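(* Let $\mathfrak{g}$ be a finite dimensional nilpotent Leibniz algebra over a field $\mathbb{F}$ with an ideal $\mathfrak{n}$. Then $$\dim(HL_2(\mathfrak{g},\mathfrak{n}))\leq\dim\left(HL_2\left(\frac{\mathfrak{g}}{\mathfrak{g}^2\cap\mathfrak{n}},\frac{\mathfrak{n}}{\mathfrak{g}^2\cap\mathfrak{n}}\right)\right)+2\dim(\mathfrak{g}^2\cap\mathfrak{n})\, d\left(\frac{\mathfrak{g}}{Z(\mathfrak{g},\mathfrak{n})}\right).$$
   Context: A (right) Leibniz algebra over a field $\mathbb{F}$ is a vector space with a bilinear bracket satisfying $[x,[y,z]]=[[x,y],z]-[[x,z],y]$. Ideals are two-sided. $\mathfrak g^2=[\mathfrak g,\mathfrak g]$; $Z(\mathfrak g)=\{z\in\mathfrak g : [z,x]=[x,z]=0 \text{ for all } x\in\mathfrak g\}$; $Z(\mathfrak g,\mathfrak n)=Z(\mathfrak g)\cap\mathfrak n$; $d(\mathfrak g)$ is the cardinality of a minimal generating set of the Leibniz algebra $\mathfrak g$. Relative homology. Let $CL_n(\mathfrak g)=\mathfrak g^{\otimes n}$, $n\ge 0$, with boundary $\partial_n(x_1\otimes\cdots\otimes x_n)=\sum_{1\le i<j\le n}(-1)^j x_1\otimes\cdots\otimes[x_i,x_j]\otimes\cdots\otimes\widehat{x_j}\otimes\cdots\otimes x_n$ (here $[x_i,x_j]$ is in position $i$). Its homology is $HL_*(\mathfrak g)$. For an ideal $\mathfrak n$ the projection $\mathfrak g\to\mathfrak g/\mathfrak n$ induces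 a chain map $\pi_*:CL_*(\mathfrak g)\to CL_*(\mathfrak g/\mathfrak n)$; let $M_*$ be its mapping cone, $M_n=CL_{n-1}(\mathfrak g)\oplus CL_n(\mathfrak g/\mathfrak n)$, $\delta_n(a,b)=(-\partial_{n-1}(a),\bar\partial_n(b)+\pi_{n-1}(a))$. Then $HL_n(\mathfrak g,\mathfrak n):=H_{n+1}(M_*,\delta_* )$. *)

theory Defs
  imports "HOL-Algebra.QuotRing" "Jordan_Normal_Form.Missing_VectorSpace"
begin

section \<open>Leibniz algebras\<close>

text \<open>The bracket \<open>[x, y]\<close> is stored in the multiplication field of the underlying module record and
  is written \<open>x \<otimes>\<^bsub>L\<^esub> y\<close>.  It is neither associative nor unital, so the locale extends
  \<^locale>\<open>vectorspace\<close> and not \<^locale>\<open>algebra\<close>; the field \<^const>\<open>one\<close> of \<open>L\<close> plays no role.\<close>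

locale leibniz_algebra = vectorspace K L
  for K and L +
  assumes bracket_closed:
      "\<lbrakk>x \<in> carrier L; y \<in> carrier L\<rbrakk> \<Longrightarrow> x \<otimes>\<^bsub>L\<^esub> y \<in> carrier L"
    and bracket_add_left:
      "\<lbrakk>x \<in> carrier L; y \<in> carrier L; z \<in> carrier L\<rbrakk>
        \<Longrightarrow> (x \<oplus>\<^bsub>L\<^esub> y) \<otimes>\<^bsub>L\<^esub> z = (x \<otimes>\<^bsub>L\<^esub> z) \<oplus>\<^bsub>L\<^esub> (y \<otimes>\<^bsub>L\<^esub> z)"
    and bracket_add_right:
      "\<lbrakk>x \<in> carrier L; y \<in> carrier L; z \<in> carrier L\<rbrakk>
        \<Longrightarrow> x \<otimes>\<^bsub>L\<^esub> (y \<oplus>\<^bsub>L\<^esub> z) = (x \<otimes>\<^bsub>L\<^esub> y) \<oplus>\<^bsub>L\<^esub> (x \<otimes>\<^bsub>L\<^esub> z)"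
    and bracket_smult_left:
      "\<lbrakk>c \<in> carrier K; x \<in> carrier L; y \<in> carrier L\<rbrakk>
        \<Longrightarrow> (c \<odot>\<^bsub>L\<^esub> x) \<otimes>\<^bsub>L\<^esub> y = c \<odot>\<^bsub>L\<^esub> (x \<otimes>\<^bsub>L\<^esub> y)"
    and bracket_smult_right:
      "\<lbrakk>c \<in> carrier K; x \<in> carrier L; y \<in> carrier L\<rbrakk>
        \<Longrightarrow> x \<otimes>\<^bsub>L\<^esub> (c \<odot>\<^bsub>L\<^esub> y) = c \<odot>\<^bsub>L\<^esub> (x \<otimes>\<^bsub>L\<^esub> y)"
    and leibniz_identity:
      "\<lbrakk>x \<in> carrier L; y \<in> carrier L; z \<in> carrier L\<rbrakk>
        \<Longrightarrow> x \<otimes>\<^bsub>L\<^esub> (y \<otimes>\<^bsub>L\<^esub> z)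
          = ((x \<otimes>\<^bsub>L\<^esub> y) \<otimes>\<^bsub>L\<^esub> z) \<ominus>\<^bsub>L\<^esub> ((x \<otimes>\<^bsub>L\<^esub> z) \<otimes>\<^bsub>L\<^esub> y)"

definition leibniz_ideal ::
  "('k, 'm) ring_scheme \<Rightarrow> 'v set \<Rightarrow> ('k, 'v, 'n) module_scheme \<Rightarrow> bool" where
  "leibniz_ideal K N L \<longleftrightarrow> submodule K N L \<and>
    (\<forall>x\<in>N. \<forall>y\<in>carrier L. x \<otimes>\<^bsub>L\<^esub> y \<in> N \<and> y \<otimes>\<^bsub>L\<^esub> x \<in> N)"

definition bracket_span ::
  "('k, 'm) ring_scheme \<Rightarrow> ('k, 'v, 'n) module_scheme \<Rightarrow> 'v set \<Rightarrow> 'v set \<Rightarrow> 'v set" where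
  "bracket_span K L A B = module.span K L {a \<otimes>\<^bsub>L\<^esub> b | a b. a \<in> A \<and> b \<in> B}"

definition leibniz_square ::
  "('k, 'm) ring_scheme \<Rightarrow> ('k, 'v, 'n) module_scheme \<Rightarrow> 'v set" where
  "leibniz_square K L = bracket_span K L (carrier L) (carrier L)"

text \<open>The indexing is shifted: \<open>lower_central K L i\<close> is the term usually written
  \<open>L\<^sup>i\<^sup>+\<^sup>1\<close>, with \<open>L\<^sup>1 = L\<close> and \<open>L\<^sup>i\<^sup>+\<^sup>1 = [L\<^sup>i, L]\<close>.\<close>

primrec lower_central ::
  "('k, 'm) ring_scheme \<Rightarrow> ('k, 'v, 'n) module_scheme \<Rightarrow> nat \<Rightarrow> 'v set" where
  "lower_central K L 0 = carrier L"
| "lower_central K L (Suc i) = bracket_span K L (lower_central K L i) (carrier L)"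

definition leibniz_nilpotent ::
  "('k, 'm) ring_scheme \<Rightarrow> ('k, 'v, 'n) module_scheme \<Rightarrow> bool" where
  "leibniz_nilpotent K L \<longleftrightarrow> (\<exists>c. lower_central K L c = {\<zero>\<^bsub>L\<^esub>})"

definition leibniz_center :: "('k, 'v, 'n) module_scheme \<Rightarrow> 'v set" where
  "leibniz_center L = {z \<in> carrier L. \<forall>x\<in>carrier L. z \<otimes>\<^bsub>L\<^esub> x = \<zero>\<^bsub>L\<^esub> \<and> x \<otimes>\<^bsub>L\<^esub> z = \<zero>\<^bsub>L\<^esub>}"

definition relative_center :: "('k, 'v, 'n) module_scheme \<Rightarrow> 'v set \<Rightarrow> 'v set" where
  "relative_center L N = leibniz_center L \<inter> N"

definition leibniz_subalgebra ::
  "('k, 'm) ring_scheme \<Rightarrow> 'v set \<Rightarrow> ('k, 'v, 'n) module_scheme \<Rightarrow> bool" where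
  "leibniz_subalgebra K H L \<longleftrightarrow> submodule K H L \<and> (\<forall>x\<in>H. \<forall>y\<in>H. x \<otimes>\<^bsub>L\<^esub> y \<in> H)"

definition leibniz_generated ::
  "('k, 'm) ring_scheme \<Rightarrow> ('k, 'v, 'n) module_scheme \<Rightarrow> 'v set \<Rightarrow> 'v set" where
  "leibniz_generated K L S = \<Inter>{H. leibniz_subalgebra K H L \<and> S \<subseteq> H}"

text \<open>The least cardinality of a finite set generating \<open>L\<close> as a Leibniz algebra.\<close>

definition generator_number ::
  "('k, 'm) ring_scheme \<Rightarrow> ('k, 'v, 'n) module_scheme \<Rightarrow> nat" where
  "generator_number K L = (LEAST n. \<exists>S. finite S \<and> card S = n \<and> S \<subseteq> carrier L \<and>
     leibniz_generated K L S = carrier L)"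


section \<open>Quotients\<close>

text \<open>The carrier, bracket and addition are those of \<^const>\<open>FactRing\<close>; scalar multiplication is
  defined on cosets in the same way as \<^const>\<open>rcoset_mult\<close>.  The construction serves both for the
  quotient of a Leibniz algebra by an ideal and for quotients of plain vector spaces, where the
  multiplication is irrelevant.\<close>

definition quotient_module ::
  "('k, 'v, 'n) module_scheme \<Rightarrow> 'v set \<Rightarrow> ('k, 'v set) module" (infixl \<open>Quotm\<close> 65) where
  "L Quotm I =
    \<lparr>carrier = a_rcosets\<^bsub>L\<^esub> I, mult = rcoset_mult L I, one = I +>\<^bsub>L\<^esub> \<one>\<^bsub>L\<^esub>, zero = I,
     add = set_add L, smult = (\<lambda>c X. \<Union>x\<in>X. I +>\<^bsub>L\<^esub> (c \<odot>\<^bsub>L\<^esub> x))\<rparr>"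

definition coset_image :: "('k, 'v, 'n) module_scheme \<Rightarrow> 'v set \<Rightarrow> 'v set \<Rightarrow> 'v set set" where
  "coset_image L I N = (\<lambda>x. I +>\<^bsub>L\<^esub> x) ` N"


section \<open>Tensor powers\<close>

definition free_module ::
  "('k, 'm) ring_scheme \<Rightarrow> 'w set \<Rightarrow> ('k, 'w \<Rightarrow> 'k) module" where
  "free_module K S = (ring.func_space K S)
    \<lparr>carrier := {f \<in> S \<rightarrow>\<^sub>E carrier K. finite {w \<in> S. f w \<noteq> \<zero>\<^bsub>K\<^esub>}}\<rparr>"

definition free_gen :: "('k, 'm) ring_scheme \<Rightarrow> 'w set \<Rightarrow> 'w \<Rightarrow> 'w \<Rightarrow> 'k" where
  "free_gen K S w = (\<lambda>v\<in>S. if v = w then \<one>\<^bsub>K\<^esub> else \<zero>\<^bsub>K\<^esub>)"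

definition words :: "('k, 'v, 'n) module_scheme \<Rightarrow> nat \<Rightarrow> 'v list set" where
  "words V n = {xs. length xs = n \<and> set xs \<subseteq> carrier V}"

abbreviation free_words ::
  "('k, 'm) ring_scheme \<Rightarrow> ('k, 'v, 'n) module_scheme \<Rightarrow> nat \<Rightarrow> ('k, 'v list \<Rightarrow> 'k) module" where
  "free_words K V n \<equiv> free_module K (words V n)"

abbreviation word_gen ::
  "('k, 'm) ring_scheme \<Rightarrow> ('k, 'v, 'n) module_scheme \<Rightarrow> nat \<Rightarrow> 'v list \<Rightarrow> 'v list \<Rightarrow> 'k" where
  "word_gen K V n \<equiv> free_gen K (words V n)"

definition multilinear_relations ::
  "('k, 'm) ring_scheme \<Rightarrow> ('k, 'v, 'n) module_scheme \<Rightarrow> nat \<Rightarrow> ('v list \<Rightarrow> 'k) set" where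
  "multilinear_relations K V n =
     {word_gen K V n (us @ (x \<oplus>\<^bsub>V\<^esub> y) # vs) \<ominus>\<^bsub>free_words K V n\<^esub>
        (word_gen K V n (us @ x # vs) \<oplus>\<^bsub>free_words K V n\<^esub> word_gen K V n (us @ y # vs))
      | us vs x y. us @ x # vs \<in> words V n \<and> y \<in> carrier V} \<union>
     {word_gen K V n (us @ (c \<odot>\<^bsub>V\<^esub> x) # vs) \<ominus>\<^bsub>free_words K V n\<^esub>
        (c \<odot>\<^bsub>free_words K V n\<^esub> word_gen K V n (us @ x # vs))
      | us vs c x. us @ x # vs \<in> words V n \<and> c \<in> carrier K}"

definition multilinear_kernel ::
  "('k, 'm) ring_scheme \<Rightarrow> ('k, 'v, 'n) module_scheme \<Rightarrow> nat \<Rightarrow> ('v list \<Rightarrow> 'k) set" where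
  "multilinear_kernel K V n = module.span K (free_words K V n) (multilinear_relations K V n)"

definition tensor_power ::
  "('k, 'm) ring_scheme \<Rightarrow> ('k, 'v, 'n) module_scheme \<Rightarrow> nat \<Rightarrow> ('k, ('v list \<Rightarrow> 'k) set) module"
  where
  "tensor_power K V n = free_words K V n Quotm multilinear_kernel K V n"

text \<open>\<open>pure_tensor K V [x\<^sub>1, \<dots>, x\<^sub>n]\<close> is \<open>x\<^sub>1 \<otimes> \<cdots> \<otimes> x\<^sub>n\<close>.\<close>

definition pure_tensor ::
  "('k, 'm) ring_scheme \<Rightarrow> ('k, 'v, 'n) module_scheme \<Rightarrow> 'v list \<Rightarrow> ('v list \<Rightarrow> 'k) set" where
  "pure_tensor K V xs = multilinear_kernel K V (length xs)
     +>\<^bsub>free_words K V (length xs)\<^esub> word_gen K V (length xs) xs"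

text \<open>The linear map on the \<open>n\<close>-th tensor power with prescribed values \<open>\<phi>\<close> on pure tensors.  It exists
  and is unique when \<open>\<phi>\<close> is multilinear; extensionality pins it down outside the carrier.\<close>

definition tensor_lift ::
  "('k, 'm) ring_scheme \<Rightarrow> ('k, 'v, 'n) module_scheme \<Rightarrow> nat \<Rightarrow> ('k, 'u, 'p) module_scheme
    \<Rightarrow> ('v list \<Rightarrow> 'u) \<Rightarrow> ('v list \<Rightarrow> 'k) set \<Rightarrow> 'u" where
  "tensor_lift K V n W \<phi> = (THE f.
     f \<in> module_hom K (tensor_power K V n) W \<inter> extensional (carrier (tensor_power K V n)) \<and>
     (\<forall>xs\<in>words V n. f (pure_tensor K V xs) = \<phi> xs))"


section \<open>The Leibniz complex and relative homology\<close>

text \<open>List positions start at \<open>0\<close>, so the sign \<open>(-1)\<^sup>j\<close> belonging to the \<open>j\<close>-th tensor factor becomes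
  \<open>(-1)\<^sup>j\<^sup>+\<^sup>1\<close>.  In the \<open>(i, j)\<close> summand the bracket \<open>[x\<^sub>i, x\<^sub>j]\<close> replaces \<open>x\<^sub>i\<close> and \<open>x\<^sub>j\<close> is deleted.\<close>

definition contract_word :: "('k, 'v, 'n) module_scheme \<Rightarrow> nat \<Rightarrow> nat \<Rightarrow> 'v list \<Rightarrow> 'v list" where
  "contract_word L i j xs =
     (let ys = xs[i := xs ! i \<otimes>\<^bsub>L\<^esub> xs ! j] in take j ys @ drop (Suc j) ys)"

text \<open>For \<open>n \<le> 1\<close> the sum is empty and \<open>\<partial>\<^sub>n\<close> is zero; in particular the truncated index \<open>0 - 1 = 0\<close> in
  the codomain is harmless.\<close>

definition leibniz_boundary ::
  "('k, 'm) ring_scheme \<Rightarrow> ('k, 'v, 'n) module_scheme \<Rightarrow> nat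
    \<Rightarrow> ('v list \<Rightarrow> 'k) set \<Rightarrow> ('v list \<Rightarrow> 'k) set" where
  "leibniz_boundary K L n = tensor_lift K L n (tensor_power K L (n - 1))
     (\<lambda>xs. \<Oplus>\<^bsub>tensor_power K L (n - 1)\<^esub>j\<in>{..<n}. \<Oplus>\<^bsub>tensor_power K L (n - 1)\<^esub>i\<in>{..<j}.
        ((\<ominus>\<^bsub>K\<^esub> \<one>\<^bsub>K\<^esub>) [^]\<^bsub>K\<^esub> Suc j) \<odot>\<^bsub>tensor_power K L (n - 1)\<^esub>
          pure_tensor K L (contract_word L i j xs))"

definition projection_chain_map ::
  "('k, 'm) ring_scheme \<Rightarrow> ('k, 'v, 'n) module_scheme \<Rightarrow> 'v set \<Rightarrow> nat
    \<Rightarrow> ('v list \<Rightarrow> 'k) set \<Rightarrow> ('v set list \<Rightarrow> 'k) set" where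
  "projection_chain_map K L N n = tensor_lift K L n (tensor_power K (L Quotm N) n)
     (\<lambda>xs. pure_tensor K (L Quotm N) (map (\<lambda>x. N +>\<^bsub>L\<^esub> x) xs))"

text \<open>\<open>M\<^sub>n = CL\<^sub>n\<^sub>-\<^sub>1(L) \<oplus> CL\<^sub>n(L/N)\<close>, where \<open>CL\<^sub>-\<^sub>1(L)\<close> is zero.\<close>

definition cone_module ::
  "('k, 'm) ring_scheme \<Rightarrow> ('k, 'v, 'n) module_scheme \<Rightarrow> 'v set \<Rightarrow> nat
    \<Rightarrow> ('k, ('v list \<Rightarrow> 'k) set \<times> ('v set list \<Rightarrow> 'k) set) module" where
  "cone_module K L N n = direct_sum
     (case n of 0 \<Rightarrow> (tensor_power K L 0)\<lparr>carrier := {\<zero>\<^bsub>tensor_power K L 0\<^esub>}\<rparr>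
              | Suc m \<Rightarrow> tensor_power K L m)
     (tensor_power K (L Quotm N) n)"

text \<open>\<open>cone_boundary K L N n\<close> is \<open>\<delta>\<^sub>n : M\<^sub>n \<rightarrow> M\<^sub>n\<^sub>-\<^sub>1\<close> for \<open>n \<ge> 1\<close>; it is not used for \<open>n = 0\<close>.\<close>

definition cone_boundary ::
  "('k, 'm) ring_scheme \<Rightarrow> ('k, 'v, 'n) module_scheme \<Rightarrow> 'v set \<Rightarrow> nat
    \<Rightarrow> ('v list \<Rightarrow> 'k) set \<times> ('v set list \<Rightarrow> 'k) set
    \<Rightarrow> ('v list \<Rightarrow> 'k) set \<times> ('v set list \<Rightarrow> 'k) set" where
  "cone_boundary K L N n = (\<lambda>(a, b).
     (\<ominus>\<^bsub>tensor_power K L (n - 2)\<^esub> leibniz_boundary K L (n - 1) a,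
      leibniz_boundary K (L Quotm N) n b
        \<oplus>\<^bsub>tensor_power K (L Quotm N) (n - 1)\<^esub> projection_chain_map K L N (n - 1) a))"

text \<open>The homology \<open>ker g / im f\<close> at \<open>B\<close> of \<open>A \<rightarrow> B \<rightarrow> C\<close>.\<close>

definition homology_module ::
  "('k, 'a, 'p) module_scheme \<Rightarrow> ('a \<Rightarrow> 'b) \<Rightarrow> ('k, 'b, 'q) module_scheme \<Rightarrow> ('b \<Rightarrow> 'c)
    \<Rightarrow> ('k, 'c, 'r) module_scheme \<Rightarrow> ('k, 'b set) module" where
  "homology_module A f B g C = B\<lparr>carrier := a_kernel B C g\<rparr> Quotm (f ` carrier A)"

text \<open>\<open>HL\<^sub>n(L, N) = H\<^sub>n\<^sub>+\<^sub>1(M\<^sub>*, \<delta>\<^sub>*)\<close>.\<close>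

definition relative_HL ::
  "('k, 'm) ring_scheme \<Rightarrow> nat \<Rightarrow> ('k, 'v, 'n) module_scheme \<Rightarrow> 'v set
    \<Rightarrow> ('k, (('v list \<Rightarrow> 'k) set \<times> ('v set list \<Rightarrow> 'k) set) set) module" where
  "relative_HL K n L N = homology_module
     (cone_module K L N (n + 2)) (cone_boundary K L N (n + 2))
     (cone_module K L N (n + 1)) (cone_boundary K L N (n + 1))
     (cone_module K L N n)"

end

theory Submission
  imports Defs
begin

text \<open>
Write \<open>g\<close> for the algebra, \<open>n\<close> for the ideal and \<open>m = g\<^sup>2 \<inter> n\<close>.  The projection \<open>g \<rightarrow> g / m\<close> induces a map of
mapping cones and from it a linear map \<open>HL\<^sub>2(g, n) \<rightarrow> HL\<^sub>2(g / m, n / m)\<close>.  By rank-nullity it is enough to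
bound the dimension of its kernel by \<open>2 dim m \<cdot> d\<close>, where \<open>d\<close> is the number of generators of \<open>g / Z(g, n)\<close>.

The map of cones is surjective, so a class in the kernel is represented by an element of degree 3 that
the map of cones kills.  Since \<open>g / n\<close> and \<open>(g / m) / (n / m)\<close> are isomorphic, only the component in
\<open>g \<otimes> g\<close> remains, and by \<open>tensor_map_kernel\<close> it lies in \<open>m \<otimes> g + g \<otimes> m\<close>.  This step is
\<open>relative_HL_2_dim_le\<close>.

Now let one of \<open>x, y, z\<close> be in \<open>n\<close>.  The tensor \<open>x \<otimes> y \<otimes> z\<close> vanishes in the tensor power of \<open>g / n\<close>, so its
boundary in the cone is, up to sign, just its Leibniz boundary.  In homology this gives the relation
\<open>[x, y] \<otimes> z \<equiv> [x, z] \<otimes> y + x \<otimes> [y, z]\<close>.  With an entry of \<open>m\<close> in one slot, it rewrites a bracket in the other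
slot by its two arguments.  With an entry of \<open>Z(g, n)\<close>, it kills \<open>g\<^sup>2 \<otimes> Z(g, n)\<close> and
\<open>Z(g, n) \<otimes> g\<^sup>2\<close>, in particular the tensors of elements of \<open>m\<close> with elements of \<open>Z(g, n)\<close>.  So
\<open>m \<otimes> g + g \<otimes> m\<close> is spanned modulo boundaries by the tensors \<open>b \<otimes> s\<close> and \<open>s \<otimes> b\<close>, where \<open>b\<close> runs through a
basis of \<open>m\<close> and \<open>s\<close> through lifts of \<open>d\<close> generators of \<open>g / Z(g, n)\<close>.  This is
\<open>pure_tensors_reduce_to_generators\<close>, and there are \<open>2 dim m \<cdot> d\<close> such tensors.

The tensor powers are handled through their universal property (\<open>tensor_lift\<close>) and through the fact that
pure tensors span; their dimension enters only through its finiteness.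
\<close>

section \<open>Linear maps and submodules\<close>

lemma module_homI:
  assumes "\<And>x. x \<in> carrier M \<Longrightarrow> f x \<in> carrier N"
    and "\<And>x y. \<lbrakk>x \<in> carrier M; y \<in> carrier M\<rbrakk> \<Longrightarrow> f (x \<oplus>\<^bsub>M\<^esub> y) = f x \<oplus>\<^bsub>N\<^esub> f y"
    and "\<And>c x. \<lbrakk>c \<in> carrier R; x \<in> carrier M\<rbrakk> \<Longrightarrow> f (c \<odot>\<^bsub>M\<^esub> x) = c \<odot>\<^bsub>N\<^esub> f x"
  shows "f \<in> module_hom R M N"
  using assms unfolding module_hom_def by blast

lemma module_hom_mem: "\<lbrakk>f \<in> module_hom R M N; x \<in> carrier M\<rbrakk> \<Longrightarrow> f x \<in> carrier N"
  using module_hom_closed by blast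

lemma module_hom_zero:
  assumes "module R M" "module R N" "f \<in> module_hom R M N"
  shows "f \<zero>\<^bsub>M\<^esub> = \<zero>\<^bsub>N\<^esub>"
  using mod_hom.f0_is_0[OF mod_hom.intro[OF assms(1,2) mod_hom_axioms.intro[OF assms(3)]]] .

lemma module_hom_neg:
  assumes "module R M" "module R N" "f \<in> module_hom R M N" "x \<in> carrier M"
  shows "f (\<ominus>\<^bsub>M\<^esub> x) = \<ominus>\<^bsub>N\<^esub> f x"
  using mod_hom.f_neg[OF mod_hom.intro[OF assms(1,2) mod_hom_axioms.intro[OF assms(3)]]] assms(4)
  by blast

lemma module_hom_minus:
  assumes "module R M" "module R N" "f \<in> module_hom R M N" "x \<in> carrier M" "y \<in> carrier M"
  shows "f (x \<ominus>\<^bsub>M\<^esub> y) = f x \<ominus>\<^bsub>N\<^esub> f y"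
proof -
  interpret M: module R M by fact
  show ?thesis
    using assms by (simp add: a_minus_def module_hom_add module_hom_neg)
qed

lemma module_hom_comp:
  "\<lbrakk>f \<in> module_hom R M N; g \<in> module_hom R N P\<rbrakk> \<Longrightarrow> (\<lambda>x. g (f x)) \<in> module_hom R M P"
  by (rule module_homI) (simp_all add: module_hom_mem module_hom_add module_hom_smult)

lemma module_hom_sum:
  assumes "module R M" "module R N" "f \<in> module_hom R M N" "g \<in> A \<rightarrow> carrier M"
  shows "f (\<Oplus>\<^bsub>M\<^esub>a\<in>A. g a) = (\<Oplus>\<^bsub>N\<^esub>a\<in>A. f (g a))"
proof -
  interpret M: module R M by fact
  interpret N: module R N by fact
  have fg: "(\<lambda>a. f (g a)) \<in> A \<rightarrow> carrier N"
    using assms(3,4) by (auto intro: module_hom_mem)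
  show ?thesis
  proof (cases "finite A")
    case True
    then show ?thesis using assms(4)
    proof induction
      case (insert a A)
      have gA: "g \<in> A \<rightarrow> carrier M" "g a \<in> carrier M" using insert by auto
      then have "(\<lambda>a. f (g a)) \<in> A \<rightarrow> carrier N" "f (g a) \<in> carrier N"
        using assms(3) by (auto intro: module_hom_mem)
      then show ?case using insert gA
        by (simp add: M.finsum_insert N.finsum_insert module_hom_add[OF assms(3)])
    qed (simp add: module_hom_zero[OF assms(1-3)])
  qed (simp add: M.finsum_infinite N.finsum_infinite module_hom_zero[OF assms(1-3)])
qed

lemma (in module) submodule_neg: "\<lbrakk>submodule R I M; x \<in> I\<rbrakk> \<Longrightarrow> \<ominus>\<^bsub>M\<^esub> x \<in> I"
  by (metis R.add.inv_closed R.one_closed smult_minus_1 submodule.smult_closed submodule.subset subsetD)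

lemma (in module) submodule_minus:
  "\<lbrakk>submodule R I M; x \<in> I; y \<in> I\<rbrakk> \<Longrightarrow> x \<ominus>\<^bsub>M\<^esub> y \<in> I"
  by (simp add: a_minus_def submodule.m_closed submodule_neg)

lemma (in module) submoduleI:
  assumes "I \<subseteq> carrier M" "\<zero>\<^bsub>M\<^esub> \<in> I"
    and "\<And>x y. \<lbrakk>x \<in> I; y \<in> I\<rbrakk> \<Longrightarrow> x \<oplus>\<^bsub>M\<^esub> y \<in> I"
    and "\<And>c x. \<lbrakk>c \<in> carrier R; x \<in> I\<rbrakk> \<Longrightarrow> c \<odot>\<^bsub>M\<^esub> x \<in> I"
  shows "submodule R I M"
  using assms module_axioms by (auto intro!: submodule.intro)

lemma submodule_vimage:
  assumes "module R M" "module R N" "f \<in> module_hom R M N" "submodule R X N"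
  shows "submodule R {x \<in> carrier M. f x \<in> X} M"
proof -
  interpret M: module R M by fact
  interpret X: submodule R X N by fact
  show ?thesis
    by (rule M.submoduleI)
      (auto simp: module_hom_zero[OF assms(1-3)] module_hom_add[OF assms(3)] module_hom_smult[OF assms(3)])
qed

lemma submodule_image:
  assumes "module R M" "module R N" "f \<in> module_hom R M N" "submodule R X M"
  shows "submodule R (f ` X) N"
proof -
  interpret M: module R M by fact
  interpret N: module R N by fact
  interpret X: submodule R X M by fact
  show ?thesis
  proof (rule N.submoduleI)
    show "f ` X \<subseteq> carrier N" using X.subset assms(3) by (auto intro: module_hom_mem)
    show "\<zero>\<^bsub>N\<^esub> \<in> f ` X" using module_hom_zero[OF assms(1-3)] X.zero_closed by (metis imageI)
    show "x \<oplus>\<^bsub>N\<^esub> y \<in> f ` X" if "x \<in> f ` X" "y \<in> f ` X" for x y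
      using that X.subset X.m_closed by (auto simp: module_hom_add[OF assms(3), symmetric] subset_iff)
    show "c \<odot>\<^bsub>N\<^esub> x \<in> f ` X" if "c \<in> carrier R" "x \<in> f ` X" for c x
      using that X.subset X.smult_closed by (auto simp: module_hom_smult[OF assms(3), symmetric] subset_iff)
  qed
qed

lemma submodule_Int:
  assumes "submodule R X M" "submodule R Y M"
  shows "submodule R (X \<inter> Y) M"
  using assms by (auto simp: submodule_def)

lemma (in module) submodule_carrier: "submodule R (carrier M) M"
  by (rule submoduleI) auto

lemma (in module) submodule_zero: "submodule R {\<zero>\<^bsub>M\<^esub>} M"
  by (rule submoduleI) auto

lemma hom_image_span_subset:
  assumes "module R M" "module R N" "f \<in> module_hom R M N" "submodule R X N"
    and "S \<subseteq> carrier M" "f ` S \<subseteq> X"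
  shows "f ` module.span R M S \<subseteq> X"
  using module.span_is_subset[OF assms(1) _ submodule_vimage[OF assms(1-4)], of S] assms(5,6)
  by blast

lemma module_hom_eq_on_span:
  assumes "module R M" "module R N" "f \<in> module_hom R M N" "g \<in> module_hom R M N"
    and "S \<subseteq> carrier M" "\<And>x. x \<in> S \<Longrightarrow> f x = g x" "x \<in> module.span R M S"
  shows "f x = g x"
proof -
  interpret M: module R M by fact
  interpret N: module R N by fact
  have "submodule R {x \<in> carrier M. f x = g x} M"
    by (rule M.submoduleI)
      (auto simp: module_hom_zero[OF assms(1-3)] module_hom_zero[OF assms(1,2,4)]
        module_hom_add[OF assms(3)] module_hom_smult[OF assms(3)]
        module_hom_add[OF assms(4)] module_hom_smult[OF assms(4)])
  from M.span_is_subset[OF _ this, of S] show ?thesis using assms(5-7) by blast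
qed

section \<open>Quotient modules\<close>

lemma (in module) submodule_abelian_subgroup:
  assumes "submodule R I M" shows "abelian_subgroup I M"
proof (rule abelian_subgroupI3)
  interpret I: submodule R I M by fact
  show "additive_subgroup I M"
    by (rule additive_subgroup.intro, rule subgroup.intro)
      (use I.subset I.m_closed I.zero_closed submodule_neg[OF assms] in \<open>auto simp: a_inv_def\<close>)
  show "abelian_group M" ..
qed

lemma (in module) coset_eq_iff:
  assumes "submodule R I M" "x \<in> carrier M" "y \<in> carrier M"
  shows "I +>\<^bsub>M\<^esub> x = I +>\<^bsub>M\<^esub> y \<longleftrightarrow> x \<ominus>\<^bsub>M\<^esub> y \<in> I"
proof -
  interpret I: abelian_subgroup I M using submodule_abelian_subgroup assms(1) .
  have "I +>\<^bsub>M\<^esub> x = I +>\<^bsub>M\<^esub> y \<longleftrightarrow> x \<in> I +>\<^bsub>M\<^esub> y"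
    using I.a_repr_independence'[of x y] I.a_rcos_self[of x] assms(2,3) by metis
  then show ?thesis
    using I.a_rcos_module[OF assms(3,2)] by (simp add: a_minus_def)
qed

lemma (in module) coset_eq_zero_iff:
  assumes "submodule R I M" "x \<in> carrier M"
  shows "I +>\<^bsub>M\<^esub> x = I \<longleftrightarrow> x \<in> I"
proof -
  interpret I: abelian_subgroup I M using submodule_abelian_subgroup assms(1) .
  show ?thesis using I.a_repr_independence'[of x "\<zero>\<^bsub>M\<^esub>"] I.a_rcos_self[OF assms(2)] I.a_subset
    by (metis M.a_coset_add_zero M.zero_closed)
qed

lemma Quotm_simps [simp]:
  "mult (M Quotm I) = rcoset_mult M I" "\<zero>\<^bsub>M Quotm I\<^esub> = I" "add (M Quotm I) = set_add M"
  by (simp_all add: quotient_module_def)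

lemma carrier_Quotm: "carrier (M Quotm I) = (\<lambda>x. I +>\<^bsub>M\<^esub> x) ` carrier M"
  by (auto simp: quotient_module_def A_RCOSETS_def')

lemma coset_in_carrier_Quotm [simp]: "x \<in> carrier M \<Longrightarrow> I +>\<^bsub>M\<^esub> x \<in> carrier (M Quotm I)"
  by (auto simp: carrier_Quotm)

lemma (in module) coset_add:
  assumes "submodule R I M" "x \<in> carrier M" "y \<in> carrier M"
  shows "(I +>\<^bsub>M\<^esub> x) \<oplus>\<^bsub>M Quotm I\<^esub> (I +>\<^bsub>M\<^esub> y) = I +>\<^bsub>M\<^esub> (x \<oplus>\<^bsub>M\<^esub> y)"
proof -
  interpret I: abelian_subgroup I M using submodule_abelian_subgroup assms(1) .
  show ?thesis using assms by (simp add: I.a_rcos_sum)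
qed

text \<open>The union over representatives in the definition of the scalar action is a union of equal cosets.\<close>

lemma (in module) coset_smult:
  assumes "submodule R I M" "c \<in> carrier R" "x \<in> carrier M"
  shows "c \<odot>\<^bsub>M Quotm I\<^esub> (I +>\<^bsub>M\<^esub> x) = I +>\<^bsub>M\<^esub> (c \<odot>\<^bsub>M\<^esub> x)"
proof -
  interpret I: abelian_subgroup I M using submodule_abelian_subgroup assms(1) .
  have *: "I +>\<^bsub>M\<^esub> (c \<odot>\<^bsub>M\<^esub> y) = I +>\<^bsub>M\<^esub> (c \<odot>\<^bsub>M\<^esub> x)" if "y \<in> I +>\<^bsub>M\<^esub> x" for y
  proof -
    obtain i where i: "i \<in> I" "y = i \<oplus>\<^bsub>M\<^esub> x" using \<open>y \<in> I +>\<^bsub>M\<^esub> x\<close> by (auto simp: a_r_coset_def')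
    then have iM: "i \<in> carrier M" using submodule.subset[OF assms(1)] by blast
    have "c \<odot>\<^bsub>M\<^esub> y \<ominus>\<^bsub>M\<^esub> c \<odot>\<^bsub>M\<^esub> x = c \<odot>\<^bsub>M\<^esub> i"
      using i iM assms by (simp add: smult_r_distr M.minus_eq M.a_assoc M.r_neg)
    then show ?thesis
      using i iM assms by (simp add: coset_eq_iff submodule.smult_closed)
  qed
  have "x \<in> I +>\<^bsub>M\<^esub> x" using I.a_rcos_self assms(3) by blast
  then have "(\<Union>y\<in>I +>\<^bsub>M\<^esub> x. I +>\<^bsub>M\<^esub> (c \<odot>\<^bsub>M\<^esub> y)) = I +>\<^bsub>M\<^esub> (c \<odot>\<^bsub>M\<^esub> x)" using * by blast
  then show ?thesis by (simp add: quotient_module_def)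
qed

lemma (in module) Quotm_module:
  assumes "submodule R I M" shows "module R (M Quotm I)"
proof (rule module_criteria)
  have c: "\<And>X. X \<in> carrier (M Quotm I) \<Longrightarrow> \<exists>x\<in>carrier M. X = I +>\<^bsub>M\<^esub> x"
    by (auto simp: carrier_Quotm)
  note [simp] = coset_add[OF assms, simplified] coset_smult[OF assms]
  have z: "I = I +>\<^bsub>M\<^esub> \<zero>\<^bsub>M\<^esub>" using coset_eq_zero_iff[OF assms] submodule.zero_closed[OF assms] by auto
  show "cring R" ..
  show "\<zero>\<^bsub>M Quotm I\<^esub> \<in> carrier (M Quotm I)" using z by (auto simp: carrier_Quotm)
  show "\<forall>v w. v \<in> carrier (M Quotm I) \<and> w \<in> carrier (M Quotm I) \<longrightarrow>
     v \<oplus>\<^bsub>M Quotm I\<^esub> w \<in> carrier (M Quotm I)"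
    by (auto simp: carrier_Quotm)
  show "\<forall>v\<in>carrier (M Quotm I). \<exists>w\<in>carrier (M Quotm I). v \<oplus>\<^bsub>M Quotm I\<^esub> w = \<zero>\<^bsub>M Quotm I\<^esub>"
  proof
    fix v assume "v \<in> carrier (M Quotm I)"
    then obtain x where x: "x \<in> carrier M" "v = I +>\<^bsub>M\<^esub> x" using c by blast
    then show "\<exists>w\<in>carrier (M Quotm I). v \<oplus>\<^bsub>M Quotm I\<^esub> w = \<zero>\<^bsub>M Quotm I\<^esub>"
      using z by (intro bexI[of _ "I +>\<^bsub>M\<^esub> (\<ominus>\<^bsub>M\<^esub> x)"]) (simp_all add: M.r_neg)
  qed
  show "\<forall>c v. c \<in> carrier R \<and> v \<in> carrier (M Quotm I) \<longrightarrow> c \<odot>\<^bsub>M Quotm I\<^esub> v \<in> carrier (M Quotm I)"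
    by (auto simp: carrier_Quotm)
  show "\<forall>v w. v \<in> carrier (M Quotm I) \<and> w \<in> carrier (M Quotm I) \<longrightarrow>
    v \<oplus>\<^bsub>M Quotm I\<^esub> w = w \<oplus>\<^bsub>M Quotm I\<^esub> v"
    by (auto simp: carrier_Quotm M.a_comm)
  show "\<forall>v w x. v \<in> carrier (M Quotm I) \<and> w \<in> carrier (M Quotm I) \<and> x \<in> carrier (M Quotm I) \<longrightarrow>
    v \<oplus>\<^bsub>M Quotm I\<^esub> w \<oplus>\<^bsub>M Quotm I\<^esub> x = v \<oplus>\<^bsub>M Quotm I\<^esub> (w \<oplus>\<^bsub>M Quotm I\<^esub> x)"
    by (auto simp: carrier_Quotm M.a_assoc)
  show "\<forall>v\<in>carrier (M Quotm I). v \<oplus>\<^bsub>M Quotm I\<^esub> \<zero>\<^bsub>M Quotm I\<^esub> = v"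
  proof
    fix v assume "v \<in> carrier (M Quotm I)"
    then obtain x where x: "x \<in> carrier M" "v = I +>\<^bsub>M\<^esub> x" using c by blast
    show "v \<oplus>\<^bsub>M Quotm I\<^esub> \<zero>\<^bsub>M Quotm I\<^esub> = v"
      using coset_add[OF assms x(1) M.zero_closed] x z by simp
  qed
  show "\<forall>a b v. a \<in> carrier R \<and> b \<in> carrier R \<and> v \<in> carrier (M Quotm I) \<longrightarrow>
    (a \<otimes> b) \<odot>\<^bsub>M Quotm I\<^esub> v = a \<odot>\<^bsub>M Quotm I\<^esub> (b \<odot>\<^bsub>M Quotm I\<^esub> v)"
    by (auto simp: carrier_Quotm smult_assoc1)
  show "\<forall>v\<in>carrier (M Quotm I). \<one> \<odot>\<^bsub>M Quotm I\<^esub> v = v"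
    by (auto simp: carrier_Quotm)
  show "\<forall>a b v. a \<in> carrier R \<and> b \<in> carrier R \<and> v \<in> carrier (M Quotm I) \<longrightarrow>
    (a \<oplus> b) \<odot>\<^bsub>M Quotm I\<^esub> v = a \<odot>\<^bsub>M Quotm I\<^esub> v \<oplus>\<^bsub>M Quotm I\<^esub> b \<odot>\<^bsub>M Quotm I\<^esub> v"
    by (auto simp: carrier_Quotm smult_l_distr)
  show "\<forall>a v w. a \<in> carrier R \<and> v \<in> carrier (M Quotm I) \<and> w \<in> carrier (M Quotm I) \<longrightarrow>
    a \<odot>\<^bsub>M Quotm I\<^esub> (v \<oplus>\<^bsub>M Quotm I\<^esub> w) = a \<odot>\<^bsub>M Quotm I\<^esub> v \<oplus>\<^bsub>M Quotm I\<^esub> a \<odot>\<^bsub>M Quotm I\<^esub> w"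
    by (auto simp: carrier_Quotm smult_r_distr)
qed

lemma (in module) coset_hom:
  assumes "submodule R I M" shows "(\<lambda>x. I +>\<^bsub>M\<^esub> x) \<in> module_hom R M (M Quotm I)"
  by (rule module_homI) (simp_all only: coset_in_carrier_Quotm coset_add[OF assms] coset_smult[OF assms])

lemma Quotm_lift:
  assumes "module R M" "module R N" "submodule R I M" "f \<in> module_hom R M N"
    and "\<And>x. x \<in> I \<Longrightarrow> f x = \<zero>\<^bsub>N\<^esub>"
  obtains g where "g \<in> module_hom R (M Quotm I) N"
    "\<And>x. x \<in> carrier M \<Longrightarrow> g (I +>\<^bsub>M\<^esub> x) = f x"
proof -
  interpret M: module R M by fact
  interpret N: module R N by fact
  define g where "g X = f (SOME x. x \<in> carrier M \<and> I +>\<^bsub>M\<^esub> x = X)" for X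
  have g: "g (I +>\<^bsub>M\<^esub> x) = f x" if x: "x \<in> carrier M" for x
  proof -
    define y where "y = (SOME y. y \<in> carrier M \<and> I +>\<^bsub>M\<^esub> y = I +>\<^bsub>M\<^esub> x)"
    have y: "y \<in> carrier M" "I +>\<^bsub>M\<^esub> y = I +>\<^bsub>M\<^esub> x"
      using someI[of "\<lambda>y. y \<in> carrier M \<and> I +>\<^bsub>M\<^esub> y = I +>\<^bsub>M\<^esub> x" x] x unfolding y_def by auto
    then have "f (y \<ominus>\<^bsub>M\<^esub> x) = \<zero>\<^bsub>N\<^esub>" using assms(5) M.coset_eq_iff[OF assms(3)] x by blast
    then have "f y \<ominus>\<^bsub>N\<^esub> f x = \<zero>\<^bsub>N\<^esub>"
      using module_hom_minus[OF assms(1,2,4) y(1) x] by simp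
    then show ?thesis
      using module_hom_mem[OF assms(4)] x y unfolding g_def y_def by simp
  qed
  have "g \<in> module_hom R (M Quotm I) N"
  proof (rule module_homI)
    show "g X \<in> carrier N" if "X \<in> carrier (M Quotm I)" for X
      using that assms(4) by (auto simp: carrier_Quotm g module_hom_mem)
    show "g (X \<oplus>\<^bsub>M Quotm I\<^esub> Y) = g X \<oplus>\<^bsub>N\<^esub> g Y"
      if "X \<in> carrier (M Quotm I)" "Y \<in> carrier (M Quotm I)" for X Y
    proof -
      obtain x y where "x \<in> carrier M" "X = I +>\<^bsub>M\<^esub> x" "y \<in> carrier M" "Y = I +>\<^bsub>M\<^esub> y"
        using \<open>X \<in> _\<close> \<open>Y \<in> _\<close> by (auto simp: carrier_Quotm)
      then show ?thesis
        by (simp add: g M.coset_add[OF assms(3)] module_hom_add[OF assms(4)] del: Quotm_simps)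
    qed
    show "g (c \<odot>\<^bsub>M Quotm I\<^esub> X) = c \<odot>\<^bsub>N\<^esub> g X"
      if "c \<in> carrier R" "X \<in> carrier (M Quotm I)" for c X
    proof -
      obtain x where "x \<in> carrier M" "X = I +>\<^bsub>M\<^esub> x"
        using \<open>X \<in> _\<close> by (auto simp: carrier_Quotm)
      then show ?thesis using \<open>c \<in> _\<close>
        by (simp add: g M.coset_smult[OF assms(3)] module_hom_smult[OF assms(4)])
    qed
  qed
  then show thesis using g that by blast
qed

section \<open>Free modules\<close>

lemma submodule_finite_support:
  assumes "cring K"
  shows "submodule K {f \<in> S \<rightarrow>\<^sub>E carrier K. finite {w \<in> S. f w \<noteq> \<zero>\<^bsub>K\<^esub>}} (ring.func_space K S)"
proof -
  interpret cring K by fact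
  interpret F: module K "func_space S" by (rule func_space_is_module)
  show ?thesis
  proof (rule F.submoduleI)
    fix x y assume xy: "x \<in> {f \<in> S \<rightarrow>\<^sub>E carrier K. finite {w \<in> S. f w \<noteq> \<zero>\<^bsub>K\<^esub>}}"
      "y \<in> {f \<in> S \<rightarrow>\<^sub>E carrier K. finite {w \<in> S. f w \<noteq> \<zero>\<^bsub>K\<^esub>}}"
    have "{w \<in> S. x w \<oplus>\<^bsub>K\<^esub> y w \<noteq> \<zero>\<^bsub>K\<^esub>} \<subseteq> {w \<in> S. x w \<noteq> \<zero>\<^bsub>K\<^esub>} \<union> {w \<in> S. y w \<noteq> \<zero>\<^bsub>K\<^esub>}" by auto
    moreover have "finite ({w \<in> S. x w \<noteq> \<zero>\<^bsub>K\<^esub>} \<union> {w \<in> S. y w \<noteq> \<zero>\<^bsub>K\<^esub>})" using xy by simp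
    ultimately have "finite {w \<in> S. x w \<oplus>\<^bsub>K\<^esub> y w \<noteq> \<zero>\<^bsub>K\<^esub>}" by (rule finite_subset)
    then show "x \<oplus>\<^bsub>func_space S\<^esub> y \<in> {f \<in> S \<rightarrow>\<^sub>E carrier K. finite {w \<in> S. f w \<noteq> \<zero>\<^bsub>K\<^esub>}}"
      using xy by (auto simp: func_space_def PiE_mem2 cong: conj_cong)
  next
    fix c x assume x: "c \<in> carrier K" "x \<in> {f \<in> S \<rightarrow>\<^sub>E carrier K. finite {w \<in> S. f w \<noteq> \<zero>\<^bsub>K\<^esub>}}"
    have "{w \<in> S. c \<otimes>\<^bsub>K\<^esub> x w \<noteq> \<zero>\<^bsub>K\<^esub>} \<subseteq> {w \<in> S. x w \<noteq> \<zero>\<^bsub>K\<^esub>}" using x by auto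
    moreover have "finite {w \<in> S. x w \<noteq> \<zero>\<^bsub>K\<^esub>}" using x by simp
    ultimately have "finite {w \<in> S. c \<otimes>\<^bsub>K\<^esub> x w \<noteq> \<zero>\<^bsub>K\<^esub>}" by (rule finite_subset)
    then show "c \<odot>\<^bsub>func_space S\<^esub> x \<in> {f \<in> S \<rightarrow>\<^sub>E carrier K. finite {w \<in> S. f w \<noteq> \<zero>\<^bsub>K\<^esub>}}"
      using x by (auto simp: func_space_def PiE_mem2 cong: conj_cong)
  qed (auto simp: func_space_def cong: conj_cong)
qed

lemma free_module_module: "cring K \<Longrightarrow> module K (free_module K S)"
  unfolding free_module_def
  by (rule module.submodule_is_module[OF cring.func_space_is_module submodule_finite_support])

lemma free_module_simps:
  assumes "cring K"
  shows "carrier (free_module K S) = {f \<in> S \<rightarrow>\<^sub>E carrier K. finite {w \<in> S. f w \<noteq> \<zero>\<^bsub>K\<^esub>}}"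
    and "\<zero>\<^bsub>free_module K S\<^esub> = (\<lambda>v\<in>S. \<zero>\<^bsub>K\<^esub>)"
    and "f \<oplus>\<^bsub>free_module K S\<^esub> g = (\<lambda>v\<in>S. f v \<oplus>\<^bsub>K\<^esub> g v)"
    and "c \<odot>\<^bsub>free_module K S\<^esub> f = (\<lambda>v\<in>S. c \<otimes>\<^bsub>K\<^esub> f v)"
  using assms by (simp_all add: free_module_def ring.func_space_def cring.axioms(1))

lemma free_gen_closed:
  assumes "cring K" shows "free_gen K S w \<in> carrier (free_module K S)"
proof -
  interpret cring K by fact
  have "{v \<in> S. free_gen K S w v \<noteq> \<zero>\<^bsub>K\<^esub>} \<subseteq> {w}" by (auto simp: free_gen_def)
  then have "finite {v \<in> S. free_gen K S w v \<noteq> \<zero>\<^bsub>K\<^esub>}" by (rule finite_subset) simp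
  then show ?thesis by (auto simp: free_module_simps[OF assms] free_gen_def)
qed

text \<open>Peeling off one point of the support at a time writes a finitely supported function as a
combination of generators.  The induction is over a finite set containing the support, so that
it does not matter whether the removed point was in the support.\<close>

lemma free_module_span:
  assumes "cring K"
  shows "module.span K (free_module K S) (free_gen K S ` S) = carrier (free_module K S)"
proof -
  interpret cring K by fact
  interpret F: module K "free_module K S" by (rule free_module_module) fact
  note s = free_module_simps[OF assms]
  have gens: "free_gen K S ` S \<subseteq> carrier (free_module K S)" by (intro image_subsetI free_gen_closed assms)
  interpret X: submodule K "F.span (free_gen K S ` S)" "free_module K S"
    by (rule F.span_is_submodule[OF gens])
  have "a \<in> F.span (free_gen K S ` S)"
    if "finite T" "a \<in> carrier (free_module K S)" "{w \<in> S. a w \<noteq> \<zero>\<^bsub>K\<^esub>} \<subseteq> T" for a T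
    using that
  proof (induction T arbitrary: a)
    case empty
    then have "a = \<zero>\<^bsub>free_module K S\<^esub>" by (auto simp: s fun_eq_iff PiE_def extensional_def)
    then show ?case using X.zero_closed by simp
  next
    case (insert t T)
    show ?case
    proof (cases "t \<in> S")
      case False
      then show ?thesis using insert by (intro insert.IH) auto
    next
      case True
      have at: "a t \<in> carrier K" using insert.prems(1) True by (auto simp: s)
      define b where "b = a(t := \<zero>\<^bsub>K\<^esub>)"
      have "{w \<in> S. b w \<noteq> \<zero>\<^bsub>K\<^esub>} \<subseteq> {w \<in> S. a w \<noteq> \<zero>\<^bsub>K\<^esub>}" by (auto simp: b_def)
      moreover have "finite {w \<in> S. a w \<noteq> \<zero>\<^bsub>K\<^esub>}" using insert.prems(1) by (simp add: s)
      ultimately have fb: "finite {w \<in> S. b w \<noteq> \<zero>\<^bsub>K\<^esub>}" by (rule finite_subset)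
      have bc: "b \<in> carrier (free_module K S)"
        using insert.prems(1) fb True by (auto simp: s b_def PiE_def extensional_def Pi_def)
      have "b \<in> F.span (free_gen K S ` S)"
        by (rule insert.IH[OF bc]) (use insert.prems(2) in \<open>auto simp: b_def\<close>)
      moreover have "free_gen K S t \<in> F.span (free_gen K S ` S)"
        using F.in_own_span[OF gens] True by blast
      moreover have "a = a t \<odot>\<^bsub>free_module K S\<^esub> free_gen K S t \<oplus>\<^bsub>free_module K S\<^esub> b"
      proof
        fix w show "a w = (a t \<odot>\<^bsub>free_module K S\<^esub> free_gen K S t \<oplus>\<^bsub>free_module K S\<^esub> b) w"
          using insert.prems(1) True at
          by (cases "w \<in> S") (auto simp: s b_def free_gen_def PiE_def extensional_def Pi_def)
      qed
      ultimately show ?thesis using at by (metis X.m_closed X.smult_closed)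
    qed
  qed
  then have "carrier (free_module K S) \<subseteq> F.span (free_gen K S ` S)"
    by (auto simp: s)
  then show ?thesis using X.subset by blast
qed

text \<open>The lift sends \<open>a\<close> to the sum of \<open>a w \<cdot> \<phi> w\<close> over the support of \<open>a\<close>.  Linearity rests on the fact
that the support may be replaced by any larger finite set, in particular by a common one for two
summands.\<close>

lemma free_module_lift:
  assumes "module K W" "\<phi> \<in> S \<rightarrow> carrier W"
  obtains f where "f \<in> module_hom K (free_module K S) W"
    "\<And>w. w \<in> S \<Longrightarrow> f (free_gen K S w) = \<phi> w"
proof -
  interpret W: module K W by fact
  have cr: "cring K" ..
  interpret F: module K "free_module K S" by (rule free_module_module[OF cr])
  note s = free_module_simps[OF cr]
  define f where "f a = (\<Oplus>\<^bsub>W\<^esub>w\<in>{w \<in> S. a w \<noteq> \<zero>\<^bsub>K\<^esub>}. a w \<odot>\<^bsub>W\<^esub> \<phi> w)" for a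
  have mem: "(\<lambda>w. a w \<odot>\<^bsub>W\<^esub> \<phi> w) \<in> T \<rightarrow> carrier W"
    if "a \<in> carrier (free_module K S)" "T \<subseteq> S" for a T
    using that assms(2) by (auto simp: s Pi_def PiE_def)
  have f: "f a = (\<Oplus>\<^bsub>W\<^esub>w\<in>T. a w \<odot>\<^bsub>W\<^esub> \<phi> w)"
    if "a \<in> carrier (free_module K S)" "finite T" "T \<subseteq> S" "{w \<in> S. a w \<noteq> \<zero>\<^bsub>K\<^esub>} \<subseteq> T" for a T
    unfolding f_def
    by (rule W.add.finprod_mono_neutral_cong_left)
      (use that mem[OF that(1,3)] assms(2) in \<open>auto simp: Pi_def\<close>)
  have "f \<in> module_hom K (free_module K S) W"
  proof (rule module_homI)
    show "f a \<in> carrier W" if "a \<in> carrier (free_module K S)" for a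
      unfolding f_def by (rule W.M.finsum_closed) (rule mem[OF that], auto)
  next
    fix a b assume ab: "a \<in> carrier (free_module K S)" "b \<in> carrier (free_module K S)"
    define T where "T = {w \<in> S. a w \<noteq> \<zero>\<^bsub>K\<^esub>} \<union> {w \<in> S. b w \<noteq> \<zero>\<^bsub>K\<^esub>}"
    have T: "finite T" "T \<subseteq> S" using ab by (auto simp: T_def s)
    have ab': "a \<oplus>\<^bsub>free_module K S\<^esub> b \<in> carrier (free_module K S)"
      using ab F.M.a_closed by blast
    have w: "a w \<in> carrier K" "b w \<in> carrier K" "\<phi> w \<in> carrier W" if "w \<in> T" for w
      using that T ab assms(2) by (auto simp: s)
    have "f (a \<oplus>\<^bsub>free_module K S\<^esub> b) = (\<Oplus>\<^bsub>W\<^esub>w\<in>T. (a \<oplus>\<^bsub>free_module K S\<^esub> b) w \<odot>\<^bsub>W\<^esub> \<phi> w)"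
      by (rule f[OF ab' T]) (auto simp: T_def s)
    also have "\<dots> = (\<Oplus>\<^bsub>W\<^esub>w\<in>T. a w \<odot>\<^bsub>W\<^esub> \<phi> w \<oplus>\<^bsub>W\<^esub> b w \<odot>\<^bsub>W\<^esub> \<phi> w)"
      by (rule W.M.finsum_cong') (use T w in \<open>auto simp: s W.smult_l_distr subset_iff\<close>)
    also have "\<dots> = f a \<oplus>\<^bsub>W\<^esub> f b"
      using f[OF ab(1) T] f[OF ab(2) T] W.M.finsum_addf[OF mem[OF ab(1) T(2)] mem[OF ab(2) T(2)]]
      by (simp add: T_def)
    finally show "f (a \<oplus>\<^bsub>free_module K S\<^esub> b) = f a \<oplus>\<^bsub>W\<^esub> f b" .
  next
    fix c a assume c: "c \<in> carrier K" and a: "a \<in> carrier (free_module K S)"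
    define T where "T = {w \<in> S. a w \<noteq> \<zero>\<^bsub>K\<^esub>}"
    have T: "finite T" "T \<subseteq> S" using a by (auto simp: T_def s)
    have ca: "c \<odot>\<^bsub>free_module K S\<^esub> a \<in> carrier (free_module K S)"
      using c a F.smult_closed by blast
    have w: "a w \<in> carrier K" "\<phi> w \<in> carrier W" if "w \<in> T" for w
      using that T a assms(2) by (auto simp: s)
    have "f (c \<odot>\<^bsub>free_module K S\<^esub> a) = (\<Oplus>\<^bsub>W\<^esub>w\<in>T. (c \<odot>\<^bsub>free_module K S\<^esub> a) w \<odot>\<^bsub>W\<^esub> \<phi> w)"
      by (rule f[OF ca T]) (use c in \<open>auto simp: T_def s\<close>)
    also have "\<dots> = (\<Oplus>\<^bsub>W\<^esub>w\<in>T. c \<odot>\<^bsub>W\<^esub> (a w \<odot>\<^bsub>W\<^esub> \<phi> w))"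
      by (rule W.M.finsum_cong') (use T w c in \<open>auto simp: s W.smult_assoc1 subset_iff\<close>)
    also have "\<dots> = c \<odot>\<^bsub>W\<^esub> (\<Oplus>\<^bsub>W\<^esub>w\<in>T. a w \<odot>\<^bsub>W\<^esub> \<phi> w)"
      using W.finsum_smult_ldistr[OF T(1) c mem[OF a T(2)]] by simp
    also have "\<dots> = c \<odot>\<^bsub>W\<^esub> f a" using f[OF a T] by (simp add: T_def)
    finally show "f (c \<odot>\<^bsub>free_module K S\<^esub> a) = c \<odot>\<^bsub>W\<^esub> f a" .
  qed
  moreover have "f (free_gen K S w) = \<phi> w" if "w \<in> S" for w
  proof -
    have "\<phi> w \<in> carrier W" using that assms(2) by auto
    moreover have "f (free_gen K S w) = (\<Oplus>\<^bsub>W\<^esub>v\<in>{w}. free_gen K S w v \<odot>\<^bsub>W\<^esub> \<phi> v)"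
      by (rule f[OF free_gen_closed[OF cr]]) (use that in \<open>auto simp: free_gen_def\<close>)
    ultimately show ?thesis using that by (simp add: free_gen_def)
  qed
  ultimately show thesis using that by blast
qed

section \<open>Tensor powers\<close>

text \<open>A slot of a word is singled out by splitting the word around it, in the same way as in the
generators of \<open>multilinear_relations\<close>.\<close>

definition multilinear ::
  "('k, 'm) ring_scheme \<Rightarrow> ('k, 'v, 'n) module_scheme \<Rightarrow> nat \<Rightarrow> ('k, 'u, 'p) module_scheme
    \<Rightarrow> ('v list \<Rightarrow> 'u) \<Rightarrow> bool" where
  "multilinear K V n W \<phi> \<longleftrightarrow> \<phi> \<in> words V n \<rightarrow> carrier W \<and>
    (\<forall>us x y vs. us @ x # vs \<in> words V n \<longrightarrow> y \<in> carrier V \<longrightarrow>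
      \<phi> (us @ (x \<oplus>\<^bsub>V\<^esub> y) # vs) = \<phi> (us @ x # vs) \<oplus>\<^bsub>W\<^esub> \<phi> (us @ y # vs)) \<and>
    (\<forall>us c x vs. us @ x # vs \<in> words V n \<longrightarrow> c \<in> carrier K \<longrightarrow>
      \<phi> (us @ (c \<odot>\<^bsub>V\<^esub> x) # vs) = c \<odot>\<^bsub>W\<^esub> \<phi> (us @ x # vs))"

lemma multilinear_closed: "\<lbrakk>multilinear K V n W \<phi>; xs \<in> words V n\<rbrakk> \<Longrightarrow> \<phi> xs \<in> carrier W"
  by (auto simp: multilinear_def)

lemma multilinear_add:
  "\<lbrakk>multilinear K V n W \<phi>; us @ x # vs \<in> words V n; y \<in> carrier V\<rbrakk>
    \<Longrightarrow> \<phi> (us @ (x \<oplus>\<^bsub>V\<^esub> y) # vs) = \<phi> (us @ x # vs) \<oplus>\<^bsub>W\<^esub> \<phi> (us @ y # vs)"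
  by (auto simp: multilinear_def)

lemma multilinear_smult:
  "\<lbrakk>multilinear K V n W \<phi>; us @ x # vs \<in> words V n; c \<in> carrier K\<rbrakk>
    \<Longrightarrow> \<phi> (us @ (c \<odot>\<^bsub>V\<^esub> x) # vs) = c \<odot>\<^bsub>W\<^esub> \<phi> (us @ x # vs)"
  by (auto simp: multilinear_def)

lemma multilinear_zero:
  assumes "module K V" "module K W" "multilinear K V n W \<phi>" "us @ \<zero>\<^bsub>V\<^esub> # vs \<in> words V n"
  shows "\<phi> (us @ \<zero>\<^bsub>V\<^esub> # vs) = \<zero>\<^bsub>W\<^esub>"
proof -
  interpret V: module K V by fact
  interpret W: module K W by fact
  show ?thesis
    using multilinear_smult[OF assms(3,4) V.R.zero_closed] multilinear_closed[OF assms(3,4)] by simp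
qed

lemma words_split:
  "us @ x # vs \<in> words V n \<longleftrightarrow> x \<in> carrier V \<and> us @ vs \<in> words V (n - 1) \<and> 0 < n"
  by (auto simp: words_def)

context module
begin

lemma multilinear_relations_closed:
  "multilinear_relations R M n \<subseteq> carrier (free_words R M n)"
proof -
  interpret F: module R "free_words R M n" by (rule free_module_module[OF R.is_cring])
  show ?thesis
    using free_gen_closed[OF R.is_cring, of "words M n"] by (auto simp: multilinear_relations_def)
qed

lemma multilinear_kernel_submodule:
  "submodule R (multilinear_kernel R M n) (free_words R M n)"
  unfolding multilinear_kernel_def
  by (rule module.span_is_submodule[OF free_module_module[OF R.is_cring] multilinear_relations_closed])

lemma tensor_power_module: "module R (tensor_power R M n)"
  unfolding tensor_power_def
  by (rule module.Quotm_module[OF free_module_module[OF R.is_cring] multilinear_kernel_submodule])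

lemma tensor_proj_hom:
  "(\<lambda>a. multilinear_kernel R M n +>\<^bsub>free_words R M n\<^esub> a) \<in> module_hom R (free_words R M n) (tensor_power R M n)"
  unfolding tensor_power_def
  by (rule module.coset_hom[OF free_module_module[OF R.is_cring] multilinear_kernel_submodule])

lemma pure_tensor_multilinear: "multilinear R M n (tensor_power R M n) (pure_tensor R M)"
proof -
  let ?F = "free_words R M n" and ?I = "multilinear_kernel R M n" and ?g = "word_gen R M n"
  let ?p = "\<lambda>a. ?I +>\<^bsub>?F\<^esub> a"
  have F: "module R ?F" by (rule free_module_module[OF R.is_cring])
  interpret F: module R ?F by fact
  note g = free_gen_closed[OF R.is_cring, of "words M n"]
  have pt: "pure_tensor R M xs = ?p (?g xs)" if "length xs = n" for xs
    using that by (auto simp: pure_tensor_def)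
  have I: "multilinear_relations R M n \<subseteq> ?I"
    unfolding multilinear_kernel_def
    by (rule module.in_own_span[OF F multilinear_relations_closed])
  have "pure_tensor R M (us @ (x \<oplus>\<^bsub>M\<^esub> y) # vs)
      = pure_tensor R M (us @ x # vs) \<oplus>\<^bsub>tensor_power R M n\<^esub> pure_tensor R M (us @ y # vs)"
    if w: "us @ x # vs \<in> words M n" "y \<in> carrier M" for us x y vs
  proof -
    have "?g (us @ (x \<oplus>\<^bsub>M\<^esub> y) # vs) \<ominus>\<^bsub>?F\<^esub> (?g (us @ x # vs) \<oplus>\<^bsub>?F\<^esub> ?g (us @ y # vs)) \<in> ?I"
      using w by (intro subsetD[OF I]) (unfold multilinear_relations_def, blast)
    then have "?p (?g (us @ (x \<oplus>\<^bsub>M\<^esub> y) # vs)) = ?p (?g (us @ x # vs) \<oplus>\<^bsub>?F\<^esub> ?g (us @ y # vs))"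
      using F.coset_eq_iff[OF multilinear_kernel_submodule] g by simp
    then show ?thesis
      using w module_hom_add[OF tensor_proj_hom g g] by (simp add: pt words_def)
  qed
  moreover have "pure_tensor R M (us @ (c \<odot>\<^bsub>M\<^esub> x) # vs)
      = c \<odot>\<^bsub>tensor_power R M n\<^esub> pure_tensor R M (us @ x # vs)"
    if w: "us @ x # vs \<in> words M n" "c \<in> carrier R" for us c x vs
  proof -
    have "?g (us @ (c \<odot>\<^bsub>M\<^esub> x) # vs) \<ominus>\<^bsub>?F\<^esub> (c \<odot>\<^bsub>?F\<^esub> ?g (us @ x # vs)) \<in> ?I"
      using w by (intro subsetD[OF I]) (unfold multilinear_relations_def, blast)
    then have "?p (?g (us @ (c \<odot>\<^bsub>M\<^esub> x) # vs)) = ?p (c \<odot>\<^bsub>?F\<^esub> ?g (us @ x # vs))"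
      using F.coset_eq_iff[OF multilinear_kernel_submodule] g w(2) by simp
    then show ?thesis
      using w module_hom_smult[OF tensor_proj_hom w(2) g] by (simp add: pt words_def)
  qed
  moreover have "pure_tensor R M \<in> words M n \<rightarrow> carrier (tensor_power R M n)"
    using module_hom_mem[OF tensor_proj_hom g] by (auto simp: pt words_def)
  ultimately show ?thesis unfolding multilinear_def by blast
qed

lemma pure_tensor_closed [simp]:
  "xs \<in> words M n \<Longrightarrow> pure_tensor R M xs \<in> carrier (tensor_power R M n)"
  by (rule multilinear_closed[OF pure_tensor_multilinear])

lemma tensor_power_span:
  "module.span R (tensor_power R M n) (pure_tensor R M ` words M n) = carrier (tensor_power R M n)"
proof -
  let ?F = "free_words R M n" and ?I = "multilinear_kernel R M n"
  have F: "module R ?F" by (rule free_module_module[OF R.is_cring])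
  interpret T: module R "tensor_power R M n" by (rule tensor_power_module)
  have sub: "pure_tensor R M ` words M n \<subseteq> carrier (tensor_power R M n)" by auto
  have "(\<lambda>a. ?I +>\<^bsub>?F\<^esub> a) ` module.span R ?F (word_gen R M n ` words M n)
      \<subseteq> T.span (pure_tensor R M ` words M n)"
  proof (rule hom_image_span_subset[OF F T.module_axioms tensor_proj_hom T.span_is_submodule[OF sub]])
    show "word_gen R M n ` words M n \<subseteq> carrier ?F" by (intro image_subsetI free_gen_closed R.is_cring)
    have "?I +>\<^bsub>?F\<^esub> word_gen R M n xs = pure_tensor R M xs" if "xs \<in> words M n" for xs
      using that by (auto simp: pure_tensor_def words_def)
    then show "(\<lambda>a. ?I +>\<^bsub>?F\<^esub> a) ` word_gen R M n ` words M n \<subseteq> T.span (pure_tensor R M ` words M n)"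
      using T.in_own_span[OF sub] by auto
  qed
  then have "carrier (tensor_power R M n) \<subseteq> T.span (pure_tensor R M ` words M n)"
    unfolding free_module_span[OF R.is_cring] by (simp add: tensor_power_def carrier_Quotm)
  then show ?thesis using T.span_is_subset2[OF sub] by blast
qed

lemma tensor_hom_eqI:
  assumes "module R W" "f \<in> module_hom R (tensor_power R M n) W" "g \<in> module_hom R (tensor_power R M n) W"
    and "\<And>xs. xs \<in> words M n \<Longrightarrow> f (pure_tensor R M xs) = g (pure_tensor R M xs)"
    and "t \<in> carrier (tensor_power R M n)"
  shows "f t = g t"
  by (rule module_hom_eq_on_span[OF tensor_power_module[of n] assms(1-3), of "pure_tensor R M ` words M n"])
    (use assms(4,5) in \<open>auto simp: tensor_power_span\<close>)

text \<open>Existence: the lift of \<open>\<phi>\<close> to the free module on words vanishes on the multilinear relations, because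
\<open>\<phi>\<close> satisfies them, and so factors through the quotient.  Uniqueness: pure tensors span.\<close>

lemma tensor_lift_unique_existence:
  assumes W: "module R W" and \<phi>: "multilinear R M n W \<phi>"
  shows "\<exists>!f. f \<in> module_hom R (tensor_power R M n) W \<inter> extensional (carrier (tensor_power R M n)) \<and>
     (\<forall>xs\<in>words M n. f (pure_tensor R M xs) = \<phi> xs)"
proof -
  interpret W: module R W by fact
  let ?F = "free_words R M n" and ?I = "multilinear_kernel R M n" and ?T = "tensor_power R M n"
  let ?g = "word_gen R M n"
  have F: "module R ?F" by (rule free_module_module[OF R.is_cring])
  interpret F: module R ?F by fact
  interpret T: module R ?T by (rule tensor_power_module)
  note gc = free_gen_closed[OF R.is_cring, of "words M n"]
  have "\<phi> \<in> words M n \<rightarrow> carrier W" using \<phi> by (auto simp: multilinear_def)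
  then obtain f where f: "f \<in> module_hom R ?F W" "\<And>xs. xs \<in> words M n \<Longrightarrow> f (?g xs) = \<phi> xs"
    using free_module_lift[OF W] by blast
  have "f r = \<zero>\<^bsub>W\<^esub>" if r: "r \<in> multilinear_relations R M n" for r
  proof -
    consider us vs x y where "us @ x # vs \<in> words M n" "y \<in> carrier M"
        "r = ?g (us @ (x \<oplus>\<^bsub>M\<^esub> y) # vs) \<ominus>\<^bsub>?F\<^esub> (?g (us @ x # vs) \<oplus>\<^bsub>?F\<^esub> ?g (us @ y # vs))"
      | us vs c x where "us @ x # vs \<in> words M n" "c \<in> carrier R"
        "r = ?g (us @ (c \<odot>\<^bsub>M\<^esub> x) # vs) \<ominus>\<^bsub>?F\<^esub> (c \<odot>\<^bsub>?F\<^esub> ?g (us @ x # vs))"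
      using r unfolding multilinear_relations_def by blast
    then show ?thesis
    proof cases
      case 1
      then have w: "us @ (x \<oplus>\<^bsub>M\<^esub> y) # vs \<in> words M n" "us @ y # vs \<in> words M n"
        by (auto simp: words_def)
      show ?thesis
        using 1 w multilinear_add[OF \<phi> 1(1,2)] multilinear_closed[OF \<phi> 1(1)] multilinear_closed[OF \<phi> w(2)]
        by (simp add: module_hom_minus[OF F W f(1)] module_hom_add[OF f(1)] gc f(2))
    next
      case 2
      then have w: "us @ (c \<odot>\<^bsub>M\<^esub> x) # vs \<in> words M n"
        by (auto simp: words_def)
      show ?thesis
        using 2 w multilinear_smult[OF \<phi> 2(1,2)] multilinear_closed[OF \<phi> 2(1)]
        by (simp add: module_hom_minus[OF F W f(1)] module_hom_smult[OF f(1)] gc f(2))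
    qed
  qed
  then have "f ` ?I \<subseteq> {\<zero>\<^bsub>W\<^esub>}"
    unfolding multilinear_kernel_def
    by (intro hom_image_span_subset[OF F W f(1) W.submodule_zero multilinear_relations_closed]) blast
  then obtain h where h: "h \<in> module_hom R ?T W" "\<And>a. a \<in> carrier ?F \<Longrightarrow> h (?I +>\<^bsub>?F\<^esub> a) = f a"
    unfolding tensor_power_def using Quotm_lift[OF F W multilinear_kernel_submodule f(1)] by blast
  have hp: "h (pure_tensor R M xs) = \<phi> xs" if "xs \<in> words M n" for xs
    using that h(2)[OF gc] f(2) by (auto simp: pure_tensor_def words_def)
  show ?thesis
  proof (rule ex1I[of _ "restrict h (carrier ?T)"])
    have "restrict h (carrier ?T) \<in> module_hom R ?T W"
      using h(1) by (auto simp: module_hom_def)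
    then show "restrict h (carrier ?T) \<in> module_hom R ?T W \<inter> extensional (carrier ?T) \<and>
       (\<forall>xs\<in>words M n. restrict h (carrier ?T) (pure_tensor R M xs) = \<phi> xs)"
      using hp by auto
  next
    fix k assume k: "k \<in> module_hom R ?T W \<inter> extensional (carrier ?T) \<and>
       (\<forall>xs\<in>words M n. k (pure_tensor R M xs) = \<phi> xs)"
    then have "k t = h t" if "t \<in> carrier ?T" for t
      using tensor_hom_eqI[OF W _ h(1) _ that, of k] hp by auto
    then show "k = restrict h (carrier ?T)"
      using k by (auto intro: extensionalityI[of _ "carrier ?T"])
  qed
qed

lemma tensor_lift:
  assumes "module R W" "multilinear R M n W \<phi>"
  shows "tensor_lift R M n W \<phi> \<in> module_hom R (tensor_power R M n) W"
    and "xs \<in> words M n \<Longrightarrow> tensor_lift R M n W \<phi> (pure_tensor R M xs) = \<phi> xs"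
  using theI'[OF tensor_lift_unique_existence[OF assms]] unfolding tensor_lift_def by blast+

end

section \<open>Induced maps of tensor powers\<close>

lemma multilinear_slot_hom:
  assumes "multilinear K V n W \<phi>" "us @ vs \<in> words V (n - 1)" "0 < n"
  shows "(\<lambda>x. \<phi> (us @ x # vs)) \<in> module_hom K V W"
proof (rule module_homI)
  have w: "us @ x # vs \<in> words V n" if "x \<in> carrier V" for x
    using that assms(2,3) by (simp add: words_split)
  show "\<phi> (us @ x # vs) \<in> carrier W" if "x \<in> carrier V" for x
    using multilinear_closed[OF assms(1) w[OF that]] .
  show "\<phi> (us @ (x \<oplus>\<^bsub>V\<^esub> y) # vs) = \<phi> (us @ x # vs) \<oplus>\<^bsub>W\<^esub> \<phi> (us @ y # vs)"
    if "x \<in> carrier V" "y \<in> carrier V" for x y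
    using multilinear_add[OF assms(1) w] that by blast
  show "\<phi> (us @ (c \<odot>\<^bsub>V\<^esub> x) # vs) = c \<odot>\<^bsub>W\<^esub> \<phi> (us @ x # vs)"
    if "c \<in> carrier K" "x \<in> carrier V" for c x
    using multilinear_smult[OF assms(1) w] that by blast
qed

lemma multilinear_comp_hom:
  assumes "multilinear K V n W \<phi>" "g \<in> module_hom K W P"
  shows "multilinear K V n P (\<lambda>xs. g (\<phi> xs))"
proof -
  have "us @ y # vs \<in> words V n" if "us @ x # vs \<in> words V n" "y \<in> carrier V" for us x y vs
    using that by (auto simp: words_def)
  with assms show ?thesis
    by (auto simp: multilinear_def module_hom_mem module_hom_add module_hom_smult Pi_iff)
qed

lemma multilinear_map:
  assumes "multilinear K W n P \<phi>" "h \<in> module_hom K V W"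
  shows "multilinear K V n P (\<lambda>xs. \<phi> (map h xs))"
proof -
  have w: "map h xs \<in> words W n" if "xs \<in> words V n" for xs
    using that module_hom_mem[OF assms(2)] by (auto simp: words_def)
  have w': "map h us @ h x # map h vs \<in> words W n" "x \<in> carrier V" if "us @ x # vs \<in> words V n" for us x vs
    using that w[OF that] by (auto simp: words_def)
  show ?thesis
    unfolding multilinear_def
    using w w' multilinear_closed[OF assms(1)] multilinear_add[OF assms(1)] multilinear_smult[OF assms(1)]
    by (auto simp: module_hom_add[OF assms(2)] module_hom_smult[OF assms(2)] module_hom_mem[OF assms(2)])
qed

definition tensor_map ::
  "('k, 'm) ring_scheme \<Rightarrow> ('k, 'v, 'n) module_scheme \<Rightarrow> ('k, 'w, 'p) module_scheme
    \<Rightarrow> ('v \<Rightarrow> 'w) \<Rightarrow> nat \<Rightarrow> ('v list \<Rightarrow> 'k) set \<Rightarrow> ('w list \<Rightarrow> 'k) set" where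
  "tensor_map K V W h n = tensor_lift K V n (tensor_power K W n) (\<lambda>xs. pure_tensor K W (map h xs))"

lemma projection_chain_map_eq:
  "projection_chain_map K L N n = tensor_map K L (L Quotm N) (\<lambda>x. N +>\<^bsub>L\<^esub> x) n"
  by (simp add: projection_chain_map_def tensor_map_def)

lemma words_map: "\<lbrakk>h \<in> module_hom K V W; xs \<in> words V n\<rbrakk> \<Longrightarrow> map h xs \<in> words W n"
  by (auto simp: words_def module_hom_mem)

lemma tensor_map:
  assumes "module K V" "module K W" "h \<in> module_hom K V W"
  shows tensor_map_hom: "tensor_map K V W h n \<in> module_hom K (tensor_power K V n) (tensor_power K W n)"
    and tensor_map_pure: "xs \<in> words V n \<Longrightarrow> tensor_map K V W h n (pure_tensor K V xs) = pure_tensor K W (map h xs)"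
  unfolding tensor_map_def
  using module.tensor_lift[OF assms(1) module.tensor_power_module[OF assms(2)]
      multilinear_map[OF module.pure_tensor_multilinear[OF assms(2)] assms(3)]]
  by auto

lemma tensor_map_square:
  assumes A: "module K A" and B: "module K B" and C: "module K C" and D: "module K D"
    and h: "h\<^sub>1 \<in> module_hom K A B" "h\<^sub>2 \<in> module_hom K B D"
    and k: "k\<^sub>1 \<in> module_hom K A C" "k\<^sub>2 \<in> module_hom K C D"
    and eq: "\<And>x. x \<in> carrier A \<Longrightarrow> h\<^sub>2 (h\<^sub>1 x) = k\<^sub>2 (k\<^sub>1 x)"
    and t: "t \<in> carrier (tensor_power K A n)"
  shows "tensor_map K B D h\<^sub>2 n (tensor_map K A B h\<^sub>1 n t) = tensor_map K C D k\<^sub>2 n (tensor_map K A C k\<^sub>1 n t)"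
proof (rule module.tensor_hom_eqI[OF A module.tensor_power_module[OF D, of n] _ _ _ t])
  show "(\<lambda>t. tensor_map K B D h\<^sub>2 n (tensor_map K A B h\<^sub>1 n t))
      \<in> module_hom K (tensor_power K A n) (tensor_power K D n)"
    by (rule module_hom_comp[OF tensor_map_hom[OF A B h(1)] tensor_map_hom[OF B D h(2)]])
  show "(\<lambda>t. tensor_map K C D k\<^sub>2 n (tensor_map K A C k\<^sub>1 n t))
      \<in> module_hom K (tensor_power K A n) (tensor_power K D n)"
    by (rule module_hom_comp[OF tensor_map_hom[OF A C k(1)] tensor_map_hom[OF C D k(2)]])
  fix xs assume xs: "xs \<in> words A n"
  then have "map h\<^sub>2 (map h\<^sub>1 xs) = map k\<^sub>2 (map k\<^sub>1 xs)" using eq by (auto simp: words_def)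
  then show "tensor_map K B D h\<^sub>2 n (tensor_map K A B h\<^sub>1 n (pure_tensor K A xs))
      = tensor_map K C D k\<^sub>2 n (tensor_map K A C k\<^sub>1 n (pure_tensor K A xs))"
    using xs words_map[OF h(1) xs] words_map[OF k(1) xs]
    by (simp add: tensor_map_pure[OF A B h(1)] tensor_map_pure[OF B D h(2)]
        tensor_map_pure[OF A C k(1)] tensor_map_pure[OF C D k(2)] del: map_map)
qed

lemma tensor_map_surj:
  assumes V: "module K V" and W: "module K W" and h: "h \<in> module_hom K V W" "h ` carrier V = carrier W"
  shows "tensor_map K V W h n ` carrier (tensor_power K V n) = carrier (tensor_power K W n)"
proof -
  interpret TV: module K "tensor_power K V n" by (rule module.tensor_power_module[OF V])
  interpret TW: module K "tensor_power K W n" by (rule module.tensor_power_module[OF W])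
  let ?f = "tensor_map K V W h n"
  note f = tensor_map_hom[OF V W h(1), of n]
  have sub: "submodule K (?f ` carrier (tensor_power K V n)) (tensor_power K W n)"
    by (rule submodule_image[OF TV.module_axioms TW.module_axioms f TV.submodule_carrier])
  have "pure_tensor K W ` words W n \<subseteq> ?f ` carrier (tensor_power K V n)"
  proof safe
    fix ws assume ws: "ws \<in> words W n"
    define vs where "vs = map (inv_into (carrier V) h) ws"
    have s: "inv_into (carrier V) h w \<in> carrier V" "h (inv_into (carrier V) h w) = w"
      if "w \<in> carrier W" for w
      using that by (auto simp: h(2)[symmetric] inv_into_into f_inv_into_f)
    have vs: "vs \<in> words V n" "map h vs = ws"
      using ws s by (auto simp: vs_def words_def map_idI subset_iff)
    then show "pure_tensor K W ws \<in> ?f ` carrier (tensor_power K V n)"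
      using tensor_map_pure[OF V W h(1) vs(1)] module.pure_tensor_closed[OF V vs(1)] by (metis imageI)
  qed
  from TW.span_is_subset[OF this sub] show ?thesis
    using submodule.subset[OF sub] by (simp add: module.tensor_power_span[OF W] subset_antisym)
qed

text \<open>This is the description of \<open>ker (h \<otimes> \<cdots> \<otimes> h)\<close> for surjective \<open>h\<close>.  Let \<open>U\<close> be the span of the pure
tensors with an entry in \<open>ker h\<close>.  Modulo \<open>U\<close> a pure tensor does not change when an entry is replaced
by another one with the same image under \<open>h\<close>.  Hence lifting the entries of a word along any
set-theoretic section of \<open>h\<close> gives a map to \<open>V\<^sup>\<otimes>\<^sup>n / U\<close> that is multilinear, although the section is not
linear.  The linear map \<open>g\<close> that it induces satisfies \<open>g \<circ> (h \<otimes> \<cdots> \<otimes> h) = q\<close> for the quotient map \<open>q\<close>, so a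
tensor killed by \<open>h \<otimes> \<cdots> \<otimes> h\<close> is killed by \<open>q\<close>.\<close>

lemma tensor_map_kernel:
  assumes V: "module K V" and W: "module K W" and h: "h \<in> module_hom K V W" "h ` carrier V = carrier W"
    and t: "t \<in> carrier (tensor_power K V n)" "tensor_map K V W h n t = \<zero>\<^bsub>tensor_power K W n\<^esub>"
  shows "t \<in> module.span K (tensor_power K V n)
    (pure_tensor K V ` {xs \<in> words V n. \<exists>x\<in>set xs. h x = \<zero>\<^bsub>W\<^esub>})"
proof -
  interpret V: module K V by fact
  interpret W: module K W by fact
  let ?TV = "tensor_power K V n" and ?TW = "tensor_power K W n"
  interpret TV: module K ?TV by (rule V.tensor_power_module)
  interpret TW: module K ?TW by (rule W.tensor_power_module)
  let ?D = "pure_tensor K V ` {xs \<in> words V n. \<exists>x\<in>set xs. h x = \<zero>\<^bsub>W\<^esub>}"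
  define U where "U = TV.span ?D"
  have D: "?D \<subseteq> carrier ?TV" by auto
  have U: "submodule K U ?TV" unfolding U_def by (rule TV.span_is_submodule[OF D])
  interpret Q: module K "?TV Quotm U" by (rule TV.Quotm_module[OF U])
  define q where "q t = U +>\<^bsub>?TV\<^esub> t" for t
  have q: "q \<in> module_hom K ?TV (?TV Quotm U)"
    unfolding q_def by (rule TV.coset_hom[OF U])
  define \<psi> where "\<psi> xs = q (pure_tensor K V xs)" for xs
  have \<psi>: "multilinear K V n (?TV Quotm U) \<psi>"
    unfolding \<psi>_def by (rule multilinear_comp_hom[OF V.pure_tensor_multilinear q])
  \<comment> \<open>Write \<open>x = z + y\<close> with \<open>z\<close> in the kernel of \<open>h\<close>; the word with \<open>z\<close> dies modulo \<open>U\<close>.\<close>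
  have slot: "\<psi> (us @ x # vs) = \<psi> (us @ y # vs)"
    if w: "us @ x # vs \<in> words V n" "y \<in> carrier V" "h x = h y" for us x y vs
  proof -
    have x: "x \<in> carrier V" using w(1) by (auto simp: words_def)
    define z where "z = x \<ominus>\<^bsub>V\<^esub> y"
    have z: "z \<in> carrier V" "h z = \<zero>\<^bsub>W\<^esub>" "x = z \<oplus>\<^bsub>V\<^esub> y"
      using x w(2,3) module_hom_mem[OF h(1)] module_hom_minus[OF V W h(1) x w(2)]
      by (simp_all add: z_def) (simp add: V.M.minus_eq V.M.a_assoc V.M.l_neg)
    have wz: "us @ z # vs \<in> words V n" "us @ y # vs \<in> words V n"
      using w z(1) by (auto simp: words_def)
    have "pure_tensor K V (us @ z # vs) \<in> ?D" using wz(1) z(2) by auto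
    then have "pure_tensor K V (us @ z # vs) \<in> U"
      unfolding U_def using TV.in_own_span[OF D] by blast
    then have "\<psi> (us @ z # vs) = \<zero>\<^bsub>?TV Quotm U\<^esub>"
      unfolding \<psi>_def q_def using TV.coset_eq_zero_iff[OF U] wz(1) by simp
    then show ?thesis
      using multilinear_add[OF \<psi> wz(1) w(2)] multilinear_closed[OF \<psi> wz(2)] z(3) by (simp del: Quotm_simps)
  qed
  have congr: "\<psi> (us @ xs) = \<psi> (us @ ys)"
    if "list_all2 (\<lambda>x y. y \<in> carrier V \<and> h x = h y) xs ys" "us @ xs \<in> words V n" for us xs ys
    using that
  proof (induction arbitrary: us rule: list_all2_induct)
    case (Cons x xs y ys)
    have w: "(us @ [y]) @ xs \<in> words V n" using Cons by (auto simp: words_def)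
    have "\<psi> (us @ x # xs) = \<psi> (us @ y # xs)" using slot Cons by blast
    also have "\<dots> = \<psi> (us @ y # ys)" using Cons.IH[OF w] by simp
    finally show ?case .
  qed simp
  \<comment> \<open>A set-theoretic section of \<open>h\<close>.\<close>
  define s where "s = inv_into (carrier V) h"
  have s: "s w \<in> carrier V" "h (s w) = w" if "w \<in> carrier W" for w
    using that by (auto simp: s_def h(2)[symmetric] inv_into_into f_inv_into_f)
  define \<phi> where "\<phi> ws = \<psi> (map s ws)" for ws
  have ws: "map s ws \<in> words V n" if "ws \<in> words W n" for ws
    using that s by (auto simp: words_def)
  have \<phi>: "multilinear K W n (?TV Quotm U) \<phi>"
    unfolding multilinear_def
  proof (intro conjI allI impI)
    show "\<phi> \<in> words W n \<rightarrow> carrier (?TV Quotm U)"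
      using multilinear_closed[OF \<psi>] ws by (auto simp: \<phi>_def)
  next
    fix us x y vs assume w: "us @ x # vs \<in> words W n" and y: "y \<in> carrier W"
    have x: "x \<in> carrier W" using w by (auto simp: words_def)
    have w': "map s us @ s x # map s vs \<in> words V n" using ws[OF w] by simp
    have "us @ (x \<oplus>\<^bsub>W\<^esub> y) # vs \<in> words W n" using w y by (auto simp: words_def)
    from ws[OF this] have "\<phi> (us @ (x \<oplus>\<^bsub>W\<^esub> y) # vs) = \<psi> (map s us @ (s x \<oplus>\<^bsub>V\<^esub> s y) # map s vs)"
      unfolding \<phi>_def map_append list.map
      by (rule slot) (use x y s in \<open>simp_all add: module_hom_add[OF h(1)]\<close>)
    then show "\<phi> (us @ (x \<oplus>\<^bsub>W\<^esub> y) # vs)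
        = \<phi> (us @ x # vs) \<oplus>\<^bsub>?TV Quotm U\<^esub> \<phi> (us @ y # vs)"
      using multilinear_add[OF \<psi> w' s(1)[OF y]] by (simp add: \<phi>_def del: Quotm_simps)
  next
    fix us c x vs assume w: "us @ x # vs \<in> words W n" and c: "c \<in> carrier K"
    have x: "x \<in> carrier W" using w by (auto simp: words_def)
    have w': "map s us @ s x # map s vs \<in> words V n" using ws[OF w] by simp
    have "us @ (c \<odot>\<^bsub>W\<^esub> x) # vs \<in> words W n" using w c by (auto simp: words_def)
    from ws[OF this] have "\<phi> (us @ (c \<odot>\<^bsub>W\<^esub> x) # vs) = \<psi> (map s us @ (c \<odot>\<^bsub>V\<^esub> s x) # map s vs)"
      unfolding \<phi>_def map_append list.map
      by (rule slot) (use x c s in \<open>simp_all add: module_hom_smult[OF h(1)]\<close>)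
    then show "\<phi> (us @ (c \<odot>\<^bsub>W\<^esub> x) # vs) = c \<odot>\<^bsub>?TV Quotm U\<^esub> \<phi> (us @ x # vs)"
      using multilinear_smult[OF \<psi> w' c] by (simp add: \<phi>_def)
  qed
  define g where "g = tensor_lift K W n (?TV Quotm U) \<phi>"
  have g: "g \<in> module_hom K ?TW (?TV Quotm U)"
    and g_pure: "\<And>ws. ws \<in> words W n \<Longrightarrow> g (pure_tensor K W ws) = \<phi> ws"
    unfolding g_def using W.tensor_lift[OF Q.module_axioms \<phi>] by auto
  have "g (tensor_map K V W h n t) = q t"
  proof (rule V.tensor_hom_eqI[OF Q.module_axioms _ q _ t(1)])
    show "(\<lambda>t. g (tensor_map K V W h n t)) \<in> module_hom K ?TV (?TV Quotm U)"
      by (rule module_hom_comp[OF tensor_map_hom[OF V W h(1)] g])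
    fix xs assume xs: "xs \<in> words V n"
    have mem: "\<And>x. x \<in> set xs \<Longrightarrow> x \<in> carrier V" using xs by (auto simp: words_def)
    have "\<psi> ([] @ map s (map h xs)) = \<psi> ([] @ xs)"
      by (rule congr) (use mem s ws[OF words_map[OF h(1) xs]] module_hom_mem[OF h(1)] in
          \<open>auto simp: list_all2_conv_all_nth\<close>)
    then show "g (tensor_map K V W h n (pure_tensor K V xs)) = q (pure_tensor K V xs)"
      using xs by (simp add: tensor_map_pure[OF V W h(1)] g_pure words_map[OF h(1)] \<phi>_def \<psi>_def)
  qed
  then have "q t = \<zero>\<^bsub>?TV Quotm U\<^esub>"
    using t(2) module_hom_zero[OF TW.module_axioms Q.module_axioms g] by simp
  then show ?thesis
    using TV.coset_eq_zero_iff[OF U t(1)] by (simp add: q_def U_def)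
qed

text \<open>The entries of a word are moved into the span of \<open>S\<close> one slot at a time: once all entries to the right
of a slot lie in \<open>S\<close>, linearity in that slot reduces it to elements of \<open>S\<close> as well.\<close>

lemma tensor_power_span_finite:
  assumes V: "module K V" and S: "S \<subseteq> carrier V" "module.span K V S = carrier V"
  shows "module.span K (tensor_power K V n) (pure_tensor K V ` {xs. set xs \<subseteq> S \<and> length xs = n})
    = carrier (tensor_power K V n)"
proof -
  interpret V: module K V by fact
  let ?T = "tensor_power K V n"
  interpret T: module K ?T by (rule V.tensor_power_module)
  let ?G = "pure_tensor K V ` {xs. set xs \<subseteq> S \<and> length xs = n}"
  have "{xs. set xs \<subseteq> S \<and> length xs = n} \<subseteq> words V n"
    using S(1) by (auto simp: words_def)
  then have G: "?G \<subseteq> carrier ?T" by auto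
  let ?X = "T.span ?G"
  have X: "submodule K ?X ?T" by (rule T.span_is_submodule[OF G])
  have "pure_tensor K V (us @ vs) \<in> ?X"
    if "us @ vs \<in> words V n" "set vs \<subseteq> S" for us vs
    using that
  proof (induction us arbitrary: vs rule: rev_induct)
    case Nil
    then show ?case using T.in_own_span[OF G] by (auto simp: words_def)
  next
    case (snoc u us)
    let ?f = "\<lambda>x. pure_tensor K V (us @ x # vs)"
    have w: "us @ vs \<in> words V (n - 1)" "0 < n" "u \<in> carrier V" using snoc.prems(1) by (auto simp: words_def)
    have f: "?f \<in> module_hom K V ?T"
      by (rule multilinear_slot_hom[OF V.pure_tensor_multilinear w(1,2)])
    have "?f ` V.span S \<subseteq> ?X"
    proof (rule hom_image_span_subset[OF V T.module_axioms f X S(1)], safe)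
      fix x assume x: "x \<in> S"
      then have "us @ x # vs \<in> words V n" using snoc.prems S(1) by (auto simp: words_def)
      then show "pure_tensor K V (us @ x # vs) \<in> ?X" using snoc.IH[of "x # vs"] snoc.prems(2) x by auto
    qed
    then show ?case using w(3) S(2) by auto
  qed
  from this[of _ "[]"] have "pure_tensor K V ` words V n \<subseteq> ?X" by auto
  from T.span_is_subset[OF this X] show ?thesis
    using T.span_is_subset2[OF G] by (simp add: V.tensor_power_span)
qed

lemma tensor_power_fin_dim:
  assumes "vectorspace K V" "vectorspace.fin_dim K V"
  shows "vectorspace K (tensor_power K V n)" "vectorspace.fin_dim K (tensor_power K V n)"
proof -
  interpret V: vectorspace K V by fact
  show T: "vectorspace K (tensor_power K V n)"
    by (intro vectorspace.intro V.tensor_power_module V.field_axioms)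
  obtain S where S: "finite S" "S \<subseteq> carrier V" "V.span S = carrier V"
    using assms(2) unfolding V.fin_dim_def by blast
  let ?G = "pure_tensor K V ` {xs. set xs \<subseteq> S \<and> length xs = n}"
  have "finite ?G" using finite_lists_length_eq[OF S(1)] by blast
  moreover have "{xs. set xs \<subseteq> S \<and> length xs = n} \<subseteq> words V n"
    using S(2) by (auto simp: words_def)
  then have "?G \<subseteq> carrier (tensor_power K V n)" by auto
  ultimately show "vectorspace.fin_dim K (tensor_power K V n)"
    unfolding vectorspace.fin_dim_def[OF T]
    using tensor_power_span_finite[OF V.module_axioms S(2,3)] by blast
qed

section \<open>The Leibniz boundary\<close>

text \<open>Multilinearity through list updates.  Contracting a word moves its entries, and an updated position is
easier to follow through the contraction than a splitting of the word.\<close>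

lemma multilinear_updateI:
  assumes "\<And>xs. xs \<in> words V n \<Longrightarrow> \<phi> xs \<in> carrier W"
    and "\<And>xs k. \<lbrakk>xs \<in> words V n; k < n\<rbrakk> \<Longrightarrow> (\<lambda>x. \<phi> (xs[k := x])) \<in> module_hom K V W"
  shows "multilinear K V n W \<phi>"
proof -
  have upd: "us @ z # vs = (us @ x # vs)[length us := z]" for us x z and vs :: "'b list" by simp
  show ?thesis
    unfolding multilinear_def
  proof (intro conjI allI impI)
    fix us x y vs assume w: "us @ x # vs \<in> words V n" "y \<in> carrier V"
    then have "length us < n" "x \<in> carrier V" by (auto simp: words_def)
    then show "\<phi> (us @ (x \<oplus>\<^bsub>V\<^esub> y) # vs) = \<phi> (us @ x # vs) \<oplus>\<^bsub>W\<^esub> \<phi> (us @ y # vs)"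
      using module_hom_add[OF assms(2)[OF w(1)], of "length us" x y] w(2) by simp
  next
    fix us c x vs assume w: "us @ x # vs \<in> words V n" "c \<in> carrier K"
    then have "length us < n" "x \<in> carrier V" by (auto simp: words_def)
    then show "\<phi> (us @ (c \<odot>\<^bsub>V\<^esub> x) # vs) = c \<odot>\<^bsub>W\<^esub> \<phi> (us @ x # vs)"
      using module_hom_smult[OF assms(2)[OF w(1)], of "length us" c x] w(2) by simp
  qed (use assms(1) in auto)
qed

lemma multilinear_update_hom:
  assumes "multilinear K V n W \<phi>" "xs \<in> words V n" "k < n"
  shows "(\<lambda>x. \<phi> (xs[k := x])) \<in> module_hom K V W"
proof -
  have k: "k < length xs" using assms(2,3) by (simp add: words_def)
  have "take k xs @ drop (Suc k) xs \<in> words V (n - 1)" "0 < n"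
    using assms(2,3) by (auto simp: words_def dest: in_set_takeD in_set_dropD)
  from multilinear_slot_hom[OF assms(1) this] show ?thesis
    by (simp add: upd_conv_take_nth_drop[OF k])
qed

lemma multilinear_sum:
  assumes W: "module K W" and A: "finite A" "\<And>a. a \<in> A \<Longrightarrow> multilinear K V n W (\<phi> a)"
  shows "multilinear K V n W (\<lambda>xs. \<Oplus>\<^bsub>W\<^esub>a\<in>A. \<phi> a xs)"
proof -
  interpret W: module K W by fact
  note cl = multilinear_closed[OF A(2)]
  show ?thesis
    unfolding multilinear_def
  proof (intro conjI allI impI)
    show "(\<lambda>xs. \<Oplus>\<^bsub>W\<^esub>a\<in>A. \<phi> a xs) \<in> words V n \<rightarrow> carrier W"
      by (auto intro!: W.M.finsum_closed cl)
  next
    fix us x y vs assume w: "us @ x # vs \<in> words V n" "y \<in> carrier V"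
    then have w': "us @ y # vs \<in> words V n" by (auto simp: words_def)
    have "(\<Oplus>\<^bsub>W\<^esub>a\<in>A. \<phi> a (us @ (x \<oplus>\<^bsub>V\<^esub> y) # vs))
        = (\<Oplus>\<^bsub>W\<^esub>a\<in>A. \<phi> a (us @ x # vs) \<oplus>\<^bsub>W\<^esub> \<phi> a (us @ y # vs))"
      by (rule W.M.finsum_cong') (use multilinear_add[OF A(2) w] cl w w' in auto)
    also have "\<dots> = (\<Oplus>\<^bsub>W\<^esub>a\<in>A. \<phi> a (us @ x # vs)) \<oplus>\<^bsub>W\<^esub> (\<Oplus>\<^bsub>W\<^esub>a\<in>A. \<phi> a (us @ y # vs))"
      by (rule W.M.finsum_addf) (use cl w w' in auto)
    finally show "(\<Oplus>\<^bsub>W\<^esub>a\<in>A. \<phi> a (us @ (x \<oplus>\<^bsub>V\<^esub> y) # vs))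
        = (\<Oplus>\<^bsub>W\<^esub>a\<in>A. \<phi> a (us @ x # vs)) \<oplus>\<^bsub>W\<^esub> (\<Oplus>\<^bsub>W\<^esub>a\<in>A. \<phi> a (us @ y # vs))" .
  next
    fix us c x vs assume w: "us @ x # vs \<in> words V n" "c \<in> carrier K"
    have "(\<Oplus>\<^bsub>W\<^esub>a\<in>A. \<phi> a (us @ (c \<odot>\<^bsub>V\<^esub> x) # vs)) = (\<Oplus>\<^bsub>W\<^esub>a\<in>A. c \<odot>\<^bsub>W\<^esub> \<phi> a (us @ x # vs))"
      by (rule W.M.finsum_cong') (use multilinear_smult[OF A(2) w] cl w in auto)
    also have "\<dots> = c \<odot>\<^bsub>W\<^esub> (\<Oplus>\<^bsub>W\<^esub>a\<in>A. \<phi> a (us @ x # vs))"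
      by (rule W.finsum_smult_ldistr[symmetric]) (use A(1) cl w in auto)
    finally show "(\<Oplus>\<^bsub>W\<^esub>a\<in>A. \<phi> a (us @ (c \<odot>\<^bsub>V\<^esub> x) # vs)) = c \<odot>\<^bsub>W\<^esub> (\<Oplus>\<^bsub>W\<^esub>a\<in>A. \<phi> a (us @ x # vs))" .
  qed
qed

lemma (in module) smult_hom:
  "c \<in> carrier R \<Longrightarrow> (\<lambda>x. c \<odot>\<^bsub>M\<^esub> x) \<in> module_hom R M M"
  by (rule module_homI) (auto simp: smult_r_distr smult_assoc1[symmetric] R.m_comm)

lemma length_contract_word: "\<lbrakk>i < j; j < length xs\<rbrakk> \<Longrightarrow> length (contract_word L i j xs) = length xs - 1"
  by (simp add: contract_word_def)

lemma nth_contract_word: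
  "\<lbrakk>i < j; j < length xs; p < length xs - 1\<rbrakk> \<Longrightarrow> contract_word L i j xs ! p =
    (if p = i then xs ! i \<otimes>\<^bsub>L\<^esub> xs ! j else if p < j then xs ! p else xs ! Suc p)"
  by (auto simp: contract_word_def nth_append min_def)

text \<open>Positions to the right of the deleted position \<open>j\<close> move down by one.\<close>

lemma contract_word_update_other:
  assumes "i < j" "j < length xs" "k < length xs" "k \<noteq> i" "k \<noteq> j"
  shows "contract_word L i j (xs[k := x]) = (contract_word L i j xs)[(if k < j then k else k - 1) := x]"
  by (rule nth_equalityI)
    (use assms in \<open>auto simp: length_contract_word nth_contract_word nth_list_update\<close>)

lemma contract_word_update_left:
  assumes "i < j" "j < length xs"
  shows "contract_word L i j (xs[i := x]) = (contract_word L i j xs)[i := x \<otimes>\<^bsub>L\<^esub> xs ! j]"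
  by (rule nth_equalityI)
    (use assms in \<open>auto simp: length_contract_word nth_contract_word nth_list_update\<close>)

lemma contract_word_update_right:
  assumes "i < j" "j < length xs"
  shows "contract_word L i j (xs[j := x]) = (contract_word L i j xs)[i := xs ! i \<otimes>\<^bsub>L\<^esub> x]"
  by (rule nth_equalityI)
    (use assms in \<open>auto simp: length_contract_word nth_contract_word nth_list_update\<close>)

definition leibniz_hom ::
  "('k, 'm) ring_scheme \<Rightarrow> ('k, 'v, 'n) module_scheme \<Rightarrow> ('k, 'w, 'p) module_scheme \<Rightarrow> ('v \<Rightarrow> 'w) set"
  where "leibniz_hom K A B = {f \<in> module_hom K A B.
    \<forall>x\<in>carrier A. \<forall>y\<in>carrier A. f (x \<otimes>\<^bsub>A\<^esub> y) = f x \<otimes>\<^bsub>B\<^esub> f y}"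

lemma map_contract_word:
  assumes "f \<in> leibniz_hom K A B" "xs \<in> words A n" "i < j" "j < n"
  shows "map f (contract_word A i j xs) = contract_word B i j (map f xs)"
proof -
  have "xs ! k \<in> carrier A" if "k < n" for k using that assms(2) by (auto simp: words_def)
  then show ?thesis
    using assms
    by (intro nth_equalityI) (auto simp: length_contract_word nth_contract_word words_def leibniz_hom_def)
qed

context leibniz_algebra
begin

lemma bracket_left_hom: "y \<in> carrier L \<Longrightarrow> (\<lambda>x. x \<otimes>\<^bsub>L\<^esub> y) \<in> module_hom K L L"
  by (rule module_homI) (simp_all add: bracket_closed bracket_add_left bracket_smult_left)

lemma bracket_right_hom: "x \<in> carrier L \<Longrightarrow> (\<lambda>y. x \<otimes>\<^bsub>L\<^esub> y) \<in> module_hom K L L"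
  by (rule module_homI) (simp_all add: bracket_closed bracket_add_right bracket_smult_right)

lemma contract_word_closed:
  assumes "xs \<in> words L n" "i < j" "j < n"
  shows "contract_word L i j xs \<in> words L (n - 1)"
proof -
  have mem: "xs ! k \<in> carrier L" if "k < n" for k using that assms(1) by (auto simp: words_def)
  have "contract_word L i j xs ! p \<in> carrier L" if "p < n - 1" for p
    using that assms mem[of i] mem[of j] mem[of p] mem[of "Suc p"]
    by (auto simp: nth_contract_word words_def bracket_closed)
  then show ?thesis
    using assms by (auto simp: words_def length_contract_word in_set_conv_nth)
qed

text \<open>The entries \<open>i\<close> and \<open>j\<close> enter through the bracket, which is linear in each argument; every other entry
is merely moved.\<close>

lemma contract_word_multilinear:
  assumes "i < j" "j < n"
  shows "multilinear K L n (tensor_power K L (n - 1)) (\<lambda>xs. pure_tensor K L (contract_word L i j xs))"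
proof (rule multilinear_updateI)
  show "pure_tensor K L (contract_word L i j xs) \<in> carrier (tensor_power K L (n - 1))"
    if "xs \<in> words L n" for xs
    using contract_word_closed[OF that assms] by simp
  fix xs k assume xs: "xs \<in> words L n" and k: "k < n"
  have len: "length xs = n" using xs by (simp add: words_def)
  have mem: "xs ! p \<in> carrier L" if "p < n" for p using that xs by (auto simp: words_def)
  have i: "i < n - 1" using assms by simp
  note hom = multilinear_update_hom[OF pure_tensor_multilinear contract_word_closed[OF xs assms]]
  consider "k = i" | "k = j" | "k \<noteq> i" "k \<noteq> j" by blast
  then show "(\<lambda>x. pure_tensor K L (contract_word L i j (xs[k := x])))
      \<in> module_hom K L (tensor_power K L (n - 1))"
  proof cases
    case 1
    show ?thesis
      using module_hom_comp[OF bracket_left_hom[OF mem[OF assms(2)]] hom[OF i]] assms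
      by (simp add: 1 contract_word_update_left len)
  next
    case 2
    show ?thesis
      using module_hom_comp[OF bracket_right_hom[OF mem[of i]] hom[OF i]] assms
      by (simp add: 2 contract_word_update_right len)
  next
    case 3
    define k' where "k' = (if k < j then k else k - 1)"
    have "k' < n - 1" using k 3 assms by (auto simp: k'_def)
    moreover have "contract_word L i j (xs[k := x]) = (contract_word L i j xs)[k' := x]" for x
      unfolding k'_def by (rule contract_word_update_other) (use 3 k assms len in auto)
    ultimately show ?thesis using hom[of k'] by simp
  qed
qed

lemma boundary_multilinear:
  "multilinear K L n (tensor_power K L (n - 1))
     (\<lambda>xs. \<Oplus>\<^bsub>tensor_power K L (n - 1)\<^esub>j\<in>{..<n}. \<Oplus>\<^bsub>tensor_power K L (n - 1)\<^esub>i\<in>{..<j}.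
        ((\<ominus>\<^bsub>K\<^esub> \<one>\<^bsub>K\<^esub>) [^]\<^bsub>K\<^esub> Suc j) \<odot>\<^bsub>tensor_power K L (n - 1)\<^esub>
          pure_tensor K L (contract_word L i j xs))"
proof -
  interpret T: module K "tensor_power K L (n - 1)" by (rule tensor_power_module)
  show ?thesis
    by (intro multilinear_sum[OF T.module_axioms] multilinear_comp_hom[OF contract_word_multilinear T.smult_hom])
      (auto simp: R.nat_pow_closed)
qed

lemma
  shows boundary_hom: "leibniz_boundary K L n \<in> module_hom K (tensor_power K L n) (tensor_power K L (n - 1))"
    and boundary_pure: "xs \<in> words L n \<Longrightarrow> leibniz_boundary K L n (pure_tensor K L xs) =
       (\<Oplus>\<^bsub>tensor_power K L (n - 1)\<^esub>j\<in>{..<n}. \<Oplus>\<^bsub>tensor_power K L (n - 1)\<^esub>i\<in>{..<j}.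
        ((\<ominus>\<^bsub>K\<^esub> \<one>\<^bsub>K\<^esub>) [^]\<^bsub>K\<^esub> Suc j) \<odot>\<^bsub>tensor_power K L (n - 1)\<^esub>
          pure_tensor K L (contract_word L i j xs))"
  unfolding leibniz_boundary_def
  using tensor_lift[OF tensor_power_module boundary_multilinear[of n]] by blast+

lemma boundary_pure_3:
  assumes "x \<in> carrier L" "y \<in> carrier L" "z \<in> carrier L"
  shows "leibniz_boundary K L 3 (pure_tensor K L [x, y, z]) =
    pure_tensor K L [x \<otimes>\<^bsub>L\<^esub> y, z] \<ominus>\<^bsub>tensor_power K L 2\<^esub>
      (pure_tensor K L [x \<otimes>\<^bsub>L\<^esub> z, y] \<oplus>\<^bsub>tensor_power K L 2\<^esub> pure_tensor K L [x, y \<otimes>\<^bsub>L\<^esub> z])"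
proof -
  let ?T = "tensor_power K L 2"
  interpret T: module K ?T by (rule tensor_power_module)
  have w: "[x, y, z] \<in> words L 3" using assms by (simp add: words_def)
  have cl: "[a, b] \<in> words L 2" if "a \<in> carrier L" "b \<in> carrier L" for a b
    using that by (simp add: words_def)
  note c = pure_tensor_closed[OF cl] bracket_closed
  have s: "{..<3::nat} = {0, 1, 2}" "{..<2::nat} = {0, 1}" "{..<1::nat} = {0}" by auto
  have neg: "(\<ominus>\<^bsub>K\<^esub> \<one>\<^bsub>K\<^esub>) \<odot>\<^bsub>?T\<^esub> t = \<ominus>\<^bsub>?T\<^esub> t" if "t \<in> carrier ?T" for t
    using T.smult_minus_1 that by simp
  have p: "(\<ominus>\<^bsub>K\<^esub> \<one>\<^bsub>K\<^esub>) [^]\<^bsub>K\<^esub> Suc 1 = \<one>\<^bsub>K\<^esub>" "(\<ominus>\<^bsub>K\<^esub> \<one>\<^bsub>K\<^esub>) [^]\<^bsub>K\<^esub> Suc 2 = \<ominus>\<^bsub>K\<^esub> \<one>\<^bsub>K\<^esub>"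
    by (simp_all add: numeral_2_eq_2 R.l_minus)
  have cw: "contract_word L 0 1 [x, y, z] = [x \<otimes>\<^bsub>L\<^esub> y, z]" "contract_word L 0 2 [x, y, z] = [x \<otimes>\<^bsub>L\<^esub> z, y]"
    "contract_word L 1 2 [x, y, z] = [x, y \<otimes>\<^bsub>L\<^esub> z]"
    by (simp_all add: contract_word_def numeral_2_eq_2)
  define g where "g i j = ((\<ominus>\<^bsub>K\<^esub> \<one>\<^bsub>K\<^esub>) [^]\<^bsub>K\<^esub> Suc j) \<odot>\<^bsub>?T\<^esub> pure_tensor K L (contract_word L i j [x, y, z])" for i j
  have g: "g 0 1 = pure_tensor K L [x \<otimes>\<^bsub>L\<^esub> y, z]" "g 0 2 = \<ominus>\<^bsub>?T\<^esub> pure_tensor K L [x \<otimes>\<^bsub>L\<^esub> z, y]"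
      "g 1 2 = \<ominus>\<^bsub>?T\<^esub> pure_tensor K L [x, y \<otimes>\<^bsub>L\<^esub> z]"
    unfolding g_def p cw using assms by (simp_all add: c neg)
  have G: "(\<Oplus>\<^bsub>?T\<^esub>i\<in>{..<0}. g i 0) = \<zero>\<^bsub>?T\<^esub>" "(\<Oplus>\<^bsub>?T\<^esub>i\<in>{..<1}. g i 1) = g 0 1"
      "(\<Oplus>\<^bsub>?T\<^esub>i\<in>{..<2}. g i 2) = g 0 2 \<oplus>\<^bsub>?T\<^esub> g 1 2"
    unfolding s using g assms by (simp_all add: c)
  have "leibniz_boundary K L 3 (pure_tensor K L [x, y, z]) = (\<Oplus>\<^bsub>?T\<^esub>j\<in>{0, 1, 2}. \<Oplus>\<^bsub>?T\<^esub>i\<in>{..<j}. g i j)"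
    using boundary_pure[OF w] by (simp add: s g_def)
  also have "\<dots> = (\<Oplus>\<^bsub>?T\<^esub>i\<in>{..<0}. g i 0) \<oplus>\<^bsub>?T\<^esub> ((\<Oplus>\<^bsub>?T\<^esub>i\<in>{..<1}. g i 1) \<oplus>\<^bsub>?T\<^esub> (\<Oplus>\<^bsub>?T\<^esub>i\<in>{..<2}. g i 2))"
    using G g assms by (simp add: c)
  also have "\<dots> = pure_tensor K L [x \<otimes>\<^bsub>L\<^esub> y, z] \<oplus>\<^bsub>?T\<^esub>
      (\<ominus>\<^bsub>?T\<^esub> pure_tensor K L [x \<otimes>\<^bsub>L\<^esub> z, y] \<oplus>\<^bsub>?T\<^esub> \<ominus>\<^bsub>?T\<^esub> pure_tensor K L [x, y \<otimes>\<^bsub>L\<^esub> z])"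
    unfolding G g using assms by (simp add: c)
  finally show ?thesis
    using assms by (simp add: c a_minus_def T.M.minus_add)
qed

end

text \<open>A homomorphism commutes with every contraction, hence termwise with the boundary.\<close>

lemma tensor_map_boundary:
  assumes A: "leibniz_algebra K A" and B: "leibniz_algebra K B" and f: "f \<in> leibniz_hom K A B"
    and t: "t \<in> carrier (tensor_power K A n)"
  shows "tensor_map K A B f (n - 1) (leibniz_boundary K A n t) = leibniz_boundary K B n (tensor_map K A B f n t)"
proof -
  interpret A: leibniz_algebra K A by fact
  interpret B: leibniz_algebra K B by fact
  have fh: "f \<in> module_hom K A B" using f by (simp add: leibniz_hom_def)
  note tm = tensor_map_hom[OF A.module_axioms B.module_axioms fh]
  note tp = tensor_map_pure[OF A.module_axioms B.module_axioms fh]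
  let ?TA = "tensor_power K A (n - 1)" and ?TB = "tensor_power K B (n - 1)"
  interpret TA: module K ?TA by (rule A.tensor_power_module)
  interpret TB: module K ?TB by (rule B.tensor_power_module)
  let ?s = "\<lambda>j. (\<ominus>\<^bsub>K\<^esub> \<one>\<^bsub>K\<^esub>) [^]\<^bsub>K\<^esub> Suc j"
  have sg: "?s j \<in> carrier K" for j by simp
  show ?thesis
  proof (rule A.tensor_hom_eqI[OF TB.module_axioms _ _ _ t])
    show "(\<lambda>t. tensor_map K A B f (n - 1) (leibniz_boundary K A n t)) \<in> module_hom K (tensor_power K A n) ?TB"
      by (rule module_hom_comp[OF A.boundary_hom tm])
    show "(\<lambda>t. leibniz_boundary K B n (tensor_map K A B f n t)) \<in> module_hom K (tensor_power K A n) ?TB"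
      by (rule module_hom_comp[OF tm B.boundary_hom])
    fix xs assume xs: "xs \<in> words A n"
    have cl: "?s j \<odot>\<^bsub>?TA\<^esub> pure_tensor K A (contract_word A i j xs) \<in> carrier ?TA" if "i < j" "j < n" for i j
      by (rule TA.smult_closed[OF sg A.pure_tensor_closed[OF A.contract_word_closed[OF xs that]]])
    have cw: "contract_word B i j (map f xs) \<in> words B (n - 1)" if "i < j" "j < n" for i j
      by (rule B.contract_word_closed[OF words_map[OF fh xs] that])
    have clB: "?s j \<odot>\<^bsub>?TB\<^esub> pure_tensor K B (contract_word B i j (map f xs)) \<in> carrier ?TB" if "i < j" "j < n" for i j
      by (rule TB.smult_closed[OF sg B.pure_tensor_closed[OF cw[OF that]]])
    have "tensor_map K A B f (n - 1) (leibniz_boundary K A n (pure_tensor K A xs))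
      = (\<Oplus>\<^bsub>?TB\<^esub>j\<in>{..<n}. tensor_map K A B f (n - 1) (\<Oplus>\<^bsub>?TA\<^esub>i\<in>{..<j}. ?s j \<odot>\<^bsub>?TA\<^esub> pure_tensor K A (contract_word A i j xs)))"
      unfolding A.boundary_pure[OF xs]
      by (rule module_hom_sum[OF TA.module_axioms TB.module_axioms tm]) (intro Pi_I TA.M.finsum_closed cl; simp)
    also have "\<dots> = (\<Oplus>\<^bsub>?TB\<^esub>j\<in>{..<n}. \<Oplus>\<^bsub>?TB\<^esub>i\<in>{..<j}. ?s j \<odot>\<^bsub>?TB\<^esub> pure_tensor K B (contract_word B i j (map f xs)))"
    proof (rule TB.M.finsum_cong'[OF refl])
      show "(\<lambda>j. \<Oplus>\<^bsub>?TB\<^esub>i\<in>{..<j}. ?s j \<odot>\<^bsub>?TB\<^esub> pure_tensor K B (contract_word B i j (map f xs))) \<in> {..<n} \<rightarrow> carrier ?TB"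
        by (intro Pi_I TB.M.finsum_closed clB; simp)
      fix j assume j: "j \<in> {..<n}"
      have "tensor_map K A B f (n - 1) (\<Oplus>\<^bsub>?TA\<^esub>i\<in>{..<j}. ?s j \<odot>\<^bsub>?TA\<^esub> pure_tensor K A (contract_word A i j xs))
        = (\<Oplus>\<^bsub>?TB\<^esub>i\<in>{..<j}. tensor_map K A B f (n - 1) (?s j \<odot>\<^bsub>?TA\<^esub> pure_tensor K A (contract_word A i j xs)))"
        by (rule module_hom_sum[OF TA.module_axioms TB.module_axioms tm]) (use j cl in auto)
      also have "\<dots> = (\<Oplus>\<^bsub>?TB\<^esub>i\<in>{..<j}. ?s j \<odot>\<^bsub>?TB\<^esub> pure_tensor K B (contract_word B i j (map f xs)))"
      proof (rule TB.M.finsum_cong'[OF refl])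
        fix i assume i: "i \<in> {..<j}"
        have ij: "i < j" "j < n" using i j by auto
        note w = A.contract_word_closed[OF xs ij]
        show "tensor_map K A B f (n - 1) (?s j \<odot>\<^bsub>?TA\<^esub> pure_tensor K A (contract_word A i j xs))
          = ?s j \<odot>\<^bsub>?TB\<^esub> pure_tensor K B (contract_word B i j (map f xs))"
          unfolding module_hom_smult[OF tm sg A.pure_tensor_closed[OF w]] tp[OF w]
            map_contract_word[OF f xs ij] ..
      qed (use j clB in auto)
      finally show "tensor_map K A B f (n - 1) (\<Oplus>\<^bsub>?TA\<^esub>i\<in>{..<j}. ?s j \<odot>\<^bsub>?TA\<^esub> pure_tensor K A (contract_word A i j xs))
        = (\<Oplus>\<^bsub>?TB\<^esub>i\<in>{..<j}. ?s j \<odot>\<^bsub>?TB\<^esub> pure_tensor K B (contract_word B i j (map f xs)))" .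
    qed
    also have "\<dots> = leibniz_boundary K B n (tensor_map K A B f n (pure_tensor K A xs))"
      unfolding tp[OF xs] B.boundary_pure[OF words_map[OF fh xs]] ..
    finally show "tensor_map K A B f (n - 1) (leibniz_boundary K A n (pure_tensor K A xs))
      = leibniz_boundary K B n (tensor_map K A B f n (pure_tensor K A xs))" .
  qed
qed

section \<open>Dimension of a subquotient\<close>

lemma (in vectorspace) submodule_vectorspace: "submodule K W V \<Longrightarrow> vectorspace K (vs W)"
  by (intro subspace_is_vs subspace.intro vectorspace_axioms)

text \<open>Independent subsets of \<open>W\<close> are independent in \<open>V\<close>, so their size is at most the dimension of \<open>V\<close>, and a
maximal one is a basis of \<open>W\<close>.\<close>

lemma (in vectorspace) fin_dim_subspace:
  assumes W: "submodule K W V" and fd: "fin_dim"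
  shows "vectorspace.fin_dim K (vs W)" "vectorspace.dim K (vs W) \<le> dim"
proof -
  interpret W: vectorspace K "vs W" by (rule submodule_vectorspace[OF W])
  have li: "finite A \<and> card A \<le> dim" if "A \<subseteq> carrier (vs W) \<and> W.lin_indpt A" for A
  proof -
    have A: "A \<subseteq> W" "lin_indpt A"
      using that span_li_not_depend(2)[OF _ W, of A] by auto
    then have "A \<subseteq> carrier V" using submodule.subset[OF W] by blast
    then show ?thesis using li_le_dim[OF fd _ A(2)] by blast
  qed
  have "W.lin_indpt {}" by (auto simp: W.lin_dep_def)
  then obtain A where A: "finite A" "maximal A (\<lambda>A. A \<subseteq> carrier (vs W) \<and> W.lin_indpt A)"
    using maximal_exists[of "\<lambda>A. A \<subseteq> carrier (vs W) \<and> W.lin_indpt A" dim "{}", OF li] by auto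
  then have b: "W.basis A" using W.max_li_is_basis by blast
  then show "W.fin_dim"
    using A(1) unfolding W.fin_dim_def W.basis_def by (intro exI[of _ A] conjI) simp_all
  show "W.dim \<le> dim"
    using W.dim_basis[OF A(1) b] li[of A] A(2) by (simp add: maximal_def)
qed

lemma (in vectorspace) dim_le_card_spanning:
  assumes W: "submodule K W V" and S: "finite S" "S \<subseteq> carrier V" "W \<subseteq> span S"
  shows "vectorspace.dim K (vs W) \<le> card S"
proof -
  have sS: "submodule K (span S) V" by (rule span_is_submodule[OF S(2)])
  interpret S: vectorspace K "vs (span S)" by (rule submodule_vectorspace[OF sS])
  have SS: "S \<subseteq> span S" by (rule in_own_span[OF S(2)])
  then have gen: "S.span S = carrier (vs (span S))" using span_li_not_depend(1)[OF _ sS] by simp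
  have WS: "submodule K W (vs (span S))"
    using S(3) submodule.m_closed[OF W] submodule.zero_closed[OF W] submodule.smult_closed[OF W]
    by (intro S.submoduleI) simp_all
  have "S.fin_dim"
    unfolding S.fin_dim_def using S(1) SS gen by (intro exI[of _ S] conjI) simp_all
  from S.fin_dim_subspace(2)[OF WS this] have "vectorspace.dim K (vs W) \<le> S.dim" by simp
  also have "\<dots> \<le> card S" using S.gen_ge_dim[OF S(1) _ gen] SS by simp
  finally show ?thesis .
qed

lemma (in vectorspace) Quotm_vectorspace: "submodule K W V \<Longrightarrow> vectorspace K (V Quotm W)"
  by (rule vectorspace.intro[OF Quotm_module field_axioms])

lemma (in vectorspace) Quotm_fin_dim:
  assumes "submodule K W V" "fin_dim"
  shows "vectorspace.fin_dim K (V Quotm W)"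
proof -
  interpret Q: vectorspace K "V Quotm W" by (rule Quotm_vectorspace[OF assms(1)])
  interpret linear_map K V "V Quotm W" "\<lambda>x. W +>\<^bsub>V\<^esub> x"
    by (intro linear_map.intro vectorspace_axioms Q.vectorspace_axioms mod_hom.intro
        module_axioms Q.module_axioms mod_hom_axioms.intro coset_hom assms(1))
  show ?thesis by (rule surj_fin_dim[OF assms(2)]) (simp add: carrier_Quotm)
qed

text \<open>Homology modules are quotients \<open>Z / B\<close> of a restricted record.  They are moved inside the quotient of
the ambient module, where images and kernels of linear maps are available.\<close>

lemma Quotm_carrier_update:
  "M\<lparr>carrier := Z\<rparr> Quotm B = (M Quotm B)\<lparr>carrier := (\<lambda>z. B +>\<^bsub>M\<^esub> z) ` Z\<rparr>"
proof -
  have c: "a_r_coset (M\<lparr>carrier := Z\<rparr>) = a_r_coset M"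
    by (simp add: fun_eq_iff a_r_coset_def r_coset_def)
  show ?thesis
    unfolding quotient_module_def c
    by (auto simp: A_RCOSETS_def RCOSETS_def c[unfolded a_r_coset_def fun_eq_iff, simplified]
        a_r_coset_def r_coset_def rcoset_mult_def fun_eq_iff set_add_def set_mult_def)
qed

text \<open>The map \<open>\<psi>\<close> descends to \<open>Z / B \<rightarrow> Z' / B'\<close>.  The hypothesis on \<open>C\<close> says that the kernel of the descended
map lies in the span of the classes of \<open>C\<close>, so the bound is rank-nullity.  The elements of \<open>C\<close> are taken
in \<open>M\<close> rather than in \<open>Z\<close>: the kernel is only compared with a subspace of \<open>M / B\<close>, which is what allows
tensors that are not cycles to serve as \<open>C\<close> later.\<close>

lemma dim_subquotient_le:
  assumes M: "vectorspace K M" "vectorspace.fin_dim K M" and M': "vectorspace K M'" "vectorspace.fin_dim K M'"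
    and Z: "submodule K Z M" and B: "submodule K B M" and Z': "submodule K Z' M'" and B': "submodule K B' M'"
    and \<psi>: "\<psi> \<in> module_hom K M M'" "\<psi> ` Z \<subseteq> Z'" "\<psi> ` B \<subseteq> B'"
    and C: "finite C" "C \<subseteq> carrier M"
    and ker: "\<And>z. \<lbrakk>z \<in> Z; \<psi> z \<in> B'\<rbrakk> \<Longrightarrow> \<exists>b\<in>B. \<exists>c\<in>module.span K M C. z = b \<oplus>\<^bsub>M\<^esub> c"
  shows "vectorspace.dim K (M\<lparr>carrier := Z\<rparr> Quotm B)
    \<le> vectorspace.dim K (M'\<lparr>carrier := Z'\<rparr> Quotm B') + card C"
proof -
  interpret M: vectorspace K M by fact
  interpret M': vectorspace K M' by fact
  let ?Q = "M Quotm B" and ?Q' = "M' Quotm B'"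
  interpret Q: vectorspace K ?Q by (rule M.Quotm_vectorspace[OF B])
  interpret Q': vectorspace K ?Q' by (rule M'.Quotm_vectorspace[OF B'])
  let ?q = "\<lambda>x. B +>\<^bsub>M\<^esub> x" and ?q' = "\<lambda>x. B' +>\<^bsub>M'\<^esub> x"
  note q = M.coset_hom[OF B] and q' = M'.coset_hom[OF B']
  let ?W = "?q ` Z" and ?W' = "?q' ` Z'"
  have W: "submodule K ?W ?Q" by (rule submodule_image[OF M.module_axioms Q.module_axioms q Z])
  have W': "submodule K ?W' ?Q'" by (rule submodule_image[OF M'.module_axioms Q'.module_axioms q' Z'])
  interpret H: vectorspace K "Q.vs ?W" by (rule Q.submodule_vectorspace[OF W])
  interpret H': vectorspace K "Q'.vs ?W'" by (rule Q'.submodule_vectorspace[OF W'])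
  have fdH: "H.fin_dim" by (rule Q.fin_dim_subspace(1)[OF W M.Quotm_fin_dim[OF B M(2)]])
  have fdH': "H'.fin_dim" by (rule Q'.fin_dim_subspace(1)[OF W' M'.Quotm_fin_dim[OF B' M'(2)]])
  have "?q' (\<psi> x) = \<zero>\<^bsub>?Q'\<^esub>" if "x \<in> B" for x
  proof -
    have "\<psi> x \<in> B'" using that \<psi>(3) by blast
    then show ?thesis
      using M'.coset_eq_zero_iff[OF B'] submodule.subset[OF B'] by auto
  qed
  from Quotm_lift[OF M.module_axioms Q'.module_axioms B module_hom_comp[OF \<psi>(1) q'] this]
  obtain T where T: "T \<in> module_hom K ?Q ?Q'" "\<And>x. x \<in> carrier M \<Longrightarrow> T (?q x) = ?q' (\<psi> x)"
    by blast
  have WQ: "?W \<subseteq> carrier ?Q" using submodule.subset[OF W] .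
  have ZM: "Z \<subseteq> carrier M" using submodule.subset[OF Z] .
  have TH: "T \<in> module_hom K (Q.vs ?W) (Q'.vs ?W')"
  proof (rule module_homI)
    show "T x \<in> carrier (Q'.vs ?W')" if x: "x \<in> carrier (Q.vs ?W)" for x
    proof -
      obtain z where "z \<in> Z" "x = ?q z" using x by auto
      moreover from this have "T x = ?q' (\<psi> z)" using T(2) ZM by blast
      ultimately show ?thesis using \<psi>(2) by auto
    qed
    show "T (x \<oplus>\<^bsub>Q.vs ?W\<^esub> y) = T x \<oplus>\<^bsub>Q'.vs ?W'\<^esub> T y"
      if "x \<in> carrier (Q.vs ?W)" "y \<in> carrier (Q.vs ?W)" for x y
    proof -
      have "x \<in> carrier ?Q" "y \<in> carrier ?Q" using that WQ by auto
      from module_hom_add[OF T(1) this] show ?thesis by simp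
    qed
    show "T (c \<odot>\<^bsub>Q.vs ?W\<^esub> x) = c \<odot>\<^bsub>Q'.vs ?W'\<^esub> T x"
      if "c \<in> carrier K" "x \<in> carrier (Q.vs ?W)" for c x
    proof -
      have "x \<in> carrier ?Q" using that WQ by auto
      from module_hom_smult[OF T(1) that(1) this] show ?thesis by simp
    qed
  qed
  interpret T: linear_map K "Q.vs ?W" "Q'.vs ?W'" T
    by (intro linear_map.intro H.vectorspace_axioms H'.vectorspace_axioms mod_hom.intro
        H.module_axioms H'.module_axioms mod_hom_axioms.intro TH)
  have im: "vectorspace.dim K (H'.vs T.im) \<le> H'.dim"
    by (rule H'.fin_dim_subspace(2)[OF _ fdH']) (use T.imT_is_subspace in \<open>simp add: subspace_def\<close>)
  have kerH: "submodule K T.ker (Q.vs ?W)" using T.kerT_is_subspace by (simp add: subspace_def)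
  have kerQ: "submodule K T.ker ?Q"
  proof (rule Q.submoduleI)
    show "T.ker \<subseteq> carrier ?Q" using submodule.subset[OF kerH] WQ by simp
    show "\<zero>\<^bsub>?Q\<^esub> \<in> T.ker" using submodule.zero_closed[OF kerH] by simp
    show "x \<oplus>\<^bsub>?Q\<^esub> y \<in> T.ker" if "x \<in> T.ker" "y \<in> T.ker" for x y
      using submodule.m_closed[OF kerH that] by simp
    show "c \<odot>\<^bsub>?Q\<^esub> x \<in> T.ker" if "c \<in> carrier K" "x \<in> T.ker" for c x
      using submodule.smult_closed[OF kerH that] by simp
  qed
  have qC: "finite (?q ` C)" "?q ` C \<subseteq> carrier ?Q" "card (?q ` C) \<le> card C"
    using C by (auto intro: card_image_le)
  have "T.ker \<subseteq> Q.span (?q ` C)"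
  proof
    fix w assume "w \<in> T.ker"
    then obtain z where z: "z \<in> Z" "w = ?q z" "T w = B'" by (auto simp: T.ker_def)
    have zM: "z \<in> carrier M" using z(1) ZM by blast
    have "?q' (\<psi> z) = B'" using z(2,3) T(2)[OF zM] by simp
    then have "\<psi> z \<in> B'"
      using M'.coset_eq_zero_iff[OF B' module_hom_mem[OF \<psi>(1) zM]] by blast
    then obtain b c where bc: "b \<in> B" "c \<in> M.span C" "z = b \<oplus>\<^bsub>M\<^esub> c" using ker[OF z(1)] by blast
    have bM: "b \<in> carrier M" using bc(1) submodule.subset[OF B] by blast
    have cM: "c \<in> carrier M" using bc(2) M.span_closed[OF C(2)] by blast
    have "w = ?q b \<oplus>\<^bsub>?Q\<^esub> ?q c" unfolding z(2) bc(3) by (rule module_hom_add[OF q bM cM])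
    also have "?q b = \<zero>\<^bsub>?Q\<^esub>" using M.coset_eq_zero_iff[OF B bM] bc(1) by simp
    finally have "w = ?q c" using module_hom_mem[OF q cM] by (simp del: Quotm_simps)
    moreover have "?q ` M.span C \<subseteq> Q.span (?q ` C)"
      by (rule hom_image_span_subset[OF M.module_axioms Q.module_axioms q Q.span_is_submodule[OF qC(2)] C(2)
            Q.in_own_span[OF qC(2)]])
    ultimately show "w \<in> Q.span (?q ` C)" using bc(2) by blast
  qed
  from Q.dim_le_card_spanning[OF kerQ qC(1,2) this] qC(3)
  have "vectorspace.dim K (H.vs T.ker) \<le> card C" by simp
  then have "H.dim \<le> H'.dim + card C" using T.rank_nullity[OF fdH] im by linarith
  then show ?thesis by (simp add: Quotm_carrier_update)
qed

section \<open>Maps of mapping cones\<close>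

lemma direct_sum_simps [simp]:
  "carrier (direct_sum A B) = carrier A \<times> carrier B"
  "\<zero>\<^bsub>direct_sum A B\<^esub> = (\<zero>\<^bsub>A\<^esub>, \<zero>\<^bsub>B\<^esub>)"
  "x \<oplus>\<^bsub>direct_sum A B\<^esub> y = (fst x \<oplus>\<^bsub>A\<^esub> fst y, snd x \<oplus>\<^bsub>B\<^esub> snd y)"
  "c \<odot>\<^bsub>direct_sum A B\<^esub> x = (c \<odot>\<^bsub>A\<^esub> fst x, c \<odot>\<^bsub>B\<^esub> snd x)"
  by (simp_all add: direct_sum_def)

lemma direct_sum_fin_dim:
  assumes A: "vectorspace K A" "vectorspace.fin_dim K A" and B: "vectorspace K B" "vectorspace.fin_dim K B"
  shows "vectorspace.fin_dim K (direct_sum A B)"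
proof -
  interpret A: vectorspace K A by fact
  interpret B: vectorspace K B by fact
  interpret D: vectorspace K "direct_sum A B" by (rule direct_sum_is_vs[OF A(1) B(1)])
  obtain S where S: "finite S" "S \<subseteq> carrier A" "A.span S = carrier A"
    using A(2) unfolding A.fin_dim_def by blast
  obtain T where T: "finite T" "T \<subseteq> carrier B" "B.span T = carrier B"
    using B(2) unfolding B.fin_dim_def by blast
  let ?i = "\<lambda>a. (a, \<zero>\<^bsub>B\<^esub>)" and ?j = "\<lambda>b. (\<zero>\<^bsub>A\<^esub>, b)"
  let ?G = "?i ` S \<union> ?j ` T"
  have G: "?G \<subseteq> carrier (direct_sum A B)" using S(2) T(2) by auto
  have sG: "submodule K (D.span ?G) (direct_sum A B)" by (rule D.span_is_submodule[OF G])
  have i: "?i \<in> module_hom K A (direct_sum A B)" by (rule module_homI) auto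
  have j: "?j \<in> module_hom K B (direct_sum A B)" by (rule module_homI) auto
  have "?i ` carrier A \<subseteq> D.span ?G"
    using hom_image_span_subset[OF A.module_axioms D.module_axioms i sG S(2)] D.in_own_span[OF G] S(3) by auto
  moreover have "?j ` carrier B \<subseteq> D.span ?G"
    using hom_image_span_subset[OF B.module_axioms D.module_axioms j sG T(2)] D.in_own_span[OF G] T(3) by auto
  ultimately have "?i a \<oplus>\<^bsub>direct_sum A B\<^esub> ?j b \<in> D.span ?G" if "a \<in> carrier A" "b \<in> carrier B" for a b
    using that submodule.m_closed[OF sG] by blast
  then have "carrier (direct_sum A B) \<subseteq> D.span ?G" by auto
  then have "D.span ?G = carrier (direct_sum A B)" using D.span_is_subset2[OF G] by blast
  moreover have "finite ?G" using S(1) T(1) by simp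
  ultimately show ?thesis unfolding D.fin_dim_def using G by (intro exI[of _ ?G] conjI)
qed

lemma cone_module_Suc:
  "cone_module K L N (Suc n) = direct_sum (tensor_power K L n) (tensor_power K (L Quotm N) (Suc n))"
  by (simp add: cone_module_def)

lemma cone_boundary_hom:
  assumes L: "leibniz_algebra K L" and N: "submodule K N L" and Q: "leibniz_algebra K (L Quotm N)"
  shows "cone_boundary K L N (Suc (Suc n))
    \<in> module_hom K (cone_module K L N (Suc (Suc n))) (cone_module K L N (Suc n))"
proof -
  interpret L: leibniz_algebra K L by fact
  interpret Q: leibniz_algebra K "L Quotm N" by fact
  interpret TL: module K "tensor_power K L n" by (rule L.tensor_power_module)
  interpret TQ: module K "tensor_power K (L Quotm N) (Suc n)" by (rule Q.tensor_power_module)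
  have dL: "leibniz_boundary K L (Suc n) \<in> module_hom K (tensor_power K L (Suc n)) (tensor_power K L n)"
    using L.boundary_hom[of "Suc n"] by simp
  have dQ: "leibniz_boundary K (L Quotm N) (Suc (Suc n))
      \<in> module_hom K (tensor_power K (L Quotm N) (Suc (Suc n))) (tensor_power K (L Quotm N) (Suc n))"
    using Q.boundary_hom[of "Suc (Suc n)"] by simp
  have p: "projection_chain_map K L N (Suc n)
      \<in> module_hom K (tensor_power K L (Suc n)) (tensor_power K (L Quotm N) (Suc n))"
    unfolding projection_chain_map_eq
    by (rule tensor_map_hom[OF L.module_axioms Q.module_axioms L.coset_hom[OF N]])
  note m = module_hom_mem[OF dL] module_hom_mem[OF dQ] module_hom_mem[OF p]
  note add = module_hom_add[OF dL] module_hom_add[OF dQ] module_hom_add[OF p]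
  note sm = module_hom_smult[OF dL] module_hom_smult[OF dQ] module_hom_smult[OF p]
  show ?thesis
    unfolding cone_module_Suc
  proof (rule module_homI, goal_cases)
    case (1 x)
    then show ?case by (auto simp: cone_boundary_def m)
  next
    case (2 x y)
    then obtain a b a' b' where xy: "x = (a, b)" "y = (a', b')"
      and a: "a \<in> carrier (tensor_power K L (Suc n))" "a' \<in> carrier (tensor_power K L (Suc n))"
      and b: "b \<in> carrier (tensor_power K (L Quotm N) (Suc (Suc n)))"
        "b' \<in> carrier (tensor_power K (L Quotm N) (Suc (Suc n)))"
      by (cases x; cases y) auto
    show ?case
      using m(1)[OF a(1)] m(1)[OF a(2)] m(2)[OF b(1)] m(2)[OF b(2)] m(3)[OF a(1)] m(3)[OF a(2)]
      by (simp add: cone_boundary_def xy add(1)[OF a] add(2)[OF b] add(3)[OF a] TL.M.minus_add TQ.M.a_ac)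
  next
    case (3 c x)
    then obtain a b where x: "x = (a, b)" and a: "a \<in> carrier (tensor_power K L (Suc n))"
      and b: "b \<in> carrier (tensor_power K (L Quotm N) (Suc (Suc n)))"
      by (cases x) auto
    show ?case
      using m(1)[OF a] m(2)[OF b] m(3)[OF a] 3(1)
      by (simp add: cone_boundary_def x sm(1)[OF 3(1) a] sm(2)[OF 3(1) b] sm(3)[OF 3(1) a]
          TL.smult_r_minus TQ.smult_r_distr)
  qed
qed

definition cone_map ::
  "('k, 'm) ring_scheme \<Rightarrow> ('k, 'v, 'n) module_scheme \<Rightarrow> ('k, 'w, 'p) module_scheme \<Rightarrow> ('v \<Rightarrow> 'w)
    \<Rightarrow> 'v set \<Rightarrow> 'w set \<Rightarrow> ('v set \<Rightarrow> 'w set) \<Rightarrow> nat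
    \<Rightarrow> ('v list \<Rightarrow> 'k) set \<times> ('v set list \<Rightarrow> 'k) set \<Rightarrow> ('w list \<Rightarrow> 'k) set \<times> ('w set list \<Rightarrow> 'k) set" where
  "cone_map K L L' \<rho> N N' \<sigma> n = (\<lambda>(a, b).
     (tensor_map K L L' \<rho> (n - 1) a, tensor_map K (L Quotm N) (L' Quotm N') \<sigma> n b))"

text \<open>A morphism of pairs \<open>(L, N) \<rightarrow> (L', N')\<close>.  The map \<open>\<sigma>\<close> of quotients is determined by \<open>\<rho>\<close>, but is kept as a
parameter in order not to choose representatives of cosets.\<close>

locale pair_morphism =
  L: leibniz_algebra K L + L': leibniz_algebra K L' +
  Q: leibniz_algebra K "L Quotm N" + Q': leibniz_algebra K "L' Quotm N'"
  for K and L and L' and N and N' +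
  fixes \<rho> \<sigma>
  assumes N: "submodule K N L" and N': "submodule K N' L'"
    and \<rho>: "\<rho> \<in> leibniz_hom K L L'" and \<sigma>: "\<sigma> \<in> leibniz_hom K (L Quotm N) (L' Quotm N')"
    and compat: "\<And>x. x \<in> carrier L \<Longrightarrow> \<sigma> (N +>\<^bsub>L\<^esub> x) = N' +>\<^bsub>L'\<^esub> \<rho> x"
begin

abbreviation "\<psi> \<equiv> cone_map K L L' \<rho> N N' \<sigma>"

lemma \<rho>_hom: "\<rho> \<in> module_hom K L L'" using \<rho> by (simp add: leibniz_hom_def)
lemma \<sigma>_hom: "\<sigma> \<in> module_hom K (L Quotm N) (L' Quotm N')" using \<sigma> by (simp add: leibniz_hom_def)

lemmas tensor_\<rho>_hom = tensor_map_hom[OF L.module_axioms L'.module_axioms \<rho>_hom]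
lemmas tensor_\<sigma>_hom = tensor_map_hom[OF Q.module_axioms Q'.module_axioms \<sigma>_hom]

lemma cone_map_hom: "\<psi> (Suc n) \<in> module_hom K (cone_module K L N (Suc n)) (cone_module K L' N' (Suc n))"
  unfolding cone_module_Suc
proof (rule module_homI, goal_cases)
  case (1 x)
  then show ?case
    by (cases x) (simp add: cone_map_def module_hom_mem[OF tensor_\<rho>_hom] module_hom_mem[OF tensor_\<sigma>_hom])
next
  case (2 x y)
  then show ?case
    by (cases x; cases y) (simp add: cone_map_def module_hom_add[OF tensor_\<rho>_hom] module_hom_add[OF tensor_\<sigma>_hom])
next
  case (3 c x)
  then show ?case
    by (cases x) (simp add: cone_map_def module_hom_smult[OF tensor_\<rho>_hom] module_hom_smult[OF tensor_\<sigma>_hom])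
qed

text \<open>In the first component and for the boundary of \<open>L / N\<close> this is naturality of the Leibniz boundary; the
mixed term is the commuting square of \<open>\<rho>\<close>, \<open>\<sigma>\<close> and the two projections.\<close>

lemma cone_map_boundary:
  assumes "w \<in> carrier (cone_module K L N (Suc (Suc n)))"
  shows "\<psi> (Suc n) (cone_boundary K L N (Suc (Suc n)) w)
    = cone_boundary K L' N' (Suc (Suc n)) (\<psi> (Suc (Suc n)) w)"
proof -
  obtain a b where w: "w = (a, b)" and a: "a \<in> carrier (tensor_power K L (Suc n))"
    and b: "b \<in> carrier (tensor_power K (L Quotm N) (Suc (Suc n)))"
    using assms by (cases w) (auto simp: cone_module_Suc)
  have p: "projection_chain_map K L N (Suc n)
      \<in> module_hom K (tensor_power K L (Suc n)) (tensor_power K (L Quotm N) (Suc n))"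
    unfolding projection_chain_map_eq
    by (rule tensor_map_hom[OF L.module_axioms Q.module_axioms L.coset_hom[OF N]])
  have dL: "leibniz_boundary K L (Suc n) a \<in> carrier (tensor_power K L n)"
    using module_hom_mem[OF L.boundary_hom a] by simp
  have dQ: "leibniz_boundary K (L Quotm N) (Suc (Suc n)) b \<in> carrier (tensor_power K (L Quotm N) (Suc n))"
    using module_hom_mem[OF Q.boundary_hom b] by simp
  have 1: "tensor_map K L L' \<rho> n (leibniz_boundary K L (Suc n) a)
      = leibniz_boundary K L' (Suc n) (tensor_map K L L' \<rho> (Suc n) a)"
    using tensor_map_boundary[OF L.leibniz_algebra_axioms L'.leibniz_algebra_axioms \<rho> a] by simp
  have 2: "tensor_map K (L Quotm N) (L' Quotm N') \<sigma> (Suc n) (leibniz_boundary K (L Quotm N) (Suc (Suc n)) b)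
      = leibniz_boundary K (L' Quotm N') (Suc (Suc n)) (tensor_map K (L Quotm N) (L' Quotm N') \<sigma> (Suc (Suc n)) b)"
    using tensor_map_boundary[OF Q.leibniz_algebra_axioms Q'.leibniz_algebra_axioms \<sigma> b] by simp
  have 3: "tensor_map K (L Quotm N) (L' Quotm N') \<sigma> (Suc n) (projection_chain_map K L N (Suc n) a)
      = projection_chain_map K L' N' (Suc n) (tensor_map K L L' \<rho> (Suc n) a)"
    unfolding projection_chain_map_eq
    by (rule tensor_map_square[OF L.module_axioms Q.module_axioms L'.module_axioms Q'.module_axioms
          L.coset_hom[OF N] \<sigma>_hom \<rho>_hom L'.coset_hom[OF N'] compat a])
  show ?thesis
    using module_hom_neg[OF L.tensor_power_module L'.tensor_power_module tensor_\<rho>_hom dL]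
      module_hom_add[OF tensor_\<sigma>_hom dQ module_hom_mem[OF p a]]
    by (simp add: w cone_map_def cone_boundary_def 1 2 3)
qed

end

section \<open>Comparing relative homology\<close>

context pair_morphism
begin

text \<open>Let \<open>z\<close> be a cycle of the cone in degree 3 whose image is a boundary.  The boundary lifts because \<open>\<psi>\<close> is
surjective in degree 4, and subtracting the lift leaves an element \<open>(c, d)\<close> of the kernel of \<open>\<psi>\<close>.  Here
\<open>c\<close> is a combination of pure tensors with an entry in \<open>ker \<rho>\<close>, and \<open>d = 0\<close> by the same description of
kernels, because \<open>\<sigma>\<close> is injective.  Each of the former tensors lies in \<open>X\<close>, the sum
of the span of \<open>C\<close> and of the boundaries of tensors \<open>v\<close> killed by the projection to \<open>L / N\<close>; and \<open>(\<partial> v, 0)\<close> is a boundary of the cone for such \<open>v\<close>.  So the classes of \<open>C\<close> span a space that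
contains the kernel of the map in homology.\<close>

lemma relative_HL_2_dim_le:
  assumes fdL: "vectorspace.fin_dim K L" and fdL': "vectorspace.fin_dim K L'"
    and surj: "\<rho> ` carrier L = carrier L'" "\<sigma> ` carrier (L Quotm N) = carrier (L' Quotm N')"
    and inj: "\<And>X. \<lbrakk>X \<in> carrier (L Quotm N); \<sigma> X = \<zero>\<^bsub>L' Quotm N'\<^esub>\<rbrakk> \<Longrightarrow> X = \<zero>\<^bsub>L Quotm N\<^esub>"
    and C: "finite C" "C \<subseteq> carrier (tensor_power K L 2)"
    and X: "X = module.submodule_sum (tensor_power K L 2)
        (leibniz_boundary K L 3 ` {v \<in> carrier (tensor_power K L 3).
           projection_chain_map K L N 3 v = \<zero>\<^bsub>tensor_power K (L Quotm N) 3\<^esub>})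
        (module.span K (tensor_power K L 2) C)"
    and ker: "\<And>xs x. \<lbrakk>xs \<in> words L 2; x \<in> set xs; \<rho> x = \<zero>\<^bsub>L'\<^esub>\<rbrakk> \<Longrightarrow> pure_tensor K L xs \<in> X"
  shows "vectorspace.dim K (relative_HL K 2 L N) \<le> vectorspace.dim K (relative_HL K 2 L' N') + card C"
proof -
  let ?Q = "L Quotm N" and ?Q' = "L' Quotm N'"
  let ?M = "\<lambda>n. cone_module K L N n" and ?M' = "\<lambda>n. cone_module K L' N' n"
  let ?\<delta> = "cone_boundary K L N" and ?\<delta>' = "cone_boundary K L' N'"
  have Qfd: "vectorspace.fin_dim K ?Q" "vectorspace.fin_dim K ?Q'"
    using L.Quotm_fin_dim[OF N fdL] L'.Quotm_fin_dim[OF N' fdL'] .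
  note TL = tensor_power_fin_dim[OF L.vectorspace_axioms fdL]
  note TL' = tensor_power_fin_dim[OF L'.vectorspace_axioms fdL']
  note TQ = tensor_power_fin_dim[OF Q.vectorspace_axioms Qfd(1)]
  note TQ' = tensor_power_fin_dim[OF Q'.vectorspace_axioms Qfd(2)]
  have cone: "vectorspace K (?M (Suc n))" "vectorspace.fin_dim K (?M (Suc n))"
    "vectorspace K (?M' (Suc n))" "vectorspace.fin_dim K (?M' (Suc n))" for n
    unfolding cone_module_Suc
    by (rule direct_sum_is_vs[OF TL(1) TQ(1)] direct_sum_fin_dim[OF TL TQ]
        direct_sum_is_vs[OF TL'(1) TQ'(1)] direct_sum_fin_dim[OF TL' TQ'])+
  have cone': "vectorspace K (?M 2)" "vectorspace K (?M 3)" "vectorspace K (?M 4)"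
    "vectorspace K (?M' 2)" "vectorspace K (?M' 3)" "vectorspace K (?M' 4)"
    "vectorspace.fin_dim K (?M 3)" "vectorspace.fin_dim K (?M' 3)"
    using cone[of 1] cone[of 2] cone[of 3] by (simp_all add: numeral_eq_Suc)
  interpret M2: vectorspace K "?M 2" by (rule cone')
  interpret M3: vectorspace K "?M 3" by (rule cone')
  interpret M4: vectorspace K "?M 4" by (rule cone')
  interpret M2': vectorspace K "?M' 2" by (rule cone')
  interpret M3': vectorspace K "?M' 3" by (rule cone')
  interpret M4': vectorspace K "?M' 4" by (rule cone')
  interpret T2: vectorspace K "tensor_power K L 2" by (rule TL)
  interpret T3: vectorspace K "tensor_power K L 3" by (rule TL)
  interpret TQ3: vectorspace K "tensor_power K ?Q 3" by (rule TQ)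
  have d4: "?\<delta> 4 \<in> module_hom K (?M 4) (?M 3)" and d3: "?\<delta> 3 \<in> module_hom K (?M 3) (?M 2)"
    using cone_boundary_hom[OF L.leibniz_algebra_axioms N Q.leibniz_algebra_axioms, of 2]
      cone_boundary_hom[OF L.leibniz_algebra_axioms N Q.leibniz_algebra_axioms, of 1]
    by (simp_all add: numeral_eq_Suc)
  have d4': "?\<delta>' 4 \<in> module_hom K (?M' 4) (?M' 3)" and d3': "?\<delta>' 3 \<in> module_hom K (?M' 3) (?M' 2)"
    using cone_boundary_hom[OF L'.leibniz_algebra_axioms N' Q'.leibniz_algebra_axioms, of 2]
      cone_boundary_hom[OF L'.leibniz_algebra_axioms N' Q'.leibniz_algebra_axioms, of 1]
    by (simp_all add: numeral_eq_Suc)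
  have p4: "\<psi> 4 \<in> module_hom K (?M 4) (?M' 4)" and p3: "\<psi> 3 \<in> module_hom K (?M 3) (?M' 3)"
    and p2: "\<psi> 2 \<in> module_hom K (?M 2) (?M' 2)"
    using cone_map_hom[of 3] cone_map_hom[of 2] cone_map_hom[of 1] by (simp_all add: numeral_eq_Suc)
  have c4: "\<psi> 3 (?\<delta> 4 w) = ?\<delta>' 4 (\<psi> 4 w)" if "w \<in> carrier (?M 4)" for w
    using cone_map_boundary[of w 2] that by (simp add: numeral_eq_Suc)
  have c3: "\<psi> 2 (?\<delta> 3 w) = ?\<delta>' 3 (\<psi> 3 w)" if "w \<in> carrier (?M 3)" for w
    using cone_map_boundary[of w 1] that by (simp add: numeral_eq_Suc)
  have M3_eq: "?M 3 = direct_sum (tensor_power K L 2) (tensor_power K ?Q 3)"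
    and M4_eq: "?M 4 = direct_sum (tensor_power K L 3) (tensor_power K ?Q 4)"
    and M3'_eq: "?M' 3 = direct_sum (tensor_power K L' 2) (tensor_power K ?Q' 3)"
    and M4'_eq: "?M' 4 = direct_sum (tensor_power K L' 3) (tensor_power K ?Q' 4)"
    using cone_module_Suc[of K L N 2] cone_module_Suc[of K L N 3]
      cone_module_Suc[of K L' N' 2] cone_module_Suc[of K L' N' 3] by simp_all
  let ?Z = "{x \<in> carrier (?M 3). ?\<delta> 3 x \<in> {\<zero>\<^bsub>?M 2\<^esub>}}" and ?B = "?\<delta> 4 ` carrier (?M 4)"
  let ?Z' = "{x \<in> carrier (?M' 3). ?\<delta>' 3 x \<in> {\<zero>\<^bsub>?M' 2\<^esub>}}" and ?B' = "?\<delta>' 4 ` carrier (?M' 4)"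
  have HL: "relative_HL K 2 L N = (?M 3)\<lparr>carrier := ?Z\<rparr> Quotm ?B"
    "relative_HL K 2 L' N' = (?M' 3)\<lparr>carrier := ?Z'\<rparr> Quotm ?B'"
    by (simp_all add: relative_HL_def homology_module_def a_kernel_def')
  have Z: "submodule K ?Z (?M 3)"
    by (rule submodule_vimage[OF M3.module_axioms M2.module_axioms d3 M2.submodule_zero])
  have Z': "submodule K ?Z' (?M' 3)"
    by (rule submodule_vimage[OF M3'.module_axioms M2'.module_axioms d3' M2'.submodule_zero])
  have B: "submodule K ?B (?M 3)"
    by (rule submodule_image[OF M4.module_axioms M3.module_axioms d4 M4.submodule_carrier])
  have B': "submodule K ?B' (?M' 3)"
    by (rule submodule_image[OF M4'.module_axioms M3'.module_axioms d4' M4'.submodule_carrier])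
  have ZZ: "\<psi> 3 ` ?Z \<subseteq> ?Z'"
  proof (rule image_subsetI)
    fix x assume "x \<in> ?Z"
    then have x: "x \<in> carrier (?M 3)" "?\<delta> 3 x = \<zero>\<^bsub>?M 2\<^esub>" by simp_all
    then show "\<psi> 3 x \<in> ?Z'"
      using c3[OF x(1)] module_hom_mem[OF p3 x(1)]
        module_hom_zero[OF M2.module_axioms M2'.module_axioms p2] by simp
  qed
  have BB: "\<psi> 3 ` ?B \<subseteq> ?B'"
    using c4 module_hom_mem[OF p4] by (simp add: image_subset_iff)
  have surj4: "\<psi> 4 ` carrier (?M 4) = carrier (?M' 4)"
  proof -
    have 1: "tensor_map K L L' \<rho> 3 ` carrier (tensor_power K L 3) = carrier (tensor_power K L' 3)"
      by (rule tensor_map_surj[OF L.module_axioms L'.module_axioms \<rho>_hom surj(1)])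
    have 2: "tensor_map K ?Q ?Q' \<sigma> 4 ` carrier (tensor_power K ?Q 4) = carrier (tensor_power K ?Q' 4)"
      by (rule tensor_map_surj[OF Q.module_axioms Q'.module_axioms \<sigma>_hom surj(2)])
    have "\<psi> 4 = map_prod (tensor_map K L L' \<rho> 3) (tensor_map K ?Q ?Q' \<sigma> 4)"
      by (simp add: cone_map_def map_prod_def)
    then show ?thesis by (simp add: M4_eq M4'_eq map_prod_surj_on[OF 1 2])
  qed
  let ?i = "\<lambda>a. (a, \<zero>\<^bsub>tensor_power K ?Q 3\<^esub>)"
  have i: "?i \<in> module_hom K (tensor_power K L 2) (?M 3)"
    unfolding M3_eq by (rule module_homI) simp_all
  have iC: "finite (?i ` C)" "?i ` C \<subseteq> carrier (?M 3)" "card (?i ` C) = card C"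
    using C by (auto simp: M3_eq card_image inj_on_def)
  define Ker where "Ker = {v \<in> carrier (tensor_power K L 3).
     projection_chain_map K L N 3 v = \<zero>\<^bsub>tensor_power K ?Q 3\<^esub>}"
  have bd: "leibniz_boundary K L 3 \<in> module_hom K (tensor_power K L 3) (tensor_power K L 2)"
    using L.boundary_hom[of 3] by simp
  have pr: "projection_chain_map K L N 3 \<in> module_hom K (tensor_power K L 3) (tensor_power K ?Q 3)"
    unfolding projection_chain_map_eq
    by (rule tensor_map_hom[OF L.module_axioms Q.module_axioms L.coset_hom[OF N]])
  have bq: "leibniz_boundary K ?Q 4 \<in> module_hom K (tensor_power K ?Q 4) (tensor_power K ?Q 3)"
    using Q.boundary_hom[of 4] by simp
  have KerS: "submodule K Ker (tensor_power K L 3)"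
    unfolding Ker_def
    using submodule_vimage[OF T3.module_axioms TQ3.module_axioms pr TQ3.submodule_zero] by simp
  have XS: "submodule K X (tensor_power K L 2)"
    unfolding X Ker_def[symmetric]
    by (rule T2.sum_is_submodule[OF submodule_image[OF T3.module_axioms T2.module_axioms bd KerS]
          T2.span_is_submodule[OF C(2)]])
  have main: "\<exists>b\<in>?B. \<exists>c\<in>M3.span (?i ` C). z = b \<oplus>\<^bsub>?M 3\<^esub> c" if z: "z \<in> ?Z" "\<psi> 3 z \<in> ?B'" for z
  proof -
    have zM: "z \<in> carrier (?M 3)" using z(1) by simp
    obtain w where w: "w \<in> carrier (?M 4)" "\<psi> 3 z = ?\<delta>' 4 (\<psi> 4 w)"
    proof -
      obtain w' where w': "w' \<in> \<psi> 4 ` carrier (?M 4)" "\<psi> 3 z = ?\<delta>' 4 w'"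
        using z(2) unfolding surj4 by (elim imageE) simp
      show thesis using w'(1) by (elim imageE) (use w'(2) that in simp)
    qed
    have dw: "?\<delta> 4 w \<in> carrier (?M 3)" by (rule module_hom_mem[OF d4 w(1)])
    obtain c d where cd: "z \<ominus>\<^bsub>?M 3\<^esub> ?\<delta> 4 w = (c, d)" by (cases "z \<ominus>\<^bsub>?M 3\<^esub> ?\<delta> 4 w")
    have cdM: "(c, d) \<in> carrier (?M 3)" unfolding cd[symmetric] using zM dw by simp
    then have c: "c \<in> carrier (tensor_power K L 2)" and d: "d \<in> carrier (tensor_power K ?Q 3)"
      by (simp_all add: M3_eq)
    have "\<psi> 3 (c, d) = \<zero>\<^bsub>?M' 3\<^esub>"
      unfolding cd[symmetric] module_hom_minus[OF M3.module_axioms M3'.module_axioms p3 zM dw]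
      using w(2) c4[OF w(1)] module_hom_mem[OF p3 zM] by simp
    then have c0: "tensor_map K L L' \<rho> 2 c = \<zero>\<^bsub>tensor_power K L' 2\<^esub>"
      and d0: "tensor_map K ?Q ?Q' \<sigma> 3 d = \<zero>\<^bsub>tensor_power K ?Q' 3\<^esub>"
      by (simp_all add: cone_map_def M3'_eq)
    have "pure_tensor K L ` {xs \<in> words L 2. \<exists>x\<in>set xs. \<rho> x = \<zero>\<^bsub>L'\<^esub>} \<subseteq> X" using ker by blast
    then have "c \<in> X"
      using T2.span_is_subset[OF _ XS]
        tensor_map_kernel[OF L.module_axioms L'.module_axioms \<rho>_hom surj(1) c c0] by blast
    then obtain v s where v: "v \<in> Ker" and s: "s \<in> T2.span C"
      and cvs: "c = leibniz_boundary K L 3 v \<oplus>\<^bsub>tensor_power K L 2\<^esub> s"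
      unfolding X Ker_def[symmetric] T2.submodule_sum_def by auto
    have "pure_tensor K ?Q xs = \<zero>\<^bsub>tensor_power K ?Q 3\<^esub>"
      if xs: "xs \<in> words ?Q 3" "\<exists>x\<in>set xs. \<sigma> x = \<zero>\<^bsub>?Q'\<^esub>" for xs
    proof -
      obtain x where x: "x \<in> set xs" "\<sigma> x = \<zero>\<^bsub>?Q'\<^esub>" using xs(2) by blast
      have "x \<in> carrier ?Q" using x(1) xs(1) by (auto simp: words_def)
      then have "x = \<zero>\<^bsub>?Q\<^esub>" using inj x(2) by blast
      then obtain us vs where "xs = us @ \<zero>\<^bsub>?Q\<^esub> # vs" using x(1) split_list by metis
      then show ?thesis
        using multilinear_zero[OF Q.module_axioms TQ3.module_axioms Q.pure_tensor_multilinear] xs(1) by blast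
    qed
    then have "pure_tensor K ?Q ` {xs \<in> words ?Q 3. \<exists>x\<in>set xs. \<sigma> x = \<zero>\<^bsub>?Q'\<^esub>} \<subseteq> {\<zero>\<^bsub>tensor_power K ?Q 3\<^esub>}" by blast
    then have d_zero: "d = \<zero>\<^bsub>tensor_power K ?Q 3\<^esub>"
      using TQ3.span_is_subset[OF _ TQ3.submodule_zero]
        tensor_map_kernel[OF Q.module_axioms Q'.module_axioms \<sigma>_hom surj(2) d d0] by blast
    have vT: "v \<in> carrier (tensor_power K L 3)"
      and pv: "projection_chain_map K L N 3 v = \<zero>\<^bsub>tensor_power K ?Q 3\<^esub>"
      using v by (simp_all add: Ker_def)
    have sT: "s \<in> carrier (tensor_power K L 2)" by (rule T2.span_closed[OF C(2) s])
    \<comment> \<open>The first component of the cone boundary is \<open>- \<partial>\<close>, hence the sign of \<open>v\<close>.\<close>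
    let ?v = "(\<ominus>\<^bsub>tensor_power K L 3\<^esub> v, \<zero>\<^bsub>tensor_power K ?Q 4\<^esub>)"
    interpret TQ4: vectorspace K "tensor_power K ?Q 4" by (rule TQ)
    have vM: "?v \<in> carrier (?M 4)" using vT by (simp add: M4_eq)
    have dv: "?\<delta> 4 ?v = ?i (leibniz_boundary K L 3 v)"
      using vT pv module_hom_mem[OF bd vT]
      by (simp add: cone_boundary_def module_hom_neg[OF T3.module_axioms T2.module_axioms bd]
          module_hom_neg[OF T3.module_axioms TQ3.module_axioms pr]
          module_hom_zero[OF TQ4.module_axioms TQ3.module_axioms bq])
    have "(c, d) = ?\<delta> 4 ?v \<oplus>\<^bsub>?M 3\<^esub> ?i s"
      unfolding cvs d_zero dv by (rule module_hom_add[OF i module_hom_mem[OF bd vT] sT])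
    moreover have "z = (c, d) \<oplus>\<^bsub>?M 3\<^esub> ?\<delta> 4 w"
      unfolding cd[symmetric] using zM dw by (simp add: M3.M.minus_eq M3.M.a_assoc M3.M.l_neg)
    ultimately have "z = (?\<delta> 4 w \<oplus>\<^bsub>?M 3\<^esub> ?\<delta> 4 ?v) \<oplus>\<^bsub>?M 3\<^esub> ?i s"
      using dw module_hom_mem[OF d4 vM] module_hom_mem[OF i sT] by (simp add: M3.M.a_ac)
    also have "?\<delta> 4 w \<oplus>\<^bsub>?M 3\<^esub> ?\<delta> 4 ?v = ?\<delta> 4 (w \<oplus>\<^bsub>?M 4\<^esub> ?v)"
      by (rule module_hom_add[OF d4 w(1) vM, symmetric])
    finally have "z = ?\<delta> 4 (w \<oplus>\<^bsub>?M 4\<^esub> ?v) \<oplus>\<^bsub>?M 3\<^esub> ?i s" .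
    moreover have "w \<oplus>\<^bsub>?M 4\<^esub> ?v \<in> carrier (?M 4)" using w(1) vM by (rule M4.M.a_closed)
    moreover have "?i ` T2.span C \<subseteq> M3.span (?i ` C)"
      by (rule hom_image_span_subset[OF T2.module_axioms M3.module_axioms i M3.span_is_submodule[OF iC(2)]
            C(2) M3.in_own_span[OF iC(2)]])
    then have "?i s \<in> M3.span (?i ` C)" using s by blast
    ultimately show ?thesis by blast
  qed
  show ?thesis
    unfolding HL iC(3)[symmetric]
    by (rule dim_subquotient_le[OF cone'(2,7,5,8) Z B Z' B' p3 ZZ BB iC(1,2) main])
qed

end

section \<open>Quotient Leibniz algebras\<close>

context leibniz_algebra
begin

text \<open>With \<open>a = i + x\<close> and \<open>b = j + y\<close> one has \<open>[a, b] - [x, y] = [a, j] + [i, y]\<close>, which lies in the ideal.\<close>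

lemma coset_bracket:
  assumes I: "leibniz_ideal K I L" and x: "x \<in> carrier L" and y: "y \<in> carrier L"
  shows "(I +>\<^bsub>L\<^esub> x) \<otimes>\<^bsub>L Quotm I\<^esub> (I +>\<^bsub>L\<^esub> y) = I +>\<^bsub>L\<^esub> (x \<otimes>\<^bsub>L\<^esub> y)"
proof -
  have sub: "submodule K I L" using I by (simp add: leibniz_ideal_def)
  interpret J: abelian_subgroup I L by (rule submodule_abelian_subgroup[OF sub])
  have *: "I +>\<^bsub>L\<^esub> (a \<otimes>\<^bsub>L\<^esub> b) = I +>\<^bsub>L\<^esub> (x \<otimes>\<^bsub>L\<^esub> y)" if ab: "a \<in> I +>\<^bsub>L\<^esub> x" "b \<in> I +>\<^bsub>L\<^esub> y" for a b
  proof -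
    obtain i j where i: "i \<in> I" "a = i \<oplus>\<^bsub>L\<^esub> x" and j: "j \<in> I" "b = j \<oplus>\<^bsub>L\<^esub> y"
      using ab by (auto simp: a_r_coset_def')
    have c: "i \<in> carrier L" "j \<in> carrier L" using i j submodule.subset[OF sub] by auto
    have aL: "a \<in> carrier L" using i c x by simp
    have "a \<otimes>\<^bsub>L\<^esub> b = a \<otimes>\<^bsub>L\<^esub> j \<oplus>\<^bsub>L\<^esub> (i \<otimes>\<^bsub>L\<^esub> y \<oplus>\<^bsub>L\<^esub> x \<otimes>\<^bsub>L\<^esub> y)"
      using aL c x y by (simp add: j(2) bracket_add_right) (simp add: i(2) bracket_add_left)
    then have "a \<otimes>\<^bsub>L\<^esub> b \<ominus>\<^bsub>L\<^esub> x \<otimes>\<^bsub>L\<^esub> y = a \<otimes>\<^bsub>L\<^esub> j \<oplus>\<^bsub>L\<^esub> i \<otimes>\<^bsub>L\<^esub> y"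
      using aL c x y by (simp add: bracket_closed M.minus_eq M.a_assoc M.r_neg)
    moreover have "a \<otimes>\<^bsub>L\<^esub> j \<in> I" "i \<otimes>\<^bsub>L\<^esub> y \<in> I"
      using I aL y i(1) j(1) by (auto simp: leibniz_ideal_def)
    ultimately have "a \<otimes>\<^bsub>L\<^esub> b \<ominus>\<^bsub>L\<^esub> x \<otimes>\<^bsub>L\<^esub> y \<in> I" using submodule.m_closed[OF sub] by simp
    moreover have "a \<otimes>\<^bsub>L\<^esub> b \<in> carrier L" using aL j c y by (simp add: bracket_closed)
    ultimately show ?thesis using coset_eq_iff[OF sub] x y by (simp add: bracket_closed)
  qed
  have "x \<in> I +>\<^bsub>L\<^esub> x" "y \<in> I +>\<^bsub>L\<^esub> y" using J.a_rcos_self x y by auto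
  then have "(\<Union>a\<in>I +>\<^bsub>L\<^esub> x. \<Union>b\<in>I +>\<^bsub>L\<^esub> y. I +>\<^bsub>L\<^esub> (a \<otimes>\<^bsub>L\<^esub> b)) = I +>\<^bsub>L\<^esub> (x \<otimes>\<^bsub>L\<^esub> y)"
    using * by blast
  then show ?thesis by (simp add: rcoset_mult_def)
qed

lemma Quotm_leibniz_algebra:
  assumes I: "leibniz_ideal K I L"
  shows "leibniz_algebra K (L Quotm I)"
proof -
  let ?q = "\<lambda>x. I +>\<^bsub>L\<^esub> x"
  have sub: "submodule K I L" using I by (simp add: leibniz_ideal_def)
  interpret Q: vectorspace K "L Quotm I" by (rule Quotm_vectorspace[OF sub])
  note q = coset_hom[OF sub]
  note br = coset_bracket[OF I] and bc = bracket_closed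
  note hom = module_hom_add[OF q, symmetric] module_hom_smult[OF q, symmetric]
    module_hom_minus[OF module_axioms Q.module_axioms q, symmetric]
  have c: "\<exists>x\<in>carrier L. X = ?q x" if "X \<in> carrier (L Quotm I)" for X
    using that by (auto simp: carrier_Quotm)
  show ?thesis
  proof (unfold_locales, goal_cases)
    case (1 X Y)
    then obtain x y where "x \<in> carrier L" "X = ?q x" "y \<in> carrier L" "Y = ?q y" using c by meson
    then show ?case by (simp add: br bc del: Quotm_simps)
  next
    case (2 X Y Z)
    then obtain x y z where "x \<in> carrier L" "X = ?q x" "y \<in> carrier L" "Y = ?q y"
      "z \<in> carrier L" "Z = ?q z" using c by meson
    then show ?case by (simp add: br bc hom bracket_add_left del: Quotm_simps)
  next
    case (3 X Y Z)
    then obtain x y z where "x \<in> carrier L" "X = ?q x" "y \<in> carrier L" "Y = ?q y"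
      "z \<in> carrier L" "Z = ?q z" using c by meson
    then show ?case by (simp add: br bc hom bracket_add_right del: Quotm_simps)
  next
    case (4 a X Y)
    then obtain x y where "x \<in> carrier L" "X = ?q x" "y \<in> carrier L" "Y = ?q y" using c by meson
    then show ?case using 4(1) by (simp add: br bc hom bracket_smult_left del: Quotm_simps)
  next
    case (5 a X Y)
    then obtain x y where "x \<in> carrier L" "X = ?q x" "y \<in> carrier L" "Y = ?q y" using c by meson
    then show ?case using 5(1) by (simp add: br bc hom bracket_smult_right del: Quotm_simps)
  next
    case (6 X Y Z)
    then obtain x y z where "x \<in> carrier L" "X = ?q x" "y \<in> carrier L" "Y = ?q y"
      "z \<in> carrier L" "Z = ?q z" using c by meson
    then show ?case by (simp add: br bc hom leibniz_identity del: Quotm_simps)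
  qed
qed

lemma coset_leibniz_hom:
  "leibniz_ideal K I L \<Longrightarrow> (\<lambda>x. I +>\<^bsub>L\<^esub> x) \<in> leibniz_hom K L (L Quotm I)"
  using coset_hom coset_bracket by (simp add: leibniz_hom_def leibniz_ideal_def)

lemma relative_center_ideal:
  assumes N: "leibniz_ideal K N L"
  shows "leibniz_ideal K (relative_center L N) L"
proof -
  have Ns: "submodule K N L" using N by (simp add: leibniz_ideal_def)
  have zero: "\<zero>\<^bsub>L\<^esub> \<otimes>\<^bsub>L\<^esub> x = \<zero>\<^bsub>L\<^esub>" "x \<otimes>\<^bsub>L\<^esub> \<zero>\<^bsub>L\<^esub> = \<zero>\<^bsub>L\<^esub>" if "x \<in> carrier L" for x
    using module_hom_zero[OF module_axioms module_axioms bracket_left_hom[OF that]]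
      module_hom_zero[OF module_axioms module_axioms bracket_right_hom[OF that]] by simp_all
  have "submodule K (leibniz_center L) L"
    by (rule submoduleI)
      (auto simp: leibniz_center_def zero bracket_add_left bracket_add_right bracket_smult_left bracket_smult_right)
  then have "submodule K (relative_center L N) L"
    unfolding relative_center_def using Ns by (rule submodule_Int)
  moreover have "x \<otimes>\<^bsub>L\<^esub> y \<in> relative_center L N \<and> y \<otimes>\<^bsub>L\<^esub> x \<in> relative_center L N"
    if "x \<in> relative_center L N" "y \<in> carrier L" for x y
    using that zero submodule.zero_closed[OF Ns]
    by (simp add: relative_center_def leibniz_center_def)
  ultimately show ?thesis by (simp add: leibniz_ideal_def)
qed

lemma brackets_closed: "{a \<otimes>\<^bsub>L\<^esub> b | a b. a \<in> carrier L \<and> b \<in> carrier L} \<subseteq> carrier L"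
  using bracket_closed by blast

lemma square_submodule: "submodule K (leibniz_square K L) L"
  unfolding leibniz_square_def bracket_span_def by (rule span_is_submodule[OF brackets_closed])

lemma bracket_in_square: "\<lbrakk>x \<in> carrier L; y \<in> carrier L\<rbrakk> \<Longrightarrow> x \<otimes>\<^bsub>L\<^esub> y \<in> leibniz_square K L"
  unfolding leibniz_square_def bracket_span_def using in_own_span[OF brackets_closed] by blast

lemma square_subset:
  assumes "submodule K X L" "\<And>x y. \<lbrakk>x \<in> carrier L; y \<in> carrier L\<rbrakk> \<Longrightarrow> x \<otimes>\<^bsub>L\<^esub> y \<in> X"
  shows "leibniz_square K L \<subseteq> X"
  unfolding leibniz_square_def bracket_span_def
  by (rule span_is_subset[OF _ assms(1)]) (use assms(2) in blast)

lemma square_Int_ideal: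
  assumes "leibniz_ideal K N L"
  shows "leibniz_ideal K (leibniz_square K L \<inter> N) L"
  using assms submodule_Int[OF square_submodule] bracket_in_square submodule.subset[OF square_submodule]
  by (auto simp: leibniz_ideal_def)

lemma coset_image_ideal:
  assumes I: "leibniz_ideal K I L" and N: "leibniz_ideal K N L"
  shows "leibniz_ideal K (coset_image L I N) (L Quotm I)"
proof -
  have Ns: "submodule K N L" and Is: "submodule K I L" using I N by (simp_all add: leibniz_ideal_def)
  have NL: "N \<subseteq> carrier L" by (rule submodule.subset[OF Ns])
  have "submodule K (coset_image L I N) (L Quotm I)"
    unfolding coset_image_def
    by (rule submodule_image[OF module_axioms Quotm_module[OF Is] coset_hom[OF Is] Ns])
  moreover have "X \<otimes>\<^bsub>L Quotm I\<^esub> Y \<in> coset_image L I N \<and> Y \<otimes>\<^bsub>L Quotm I\<^esub> X \<in> coset_image L I N"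
    if XY: "X \<in> coset_image L I N" "Y \<in> carrier (L Quotm I)" for X Y
  proof -
    obtain x y where x: "x \<in> N" "X = I +>\<^bsub>L\<^esub> x" and y: "y \<in> carrier L" "Y = I +>\<^bsub>L\<^esub> y"
      using XY by (auto simp: coset_image_def carrier_Quotm)
    have xL: "x \<in> carrier L" using x NL by blast
    have "x \<otimes>\<^bsub>L\<^esub> y \<in> N" "y \<otimes>\<^bsub>L\<^esub> x \<in> N" using N x y by (auto simp: leibniz_ideal_def)
    then show ?thesis
      unfolding x(2) y(2) coset_bracket[OF I xL y(1)] coset_bracket[OF I y(1) xL] coset_image_def
      by blast
  qed
  ultimately show ?thesis by (simp add: leibniz_ideal_def)
qed

lemma generator_number_attained:
  assumes "fin_dim"
  obtains S where "finite S" "card S = generator_number K L" "S \<subseteq> carrier L"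
    "leibniz_generated K L S = carrier L"
proof -
  obtain S where S: "finite S" "S \<subseteq> carrier L" "span S = carrier L"
    using assms unfolding fin_dim_def by blast
  have "carrier L \<subseteq> H" if H: "leibniz_subalgebra K H L" "S \<subseteq> H" for H
    using span_is_subset[OF H(2)] H(1) S(3) by (simp add: leibniz_subalgebra_def)
  moreover have "leibniz_subalgebra K (carrier L) L"
    by (simp add: leibniz_subalgebra_def submodule_carrier bracket_closed)
  ultimately have "leibniz_generated K L S = carrier L"
    unfolding leibniz_generated_def using S(2) by blast
  then have "\<exists>n S. finite S \<and> card S = n \<and> S \<subseteq> carrier L \<and> leibniz_generated K L S = carrier L"
    using S by blast
  from LeastI_ex[OF this] show thesis
    using that unfolding generator_number_def by blast
qed

text \<open>The image of \<open>H\<close> in \<open>L / I\<close> is a subalgebra that contains the generators, hence everything; and \<open>H\<close>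
contains every coset of \<open>I\<close> that it meets.\<close>

lemma subalgebra_eq_carrier:
  assumes I: "leibniz_ideal K I L" and gen: "leibniz_generated K (L Quotm I) ((\<lambda>x. I +>\<^bsub>L\<^esub> x) ` S) = carrier (L Quotm I)"
    and H: "leibniz_subalgebra K H L" and sub: "S \<subseteq> H" "I \<subseteq> H"
  shows "H = carrier L"
proof -
  let ?q = "\<lambda>x. I +>\<^bsub>L\<^esub> x"
  have Is: "submodule K I L" and Hs: "submodule K H L"
    using I H by (simp_all add: leibniz_ideal_def leibniz_subalgebra_def)
  have HL: "H \<subseteq> carrier L" by (rule submodule.subset[OF Hs])
  have "?q x \<otimes>\<^bsub>L Quotm I\<^esub> ?q y \<in> ?q ` H" if "x \<in> H" "y \<in> H" for x y
  proof -
    have xy: "x \<in> carrier L" "y \<in> carrier L" using that HL by auto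
    show ?thesis
      unfolding coset_bracket[OF I xy] using that H by (simp add: leibniz_subalgebra_def)
  qed
  then have "leibniz_subalgebra K (?q ` H) (L Quotm I)"
    unfolding leibniz_subalgebra_def
    using submodule_image[OF module_axioms Quotm_module[OF Is] coset_hom[OF Is] Hs] by blast
  then have "carrier (L Quotm I) \<subseteq> ?q ` H"
    using sub(1) unfolding gen[symmetric] leibniz_generated_def by blast
  then have "y \<in> H" if y: "y \<in> carrier L" for y
  proof -
    have "?q y \<in> ?q ` H" using \<open>carrier (L Quotm I) \<subseteq> ?q ` H\<close> y by auto
    then obtain h where h: "h \<in> H" "?q y = ?q h" by blast
    have hL: "h \<in> carrier L" using h(1) HL by blast
    have "y \<ominus>\<^bsub>L\<^esub> h \<in> H" using coset_eq_iff[OF Is y hL] h(2) sub(2) by blast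
    then have "y \<ominus>\<^bsub>L\<^esub> h \<oplus>\<^bsub>L\<^esub> h \<in> H" using h(1) by (rule submodule.m_closed[OF Hs])
    then show ?thesis using y hL by (simp add: M.minus_eq M.a_assoc M.l_neg)
  qed
  then show ?thesis using HL by blast
qed

section \<open>Reduction to generators\<close>

text \<open>The core of the argument.  Write \<open>m\<close> for the intersection of the square of \<open>L\<close> with \<open>N\<close> and \<open>Z\<close> for the
relative center.  Modulo \<open>X\<close> the boundary of \<open>a \<otimes> b \<otimes> c\<close> gives
\<open>[a, b] \<otimes> c \<equiv> [a, c] \<otimes> b + a \<otimes> [b, c]\<close> as soon as one of \<open>a, b, c\<close> is in \<open>N\<close>.

For \<open>a \<in> m\<close> it shows that \<open>{y. m \<otimes> y \<subseteq> X}\<close> is closed under brackets, since \<open>[a, b]\<close> and \<open>[a, c]\<close> are again in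
the ideal \<open>m\<close>.  The set contains \<open>S\<close> by the assumption on \<open>\<beta>\<close> and linearity.
It contains \<open>Z\<close>: if \<open>c\<close> is in \<open>Z\<close>, both terms on the right vanish, so \<open>[a, b] \<otimes> c \<equiv> 0\<close> for all \<open>a, b\<close>, and these brackets span the square of \<open>L\<close>, which contains
\<open>m\<close>.  As \<open>S\<close> and \<open>Z\<close> generate \<open>L\<close>, the set is all of \<open>L\<close>.

The set \<open>{y. y \<otimes> m \<subseteq> X}\<close> is treated in the same way with \<open>c \<in> m\<close>; its closure under brackets uses the first
half, because \<open>[a, c] \<otimes> b\<close> has its entry from \<open>m\<close> on the left.\<close>

lemma pure_tensors_reduce_to_generators:
  assumes N: "leibniz_ideal K N L"
    and X: "submodule K X (tensor_power K L 2)"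
    and bd: "\<And>x y z. \<lbrakk>x \<in> carrier L; y \<in> carrier L; z \<in> carrier L; x \<in> N \<or> y \<in> N \<or> z \<in> N\<rbrakk>
      \<Longrightarrow> leibniz_boundary K L 3 (pure_tensor K L [x, y, z]) \<in> X"
    and gen: "leibniz_generated K (L Quotm relative_center L N) ((\<lambda>x. relative_center L N +>\<^bsub>L\<^esub> x) ` S)
        = carrier (L Quotm relative_center L N)"
    and \<beta>: "\<beta> \<subseteq> leibniz_square K L \<inter> N" "span \<beta> = leibniz_square K L \<inter> N"
    and S: "S \<subseteq> carrier L"
    and base: "\<And>b s. \<lbrakk>b \<in> \<beta>; s \<in> S\<rbrakk> \<Longrightarrow> pure_tensor K L [b, s] \<in> X"
      "\<And>b s. \<lbrakk>b \<in> \<beta>; s \<in> S\<rbrakk> \<Longrightarrow> pure_tensor K L [s, b] \<in> X"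
    and x: "x \<in> leibniz_square K L \<inter> N" and y: "y \<in> carrier L"
  shows "pure_tensor K L [x, y] \<in> X" "pure_tensor K L [y, x] \<in> X"
proof -
  let ?m = "leibniz_square K L \<inter> N" and ?T = "tensor_power K L 2"
  interpret T: module K ?T by (rule tensor_power_module)
  have mi: "leibniz_ideal K ?m L" by (rule square_Int_ideal[OF N])
  then have ms: "submodule K ?m L" by (simp add: leibniz_ideal_def)
  have mL: "?m \<subseteq> carrier L" by (rule submodule.subset[OF ms])
  have m_bracket: "a \<otimes>\<^bsub>L\<^esub> b \<in> ?m" "b \<otimes>\<^bsub>L\<^esub> a \<in> ?m" if "a \<in> ?m" "b \<in> carrier L" for a b
    using mi that unfolding leibniz_ideal_def by blast+
  have pt: "pure_tensor K L [a, b] \<in> carrier ?T" if "a \<in> carrier L" "b \<in> carrier L" for a b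
    using that by (simp add: words_def)
  have lin1: "(\<lambda>a. pure_tensor K L [a, b]) \<in> module_hom K L ?T" if "b \<in> carrier L" for b
    using multilinear_slot_hom[OF pure_tensor_multilinear, of "[]" "[b]" 2] that by (simp add: words_def)
  have lin2: "(\<lambda>b. pure_tensor K L [a, b]) \<in> module_hom K L ?T" if "a \<in> carrier L" for a
    using multilinear_slot_hom[OF pure_tensor_multilinear, of "[a]" "[]" 2] that by (simp add: words_def)
  have z1: "pure_tensor K L [\<zero>\<^bsub>L\<^esub>, b] = \<zero>\<^bsub>?T\<^esub>" if "b \<in> carrier L" for b
    by (rule module_hom_zero[OF module_axioms T.module_axioms lin1[OF that]])
  have z2: "pure_tensor K L [a, \<zero>\<^bsub>L\<^esub>] = \<zero>\<^bsub>?T\<^esub>" if "a \<in> carrier L" for a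
    by (rule module_hom_zero[OF module_axioms T.module_axioms lin2[OF that]])
  have rel: "pure_tensor K L [a \<otimes>\<^bsub>L\<^esub> b, c] \<ominus>\<^bsub>?T\<^esub>
      (pure_tensor K L [a \<otimes>\<^bsub>L\<^esub> c, b] \<oplus>\<^bsub>?T\<^esub> pure_tensor K L [a, b \<otimes>\<^bsub>L\<^esub> c]) \<in> X"
    if "a \<in> carrier L" "b \<in> carrier L" "c \<in> carrier L" "a \<in> N \<or> b \<in> N \<or> c \<in> N" for a b c
    using bd[OF that] boundary_pure_3[OF that(1-3)] by simp
  \<comment> \<open>Solving the relation for its left side and for its last term.\<close>
  have solve1: "p \<in> X" if "p \<ominus>\<^bsub>?T\<^esub> (q \<oplus>\<^bsub>?T\<^esub> r) \<in> X" "p \<in> carrier ?T" "q \<in> X" "r \<in> X" for p q r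
  proof -
    have c: "q \<in> carrier ?T" "r \<in> carrier ?T" using that(3,4) submodule.subset[OF X] by auto
    have "p \<ominus>\<^bsub>?T\<^esub> (q \<oplus>\<^bsub>?T\<^esub> r) \<oplus>\<^bsub>?T\<^esub> (q \<oplus>\<^bsub>?T\<^esub> r) \<in> X"
      by (intro submodule.m_closed[OF X] that)
    then show ?thesis using c that(2) by (simp add: T.M.minus_eq T.M.a_assoc T.M.l_neg)
  qed
  have solve3: "r \<in> X" if "p \<ominus>\<^bsub>?T\<^esub> (q \<oplus>\<^bsub>?T\<^esub> r) \<in> X" "p \<in> X" "q \<in> X" "r \<in> carrier ?T" for p q r
  proof -
    have c: "p \<in> carrier ?T" "q \<in> carrier ?T" using that(2,3) submodule.subset[OF X] by auto
    have "p \<ominus>\<^bsub>?T\<^esub> (p \<ominus>\<^bsub>?T\<^esub> (q \<oplus>\<^bsub>?T\<^esub> r)) \<in> X"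
      by (intro T.submodule_minus[OF X] that)
    moreover have "p \<ominus>\<^bsub>?T\<^esub> (p \<ominus>\<^bsub>?T\<^esub> (q \<oplus>\<^bsub>?T\<^esub> r)) = q \<oplus>\<^bsub>?T\<^esub> r"
      using c that(4) by (simp add: T.M.minus_eq T.M.minus_add T.M.a_assoc[symmetric] T.M.r_neg)
    ultimately have "q \<oplus>\<^bsub>?T\<^esub> r \<ominus>\<^bsub>?T\<^esub> q \<in> X" using T.submodule_minus[OF X _ that(3)] by simp
    moreover have "q \<oplus>\<^bsub>?T\<^esub> r \<ominus>\<^bsub>?T\<^esub> q = r"
      using c that(4) by (simp add: T.M.minus_eq T.M.a_comm[of q r] T.M.a_assoc T.M.r_neg)
    ultimately show ?thesis by simp
  qed
  have X0: "\<zero>\<^bsub>?T\<^esub> \<in> X" by (rule submodule.zero_closed[OF X])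
  let ?Z = "relative_center L N"
  have Zi: "leibniz_ideal K ?Z L" by (rule relative_center_ideal[OF N])
  have Z: "z \<in> carrier L" "z \<in> N" if "z \<in> ?Z" for z
    using that by (auto simp: relative_center_def leibniz_center_def)
  have Zb: "z \<otimes>\<^bsub>L\<^esub> a = \<zero>\<^bsub>L\<^esub>" "a \<otimes>\<^bsub>L\<^esub> z = \<zero>\<^bsub>L\<^esub>" if "z \<in> ?Z" "a \<in> carrier L" for z a
    using that by (auto simp: relative_center_def leibniz_center_def)
  have square_center_1: "pure_tensor K L [a, z] \<in> X" if z: "z \<in> ?Z" and a: "a \<in> leibniz_square K L" for z a
  proof -
    have "leibniz_square K L \<subseteq> {a \<in> carrier L. pure_tensor K L [a, z] \<in> X}"
    proof (rule square_subset[OF submodule_vimage[OF module_axioms T.module_axioms lin1[OF Z(1)[OF z]] X]], safe)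
      fix u v assume uv: "u \<in> carrier L" "v \<in> carrier L"
      show "u \<otimes>\<^bsub>L\<^esub> v \<in> carrier L" by (rule bracket_closed[OF uv])
      show "pure_tensor K L [u \<otimes>\<^bsub>L\<^esub> v, z] \<in> X"
        using rel[OF uv Z(1)[OF z]] Z(2)[OF z]
        by (intro solve1[OF _ pt[OF bracket_closed[OF uv] Z(1)[OF z]] X0 X0])
          (simp add: Zb[OF z] z1 z2 uv)
    qed
    then show ?thesis using a by blast
  qed
  have square_center_2: "pure_tensor K L [z, a] \<in> X" if z: "z \<in> ?Z" and a: "a \<in> leibniz_square K L" for z a
  proof -
    have "leibniz_square K L \<subseteq> {a \<in> carrier L. pure_tensor K L [z, a] \<in> X}"
    proof (rule square_subset[OF submodule_vimage[OF module_axioms T.module_axioms lin2[OF Z(1)[OF z]] X]], safe)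
      fix u v assume uv: "u \<in> carrier L" "v \<in> carrier L"
      show "u \<otimes>\<^bsub>L\<^esub> v \<in> carrier L" by (rule bracket_closed[OF uv])
      show "pure_tensor K L [z, u \<otimes>\<^bsub>L\<^esub> v] \<in> X"
        using rel[OF Z(1)[OF z] uv] Z(2)[OF z]
        by (intro solve3[OF _ X0 X0 pt[OF Z(1)[OF z] bracket_closed[OF uv]]])
          (simp add: Zb[OF z] z1 uv)
    qed
    then show ?thesis using a by blast
  qed
  have span_base: "pure_tensor K L [a, s] \<in> X" "pure_tensor K L [s, a] \<in> X" if s: "s \<in> S" and a: "a \<in> ?m" for s a
  proof -
    have sL: "s \<in> carrier L" using s S by blast
    have \<beta>L: "\<beta> \<subseteq> carrier L" using \<beta>(1) mL by blast
    have "(\<lambda>a. pure_tensor K L [a, s]) ` span \<beta> \<subseteq> X"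
      by (rule hom_image_span_subset[OF module_axioms T.module_axioms lin1[OF sL] X \<beta>L])
        (use base(1) s in blast)
    then show "pure_tensor K L [a, s] \<in> X" using a \<beta>(2) by blast
    have "(\<lambda>a. pure_tensor K L [s, a]) ` span \<beta> \<subseteq> X"
      by (rule hom_image_span_subset[OF module_axioms T.module_axioms lin2[OF sL] X \<beta>L])
        (use base(2) s in blast)
    then show "pure_tensor K L [s, a] \<in> X" using a \<beta>(2) by blast
  qed
  have submod1: "submodule K {y \<in> carrier L. \<forall>a\<in>?m. pure_tensor K L [a, y] \<in> X} L"
  proof (rule submoduleI)
    show "\<zero>\<^bsub>L\<^esub> \<in> {y \<in> carrier L. \<forall>a\<in>?m. pure_tensor K L [a, y] \<in> X}"
      using z2 X0 mL by auto
    fix b c assume bc: "b \<in> {y \<in> carrier L. \<forall>a\<in>?m. pure_tensor K L [a, y] \<in> X}"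
      "c \<in> {y \<in> carrier L. \<forall>a\<in>?m. pure_tensor K L [a, y] \<in> X}"
    have "pure_tensor K L [a, b \<oplus>\<^bsub>L\<^esub> c] \<in> X" if a: "a \<in> ?m" for a
    proof -
      have aL: "a \<in> carrier L" using a mL by blast
      show ?thesis
        using module_hom_add[OF lin2[OF aL], of b c] bc a submodule.m_closed[OF X] by simp
    qed
    then show "b \<oplus>\<^bsub>L\<^esub> c \<in> {y \<in> carrier L. \<forall>a\<in>?m. pure_tensor K L [a, y] \<in> X}" using bc by simp
  next
    fix k b assume k: "k \<in> carrier K" and b: "b \<in> {y \<in> carrier L. \<forall>a\<in>?m. pure_tensor K L [a, y] \<in> X}"
    have "pure_tensor K L [a, k \<odot>\<^bsub>L\<^esub> b] \<in> X" if a: "a \<in> ?m" for a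
    proof -
      have aL: "a \<in> carrier L" using a mL by blast
      show ?thesis
        using module_hom_smult[OF lin2[OF aL] k, of b] b a submodule.smult_closed[OF X k] by simp
    qed
    then show "k \<odot>\<^bsub>L\<^esub> b \<in> {y \<in> carrier L. \<forall>a\<in>?m. pure_tensor K L [a, y] \<in> X}" using b k by simp
  qed blast
  have "{y \<in> carrier L. \<forall>a\<in>?m. pure_tensor K L [a, y] \<in> X} = carrier L" (is "?D = _")
  proof (rule subalgebra_eq_carrier[OF Zi gen])
    have "b \<otimes>\<^bsub>L\<^esub> c \<in> ?D" if b: "b \<in> ?D" and c: "c \<in> ?D" for b c
    proof -
      have bL: "b \<in> carrier L" and cL: "c \<in> carrier L" using b c by simp_all
      have "pure_tensor K L [a, b \<otimes>\<^bsub>L\<^esub> c] \<in> X" if a: "a \<in> ?m" for a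
      proof (rule solve3[OF rel])
        show aL: "a \<in> carrier L" "a \<in> N \<or> b \<in> N \<or> c \<in> N" using a mL by auto
        show "pure_tensor K L [a \<otimes>\<^bsub>L\<^esub> b, c] \<in> X" using m_bracket(1)[OF a bL] c by simp
        show "pure_tensor K L [a \<otimes>\<^bsub>L\<^esub> c, b] \<in> X" using m_bracket(1)[OF a cL] b by simp
        show "pure_tensor K L [a, b \<otimes>\<^bsub>L\<^esub> c] \<in> carrier ?T" by (rule pt[OF aL(1) bracket_closed[OF bL cL]])
      qed (rule bL cL)+
      then show ?thesis using bracket_closed[OF bL cL] by simp
    qed
    then show "leibniz_subalgebra K ?D L" using submod1 by (simp add: leibniz_subalgebra_def)
    show "S \<subseteq> ?D" using S span_base(1) by blast
    show "?Z \<subseteq> ?D" using Z(1) square_center_1 by blast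
  qed
  then have all1: "pure_tensor K L [a, b] \<in> X" if "a \<in> ?m" "b \<in> carrier L" for a b
    using that by blast
  then show "pure_tensor K L [x, y] \<in> X" using x y by blast
  have submod2: "submodule K {y \<in> carrier L. \<forall>a\<in>?m. pure_tensor K L [y, a] \<in> X} L"
  proof (rule submoduleI)
    show "\<zero>\<^bsub>L\<^esub> \<in> {y \<in> carrier L. \<forall>a\<in>?m. pure_tensor K L [y, a] \<in> X}"
      using z1 X0 mL by auto
    fix b c assume bc: "b \<in> {y \<in> carrier L. \<forall>a\<in>?m. pure_tensor K L [y, a] \<in> X}"
      "c \<in> {y \<in> carrier L. \<forall>a\<in>?m. pure_tensor K L [y, a] \<in> X}"
    have "pure_tensor K L [b \<oplus>\<^bsub>L\<^esub> c, a] \<in> X" if a: "a \<in> ?m" for a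
    proof -
      have aL: "a \<in> carrier L" using a mL by blast
      show ?thesis
        using module_hom_add[OF lin1[OF aL], of b c] bc a submodule.m_closed[OF X] by simp
    qed
    then show "b \<oplus>\<^bsub>L\<^esub> c \<in> {y \<in> carrier L. \<forall>a\<in>?m. pure_tensor K L [y, a] \<in> X}" using bc by simp
  next
    fix k b assume k: "k \<in> carrier K" and b: "b \<in> {y \<in> carrier L. \<forall>a\<in>?m. pure_tensor K L [y, a] \<in> X}"
    have "pure_tensor K L [k \<odot>\<^bsub>L\<^esub> b, a] \<in> X" if a: "a \<in> ?m" for a
    proof -
      have aL: "a \<in> carrier L" using a mL by blast
      show ?thesis
        using module_hom_smult[OF lin1[OF aL] k, of b] b a submodule.smult_closed[OF X k] by simp
    qed
    then show "k \<odot>\<^bsub>L\<^esub> b \<in> {y \<in> carrier L. \<forall>a\<in>?m. pure_tensor K L [y, a] \<in> X}" using b k by simp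
  qed blast
  have "{y \<in> carrier L. \<forall>a\<in>?m. pure_tensor K L [y, a] \<in> X} = carrier L" (is "?D = _")
  proof (rule subalgebra_eq_carrier[OF Zi gen])
    have "b \<otimes>\<^bsub>L\<^esub> c \<in> ?D" if b: "b \<in> ?D" and c: "c \<in> ?D" for b c
    proof -
      have bL: "b \<in> carrier L" and cL: "c \<in> carrier L" using b c by simp_all
      have "pure_tensor K L [b \<otimes>\<^bsub>L\<^esub> c, a] \<in> X" if a: "a \<in> ?m" for a
      proof (rule solve1[OF rel])
        show aL: "a \<in> carrier L" "b \<in> N \<or> c \<in> N \<or> a \<in> N" using a mL by auto
        show "pure_tensor K L [b \<otimes>\<^bsub>L\<^esub> a, c] \<in> X" by (rule all1[OF m_bracket(2)[OF a bL] cL])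
        show "pure_tensor K L [b, c \<otimes>\<^bsub>L\<^esub> a] \<in> X" using m_bracket(2)[OF a cL] b by simp
        show "pure_tensor K L [b \<otimes>\<^bsub>L\<^esub> c, a] \<in> carrier ?T" by (rule pt[OF bracket_closed[OF bL cL] aL(1)])
      qed (rule bL cL)+
      then show ?thesis using bracket_closed[OF bL cL] by simp
    qed
    then show "leibniz_subalgebra K ?D L" using submod2 by (simp add: leibniz_subalgebra_def)
    show "S \<subseteq> ?D" using S span_base(2) by blast
    show "?Z \<subseteq> ?D" using Z(1) square_center_2 by blast
  qed
  then show "pure_tensor K L [y, x] \<in> X" using x y by blast
qed

end

section \<open>The bound on relative homology\<close>

text \<open>The map \<open>\<sigma>\<close> is the isomorphism \<open>L / N \<cong> (L / I) / (N / I)\<close>, obtained by lifting the composite projection from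
\<open>L\<close>, which kills \<open>N\<close>.  It is injective because an element congruent to an element of \<open>N\<close> modulo
\<open>I \<subseteq> N\<close> is itself in \<open>N\<close>.\<close>

lemma quotient_pair_morphism:
  assumes L: "leibniz_algebra K L" and I: "leibniz_ideal K I L" and N: "leibniz_ideal K N L" and sub: "I \<subseteq> N"
  obtains \<sigma> where "pair_morphism K L (L Quotm I) N (coset_image L I N) (\<lambda>x. I +>\<^bsub>L\<^esub> x) \<sigma>"
    "\<sigma> ` carrier (L Quotm N) = carrier ((L Quotm I) Quotm coset_image L I N)"
    "\<And>X. \<lbrakk>X \<in> carrier (L Quotm N); \<sigma> X = \<zero>\<^bsub>(L Quotm I) Quotm coset_image L I N\<^esub>\<rbrakk> \<Longrightarrow> X = \<zero>\<^bsub>L Quotm N\<^esub>"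
proof -
  interpret L: leibniz_algebra K L by fact
  let ?L' = "L Quotm I" and ?N' = "coset_image L I N"
  let ?Q = "L Quotm N" and ?Q' = "?L' Quotm ?N'"
  let ?\<rho> = "\<lambda>x. I +>\<^bsub>L\<^esub> x" and ?p = "\<lambda>x. N +>\<^bsub>L\<^esub> x" and ?p' = "\<lambda>X. ?N' +>\<^bsub>?L'\<^esub> X"
  interpret L': leibniz_algebra K ?L' by (rule L.Quotm_leibniz_algebra[OF I])
  have N': "leibniz_ideal K ?N' ?L'" by (rule L.coset_image_ideal[OF I N])
  interpret Q: leibniz_algebra K ?Q by (rule L.Quotm_leibniz_algebra[OF N])
  interpret Q': leibniz_algebra K ?Q' by (rule L'.Quotm_leibniz_algebra[OF N'])
  have Ns: "submodule K N L" and Is: "submodule K I L" and N's: "submodule K ?N' ?L'"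
    using N I N' by (simp_all add: leibniz_ideal_def)
  have NL: "N \<subseteq> carrier L" by (rule submodule.subset[OF Ns])
  have \<rho>: "?\<rho> \<in> leibniz_hom K L ?L'" by (rule L.coset_leibniz_hom[OF I])
  have \<rho>m: "?\<rho> \<in> module_hom K L ?L'" by (rule L.coset_hom[OF Is])
  have p': "?p' \<in> leibniz_hom K ?L' ?Q'" by (rule L'.coset_leibniz_hom[OF N'])
  have p'm: "?p' \<in> module_hom K ?L' ?Q'" by (rule L'.coset_hom[OF N's])
  have kill: "?p' (?\<rho> x) = \<zero>\<^bsub>?Q'\<^esub>" if x: "x \<in> N" for x
  proof -
    have "?\<rho> x \<in> ?N'" using x by (auto simp: coset_image_def)
    moreover have "?\<rho> x \<in> carrier ?L'" using x NL by auto
    ultimately show ?thesis using L'.coset_eq_zero_iff[OF N's] by simp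
  qed
  obtain \<sigma> where \<sigma>: "\<sigma> \<in> module_hom K ?Q ?Q'" "\<And>x. x \<in> carrier L \<Longrightarrow> \<sigma> (?p x) = ?p' (?\<rho> x)"
    using Quotm_lift[OF L.module_axioms Q'.module_axioms Ns module_hom_comp[OF \<rho>m p'm] kill] by blast
  have \<sigma>l: "\<sigma> \<in> leibniz_hom K ?Q ?Q'"
    unfolding leibniz_hom_def
  proof (rule CollectI, intro conjI ballI \<sigma>(1))
    fix X Y assume "X \<in> carrier ?Q" "Y \<in> carrier ?Q"
    then obtain x y where x: "x \<in> carrier L" "X = ?p x" and y: "y \<in> carrier L" "Y = ?p y"
      by (auto simp: carrier_Quotm)
    have r: "?\<rho> x \<in> carrier ?L'" "?\<rho> y \<in> carrier ?L'" using x y by simp_all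
    show "\<sigma> (X \<otimes>\<^bsub>?Q\<^esub> Y) = \<sigma> X \<otimes>\<^bsub>?Q'\<^esub> \<sigma> Y"
      unfolding x(2) y(2) L.coset_bracket[OF N x(1) y(1)] \<sigma>(2)[OF L.bracket_closed[OF x(1) y(1)]]
        \<sigma>(2)[OF x(1)] \<sigma>(2)[OF y(1)] L'.coset_bracket[OF N' r] L.coset_bracket[OF I x(1) y(1)] ..
  qed
  have "pair_morphism K L ?L' N ?N' ?\<rho> \<sigma>"
    by (intro pair_morphism.intro pair_morphism_axioms.intro L.leibniz_algebra_axioms L'.leibniz_algebra_axioms
        Q.leibniz_algebra_axioms Q'.leibniz_algebra_axioms Ns N's \<rho> \<sigma>l \<sigma>(2))
  moreover have "\<sigma> ` carrier ?Q = carrier ?Q'"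
  proof -
    have "\<sigma> ` carrier ?Q = (\<lambda>x. ?p' (?\<rho> x)) ` carrier L"
      unfolding carrier_Quotm[of L N] image_image using \<sigma>(2) by (rule image_cong[OF refl])
    then show ?thesis by (simp add: carrier_Quotm image_image)
  qed
  moreover have "X = \<zero>\<^bsub>?Q\<^esub>" if X: "X \<in> carrier ?Q" "\<sigma> X = \<zero>\<^bsub>?Q'\<^esub>" for X
  proof -
    obtain x where x: "x \<in> carrier L" "X = ?p x" using X(1) by (auto simp: carrier_Quotm)
    have rx: "?\<rho> x \<in> carrier ?L'" using x(1) by simp
    have "?p' (?\<rho> x) = ?N'" using X(2) \<sigma>(2)[OF x(1)] x(2) by simp
    then have "?\<rho> x \<in> ?N'" using L'.coset_eq_zero_iff[OF N's rx] by blast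
    then obtain y where y: "y \<in> N" "?\<rho> x = ?\<rho> y" by (auto simp: coset_image_def)
    have yL: "y \<in> carrier L" using y(1) NL by blast
    have "x \<ominus>\<^bsub>L\<^esub> y \<in> N" using L.coset_eq_iff[OF Is x(1) yL] y(2) sub by blast
    then have "x \<ominus>\<^bsub>L\<^esub> y \<oplus>\<^bsub>L\<^esub> y \<in> N" using y(1) by (rule submodule.m_closed[OF Ns])
    then have "x \<in> N" using x(1) yL by (simp add: L.M.minus_eq L.M.a_assoc L.M.l_neg)
    then show ?thesis using L.coset_eq_zero_iff[OF Ns x(1)] x(2) by simp
  qed
  ultimately show thesis by (rule that)
qed

theorem theorem3p6:
  fixes K :: "('k, 'm) ring_scheme" and L :: "('k, 'v, 'n) module_scheme" and N :: "'v set"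
  assumes "leibniz_algebra K L"
    and "vectorspace.fin_dim K L"
    and "leibniz_nilpotent K L"
    and "leibniz_ideal K N L"
  shows "vectorspace.dim K (relative_HL K 2 L N)
    \<le> vectorspace.dim K
        (relative_HL K 2 (L Quotm (leibniz_square K L \<inter> N))
          (coset_image L (leibniz_square K L \<inter> N) N))
      + 2 * vectorspace.dim K (L\<lparr>carrier := leibniz_square K L \<inter> N\<rparr>)
          * generator_number K (L Quotm relative_center L N)"
proof -
  interpret L: leibniz_algebra K L by fact
  note fd = assms(2) and N = assms(4)
  let ?m = "leibniz_square K L \<inter> N" and ?Z = "relative_center L N"
  have m: "leibniz_ideal K ?m L" by (rule L.square_Int_ideal[OF N])
  then have ms: "submodule K ?m L" by (simp add: leibniz_ideal_def)
  have mL: "?m \<subseteq> carrier L" by (rule submodule.subset[OF ms])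
  have Z: "leibniz_ideal K ?Z L" by (rule L.relative_center_ideal[OF N])
  then have Zs: "submodule K ?Z L" by (simp add: leibniz_ideal_def)
  have Ns: "submodule K N L" using N by (simp add: leibniz_ideal_def)
  obtain \<sigma> where pm: "pair_morphism K L (L Quotm ?m) N (coset_image L ?m N) (\<lambda>x. ?m +>\<^bsub>L\<^esub> x) \<sigma>"
    and \<sigma>: "\<sigma> ` carrier (L Quotm N) = carrier ((L Quotm ?m) Quotm coset_image L ?m N)"
      "\<And>X. \<lbrakk>X \<in> carrier (L Quotm N); \<sigma> X = \<zero>\<^bsub>(L Quotm ?m) Quotm coset_image L ?m N\<^esub>\<rbrakk> \<Longrightarrow> X = \<zero>\<^bsub>L Quotm N\<^esub>"
    using quotient_pair_morphism[OF assms(1) m N Int_lower2] by blast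
  interpret pm: pair_morphism K L "L Quotm ?m" N "coset_image L ?m N" "\<lambda>x. ?m +>\<^bsub>L\<^esub> x" \<sigma> by (rule pm)
  interpret mv: vectorspace K "L\<lparr>carrier := ?m\<rparr>" by (rule L.submodule_vectorspace[OF ms])
  obtain \<beta> where \<beta>: "finite \<beta>" "mv.basis \<beta>"
    using mv.finite_basis_exists[OF L.fin_dim_subspace(1)[OF ms fd]] by blast
  have \<beta>m: "\<beta> \<subseteq> ?m" using \<beta>(2) by (simp add: mv.basis_def)
  have \<beta>span: "L.span \<beta> = ?m"
    using \<beta>(2) L.span_li_not_depend(1)[OF \<beta>m ms] by (simp add: mv.basis_def)
  interpret LZ: leibniz_algebra K "L Quotm ?Z" by (rule L.Quotm_leibniz_algebra[OF Z])
  obtain G where G: "finite G" "card G = generator_number K (L Quotm ?Z)" "G \<subseteq> carrier (L Quotm ?Z)"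
    "leibniz_generated K (L Quotm ?Z) G = carrier (L Quotm ?Z)"
    using LZ.generator_number_attained[OF L.Quotm_fin_dim[OF Zs fd]] by blast
  let ?z = "\<lambda>x. ?Z +>\<^bsub>L\<^esub> x"
  \<comment> \<open>Representatives in \<open>L\<close> of a minimal generating set of \<open>L / Z\<close>.\<close>
  define S where "S = inv_into (carrier L) ?z ` G"
  have GZ: "G \<subseteq> ?z ` carrier L" using G(3) by (simp add: carrier_Quotm)
  have S: "finite S" "card S \<le> generator_number K (L Quotm ?Z)" "S \<subseteq> carrier L" "?z ` S = G"
    using G(1) card_image_le[OF G(1), of "inv_into (carrier L) ?z"] G(2) GZ
    by (auto simp: S_def inv_into_into image_inv_into_cancel[OF refl GZ] subset_iff)
  let ?C1 = "(\<lambda>(b, s). pure_tensor K L [b, s]) ` (\<beta> \<times> S)"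
  let ?C2 = "(\<lambda>(b, s). pure_tensor K L [s, b]) ` (\<beta> \<times> S)"
  let ?C = "?C1 \<union> ?C2"
  have \<beta>L: "\<beta> \<subseteq> carrier L" using \<beta>m mL by blast
  have C: "finite ?C" using \<beta>(1) S(1) by simp
  have C_sub: "?C \<subseteq> carrier (tensor_power K L 2)"
    using \<beta>L S(3) by (auto intro!: L.pure_tensor_closed simp: words_def)
  have cC: "card ?C \<le> 2 * card \<beta> * card S"
  proof -
    have "card ?C1 \<le> card \<beta> * card S" "card ?C2 \<le> card \<beta> * card S"
      using card_image_le[of "\<beta> \<times> S"] \<beta>(1) S(1) by (simp_all add: card_cartesian_product)
    then show ?thesis using card_Un_le[of ?C1 ?C2] by linarith
  qed
  interpret T2: module K "tensor_power K L 2" by (rule L.tensor_power_module)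
  interpret T3: module K "tensor_power K L 3" by (rule L.tensor_power_module)
  interpret TQ3: module K "tensor_power K (L Quotm N) 3" by (rule pm.Q.tensor_power_module)
  define Ker where "Ker = {v \<in> carrier (tensor_power K L 3).
     projection_chain_map K L N 3 v = \<zero>\<^bsub>tensor_power K (L Quotm N) 3\<^esub>}"
  define X where "X = T2.submodule_sum (leibniz_boundary K L 3 ` Ker) (T2.span ?C)"
  have pr: "projection_chain_map K L N 3 \<in> module_hom K (tensor_power K L 3) (tensor_power K (L Quotm N) 3)"
    unfolding projection_chain_map_eq
    by (rule tensor_map_hom[OF L.module_axioms pm.Q.module_axioms L.coset_hom[OF Ns]])
  have bd: "leibniz_boundary K L 3 \<in> module_hom K (tensor_power K L 3) (tensor_power K L 2)"
    using L.boundary_hom[of 3] by simp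
  have KerS: "submodule K Ker (tensor_power K L 3)"
    unfolding Ker_def
    using submodule_vimage[OF T3.module_axioms TQ3.module_axioms pr TQ3.submodule_zero] by simp
  have bdS: "submodule K (leibniz_boundary K L 3 ` Ker) (tensor_power K L 2)"
    by (rule submodule_image[OF T3.module_axioms T2.module_axioms bd KerS])
  have spS: "submodule K (T2.span ?C) (tensor_power K L 2)" by (rule T2.span_is_submodule[OF C_sub])
  have XS: "submodule K X (tensor_power K L 2)"
    unfolding X_def by (rule T2.sum_is_submodule[OF bdS spS])
  have bdX: "leibniz_boundary K L 3 ` Ker \<subseteq> X"
    unfolding X_def by (rule T2.in_sum[OF bdS spS])
  have CX: "?C \<subseteq> X"
    using T2.in_own_span[OF C_sub] T2.in_sum[OF spS bdS] T2.msum_comm[OF bdS spS] unfolding X_def by blast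
  \<comment> \<open>One entry in \<open>N\<close> makes the image of the word in \<open>L / N\<close> contain a zero.\<close>
  have bd_pure: "leibniz_boundary K L 3 (pure_tensor K L [x, y, z]) \<in> X"
    if xyz: "x \<in> carrier L" "y \<in> carrier L" "z \<in> carrier L" "x \<in> N \<or> y \<in> N \<or> z \<in> N" for x y z
  proof -
    have w: "[x, y, z] \<in> words L 3" using xyz by (simp add: words_def)
    have "\<exists>us vs. map (\<lambda>x. N +>\<^bsub>L\<^esub> x) [x, y, z] = us @ \<zero>\<^bsub>L Quotm N\<^esub> # vs"
    proof -
      have "\<zero>\<^bsub>L Quotm N\<^esub> \<in> set (map (\<lambda>x. N +>\<^bsub>L\<^esub> x) [x, y, z])"
        using xyz L.coset_eq_zero_iff[OF Ns] by auto
      then show ?thesis by (rule split_list)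
    qed
    then obtain us vs where uv: "map (\<lambda>x. N +>\<^bsub>L\<^esub> x) [x, y, z] = us @ \<zero>\<^bsub>L Quotm N\<^esub> # vs" by blast
    have "us @ \<zero>\<^bsub>L Quotm N\<^esub> # vs \<in> words (L Quotm N) 3"
      unfolding uv[symmetric] by (rule words_map[OF L.coset_hom[OF Ns] w])
    then have "pure_tensor K (L Quotm N) (us @ \<zero>\<^bsub>L Quotm N\<^esub> # vs) = \<zero>\<^bsub>tensor_power K (L Quotm N) 3\<^esub>"
      by (rule multilinear_zero[OF pm.Q.module_axioms TQ3.module_axioms pm.Q.pure_tensor_multilinear])
    then have "projection_chain_map K L N 3 (pure_tensor K L [x, y, z]) = \<zero>\<^bsub>tensor_power K (L Quotm N) 3\<^esub>"
      unfolding projection_chain_map_eq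
        tensor_map_pure[OF L.module_axioms pm.Q.module_axioms L.coset_hom[OF Ns] w] uv .
    then have "pure_tensor K L [x, y, z] \<in> Ker" using L.pure_tensor_closed[OF w] by (simp add: Ker_def)
    then show ?thesis using bdX by blast
  qed
  have base: "pure_tensor K L [b, s] \<in> X" "pure_tensor K L [s, b] \<in> X" if "b \<in> \<beta>" "s \<in> S" for b s
    using that CX by force+
  have gen: "leibniz_generated K (L Quotm ?Z) (?z ` S) = carrier (L Quotm ?Z)"
    using G(4) S(4) by simp
  have red1: "pure_tensor K L [x, y] \<in> X" if "x \<in> ?m" "y \<in> carrier L" for x y
    by (rule L.pure_tensors_reduce_to_generators(1)[OF N XS bd_pure gen \<beta>m \<beta>span S(3) base that])
  have red2: "pure_tensor K L [y, x] \<in> X" if "x \<in> ?m" "y \<in> carrier L" for x y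
    by (rule L.pure_tensors_reduce_to_generators(2)[OF N XS bd_pure gen \<beta>m \<beta>span S(3) base that])
  have ker: "pure_tensor K L xs \<in> X"
    if xs: "xs \<in> words L 2" "x \<in> set xs" "?m +>\<^bsub>L\<^esub> x = \<zero>\<^bsub>L Quotm ?m\<^esub>" for xs x
  proof -
    obtain a b where ab: "xs = [a, b]" "a \<in> carrier L" "b \<in> carrier L"
      using xs(1) by (auto simp: words_def numeral_2_eq_2 length_Suc_conv)
    have "x \<in> carrier L" using xs(2) ab by auto
    then have "x \<in> ?m" using xs(3) L.coset_eq_zero_iff[OF ms] by simp
    then consider "a \<in> ?m" | "b \<in> ?m" using xs(2) ab(1) by auto
    then show ?thesis
      using red1[OF _ ab(3)] red2[OF _ ab(2)] unfolding ab(1) by cases blast+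
  qed
  have "vectorspace.dim K (relative_HL K 2 L N)
      \<le> vectorspace.dim K (relative_HL K 2 (L Quotm ?m) (coset_image L ?m N)) + card ?C"
    by (rule pm.relative_HL_2_dim_le[OF fd L.Quotm_fin_dim[OF ms fd] carrier_Quotm[symmetric] \<sigma> C C_sub
          X_def[unfolded Ker_def] ker])
  moreover have "card ?C \<le> 2 * vectorspace.dim K (L\<lparr>carrier := ?m\<rparr>) * generator_number K (L Quotm ?Z)"
    unfolding mv.dim_basis[OF \<beta>] by (rule le_trans[OF cC mult_le_mono2[OF S(2)]])
  ultimately show ?thesis by linarith
qed

end
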